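(* Let $(X,Y),(X_1,Y_1),(X_2,Y_2),\ldots$ be i.i.d. random vectors in $\mathbb{R}^2$ with joint Lebesgue density $f$, let $f_X(x)=\int_{\mathbb{R}}f(x,y)\,dy$, let $I\subset\mathbb{R}$ be a compact interval, and let $J=I^\eta$ be its closed $\eta$-neighbourhood for some $0<\eta<1$. Assume that $f_X$ is continuous and strictly positive on $J$, and that for all $x\in J$, $\lim_{x'\to x}f(x',y)=f(x,y)$ for almost every $y\in\mathbb{R}$. Let $p\in\{0,1,2\}$ and suppose that the regression function $g(x)=\mathbb{E}[Y\mid X=x]$ is $(p+1)$ times differentiable on $J$. Let $K:\mathbb{R}\to[0,\infty)$ be a bounded measurable function with support contained in $[-1/2,1/2]$ and $\int_{\mathbb{R}}K(u)\,du=1$, such that the class $\mathcal{K}=\{K((x-\cdot)/h):h>0,\ x\in\mathbb{R}\}$ is pointwise measurable and satisfies, for some constants $C,\nu>0$, $N(\epsilon,\mathcal{K})\le C\epsilon^{-\nu}$ for $0<\epsilon<1$ (uniform covering number with the constant envelope $\|K\|_\infty$). Assume that one of the following two conditions holds, and let $(a_n)$ be a sequence of positive numbers as indicated: (a) there is $M>0$ with $|Y|\,1\{X\in J\}\le M$ almost surely, and $a_n\searrow0$ with $na_n/\log n\to\infty$; (b) for some $q>2$, $\sup_{z\in J}\mathbb{E}[|Y|^q\mid X=z]<\infty$, and $a_n=c(\log n/n)^{\gamma}$ for some $c>0$, with $\gamma=1-2/q$. Let $(b_n)$ be a sequence with $a_n<b_n$ and $b_n\searrow0$. Then, with probability 1,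 for all large enough $n$ the local polynomial regression estimator $\hat g^{(p)}_{n,h}(x_0)$ of order $p$ is well defined (the corresponding weighted least-squares problem has a unique solution) for all $x_0\in I$ and all $a_n\le h\le b_n$, and $$\sup_{a_n\le h\le b_n}\ \sup_{x_0\in I}\left|\hat g^{(p)}_{n,h}(x_0)-g(x_0)\right|\longrightarrow0\quad\text{as } n\to\infty .$$
   Context: Local polynomial regression estimator of order $p$: for $x_0\in\mathbb{R}$, $h>0$ and $n\ge1$, consider the problem of minimizing over $\beta=(\beta_0,\ldots,\beta_p)\in\mathbb{R}^{p+1}$ $$\frac1{nh}\sum_{i=1}^n\Big[Y_i-\sum_{j=0}^p\beta_j(X_i-x_0)^j\Big]^2K\left(\frac{x_0-X_i}{h}\right).$$ When the $(p+1)\times(p+1)$ matrix with entries $\frac1{nh}\sum_{i=1}^n(X_i-x_0)^{j+k}K\left(\frac{x_0-X_i}{h}\right)$, $0\le j,k\le p$, is invertible, this problem has a unique solution $\hat\beta=(\hat\beta_0,\ldots,\hat\beta_p)$, and $\hat g^{(p)}_{n,h}(x_0):=\hat\beta_0$. For $p=0$ this is the Nadaraya-Watson estimator $\sum_i Y_iK((x_0-X_i)/h)/\sum_iK((x_0-X_i)/h)$; for $p=1$ it is the local linear and for $p=2$ the local quadratic estimator. Conditional expectations given $X=z$, $z\in J$, are understood via the joint density: $\mathbb{E}[\psi(Y)\mid X=z]=\int\psi(y)f(z,y)\,dy/f_X(z)$. The neighbourhood is $I^\eta=\{x\in\mathbb{R}:|x-y|\le\eta\text{ for some }y\in I\}$.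 $u_n\searrow 0$ means that $u_n$ decreases to $0$. Pointwise measurable class: a class $\mathcal{H}$ of real-valued functions on a measurable space $(\mathcal{X},\mathcal{A})$ is pointwise measurable if there is a countable subclass $\mathcal{H}_0\subset\mathcal{H}$ such that for every $u\in\mathcal{H}$ there is a sequence $\{u_m\}$ in $\mathcal{H}_0$ with $u_m(x)\to u(x)$ for all $x\in\mathcal{X}$. Uniform covering number: for a class $\mathcal{H}$ of measurable real functions on $(\mathcal{X},\mathcal{A})$ with a finite-valued measurable envelope $H\ge\sup_{u\in\mathcal{H}}|u|$, $N(\epsilon,\mathcal{H}):=\sup_QN(\epsilon\sqrt{Q(H^2)},\mathcal{H},d_Q)$, where the supremum is over all probability measures $Q$ on $(\mathcal{X},\mathcal{A})$ with $0<Q(H^2)<\infty$, $d_Q$ is the $L_2(Q)$-metric, and $N(\epsilon,\mathcal{H},d)$ is the minimal number of balls $\{u:d(u,v)<\epsilon\}$ of $d$-radius $\epsilon$ needed to cover $\mathcal{H}$. *)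

theory Defs
  imports "HOL-Probability.Probability"
begin

definition closed_nbhd :: "real set \<Rightarrow> real \<Rightarrow> real set" where
  "closed_nbhd I \<eta> = {x. \<exists>y\<in>I. \<bar>x - y\<bar> \<le> \<eta>}"

definition marginal_density :: "(real \<times> real \<Rightarrow> real) \<Rightarrow> real \<Rightarrow> real" where
  "marginal_density f x = (\<integral>y. f (x, y) \<partial>lborel)"

definition regression_fun :: "(real \<times> real \<Rightarrow> real) \<Rightarrow> real \<Rightarrow> real" where
  "regression_fun f x = (\<integral>y. y * f (x, y) \<partial>lborel) / marginal_density f x"

text \<open>Conditional expectation of \<open>\<psi> Y\<close> given \<open>X = z\<close> for nonnegative \<open>\<psi>\<close>;
  the value \<open>\<infinity>\<close> is possible, so that a finiteness assumption on it is meaningful.\<close>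

definition cond_nn_expectation :: "(real \<times> real \<Rightarrow> real) \<Rightarrow> (real \<Rightarrow> real) \<Rightarrow> real \<Rightarrow> ennreal" where
  "cond_nn_expectation f \<psi> z =
     (\<integral>\<^sup>+y. ennreal (\<psi> y * f (z, y)) \<partial>lborel) / ennreal (marginal_density f z)"

text \<open>Derivatives are relative to \<open>J\<close>, i.e. one-sided at the end points of an interval.\<close>

definition times_differentiable_on :: "nat \<Rightarrow> (real \<Rightarrow> real) \<Rightarrow> real set \<Rightarrow> bool" where
  "times_differentiable_on m g J \<longleftrightarrow>
     (\<exists>D :: nat \<Rightarrow> real \<Rightarrow> real. (\<forall>x\<in>J. D 0 x = g x) \<and>
        (\<forall>k<m. \<forall>x\<in>J. (D k has_real_derivative D (Suc k) x) (at x within J)))"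

definition pointwise_measurable_class :: "'x measure \<Rightarrow> ('x \<Rightarrow> real) set \<Rightarrow> bool" where
  "pointwise_measurable_class A \<H> \<longleftrightarrow>
     (\<exists>\<H>\<^sub>0\<subseteq>\<H>. countable \<H>\<^sub>0 \<and>
        (\<forall>u\<in>\<H>. \<exists>s :: nat \<Rightarrow> 'x \<Rightarrow> real. (\<forall>m. s m \<in> \<H>\<^sub>0) \<and>
           (\<forall>x\<in>space A. (\<lambda>m. s m x) \<longlonglongrightarrow> u x)))"

text \<open>Minimal number of open \<open>d\<close>-balls of radius \<open>\<epsilon>\<close> with centres in \<open>V\<close> that cover \<open>\<H>\<close>;
  it is \<open>\<infinity>\<close> if no finite cover exists.\<close>

definition covering_number :: "'u set \<Rightarrow> ('u \<Rightarrow> 'u \<Rightarrow> real) \<Rightarrow> real \<Rightarrow> 'u set \<Rightarrow> enat" where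
  "covering_number V d \<epsilon> \<H> =
     (INF F\<in>{F. finite F \<and> F \<subseteq> V \<and> \<H> \<subseteq> (\<Union>v\<in>F. {u. d u v < \<epsilon>})}. enat (card F))"

definition L2_functions :: "'x measure \<Rightarrow> ('x \<Rightarrow> real) set" where
  "L2_functions Q = {v \<in> borel_measurable Q. integrable Q (\<lambda>x. (v x)\<^sup>2)}"

definition L2_distance :: "'x measure \<Rightarrow> ('x \<Rightarrow> real) \<Rightarrow> ('x \<Rightarrow> real) \<Rightarrow> real" where
  "L2_distance Q u v = sqrt (\<integral>x. (u x - v x)\<^sup>2 \<partial>Q)"

text \<open>The centres of the balls are arbitrary elements of \<open>L\<^sub>2(Q)\<close>. Requiring them to belong to
  \<open>\<H>\<close> would only change the constant \<open>C\<close> in a bound \<open>C \<epsilon>\<^sup>-\<^sup>\<nu>\<close>.\<close>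

definition uniform_covering_number ::
    "'x measure \<Rightarrow> ('x \<Rightarrow> real) \<Rightarrow> real \<Rightarrow> ('x \<Rightarrow> real) set \<Rightarrow> enat" where
  "uniform_covering_number A H \<epsilon> \<H> =
     (SUP Q\<in>{Q. prob_space Q \<and> sets Q = sets A \<and>
                0 < (\<integral>\<^sup>+x. ennreal ((H x)\<^sup>2) \<partial>Q) \<and> (\<integral>\<^sup>+x. ennreal ((H x)\<^sup>2) \<partial>Q) < \<infinity>}.
        covering_number (L2_functions Q) (L2_distance Q) (\<epsilon> * sqrt (\<integral>x. (H x)\<^sup>2 \<partial>Q)) \<H>)"

definition kernel_class :: "(real \<Rightarrow> real) \<Rightarrow> (real \<Rightarrow> real) set" where
  "kernel_class K = {(\<lambda>t. K ((x - t) / h)) | x h. h > 0}"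

definition sup_norm :: "(real \<Rightarrow> real) \<Rightarrow> real" where
  "sup_norm K = (SUP u. \<bar>K u\<bar>)"

definition lp_objective ::
    "(real \<Rightarrow> real) \<Rightarrow> nat \<Rightarrow> (nat \<Rightarrow> real) \<Rightarrow> (nat \<Rightarrow> real) \<Rightarrow> nat \<Rightarrow> real \<Rightarrow> real \<Rightarrow> (nat \<Rightarrow> real) \<Rightarrow> real"
where
  "lp_objective K p x y n h x\<^sub>0 \<beta> =
     1 / (real n * h) *
       (\<Sum>i=1..n. (y i - (\<Sum>j=0..p. \<beta> j * (x i - x\<^sub>0) ^ j))\<^sup>2 * K ((x\<^sub>0 - x i) / h))"

text \<open>The parameter space, \<open>\<real>\<close> to the power \<open>p + 1\<close>, is represented by the extensional functions
  on \<open>{0..p}\<close>, so that uniqueness of a minimizer has its usual meaning.\<close>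

definition lp_solution ::
    "(real \<Rightarrow> real) \<Rightarrow> nat \<Rightarrow> (nat \<Rightarrow> real) \<Rightarrow> (nat \<Rightarrow> real) \<Rightarrow> nat \<Rightarrow> real \<Rightarrow> real \<Rightarrow> (nat \<Rightarrow> real) \<Rightarrow> bool"
where
  "lp_solution K p x y n h x\<^sub>0 \<beta> \<longleftrightarrow>
     is_arg_min (lp_objective K p x y n h x\<^sub>0) (\<lambda>\<beta>. \<beta> \<in> {0..p} \<rightarrow>\<^sub>E UNIV) \<beta>"

definition lp_well_defined ::
    "(real \<Rightarrow> real) \<Rightarrow> nat \<Rightarrow> (nat \<Rightarrow> real) \<Rightarrow> (nat \<Rightarrow> real) \<Rightarrow> nat \<Rightarrow> real \<Rightarrow> real \<Rightarrow> bool"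
where
  "lp_well_defined K p x y n h x\<^sub>0 \<longleftrightarrow> (\<exists>!\<beta>. lp_solution K p x y n h x\<^sub>0 \<beta>)"

definition lp_estimator ::
    "(real \<Rightarrow> real) \<Rightarrow> nat \<Rightarrow> (nat \<Rightarrow> real) \<Rightarrow> (nat \<Rightarrow> real) \<Rightarrow> nat \<Rightarrow> real \<Rightarrow> real \<Rightarrow> real"
where
  "lp_estimator K p x y n h x\<^sub>0 = (THE \<beta>. lp_solution K p x y n h x\<^sub>0 \<beta>) 0"

end

theory Submission
  imports Defs
begin

text \<open>
  With \<open>\<gamma>\<^sub>j = \<beta>\<^sub>j h\<^sup>j\<close> the estimator minimises a quadratic form whose coefficients are the local empirical
  moments \<open>(1/nh) \<Sum>\<^sub>i ((X\<^sub>i - x)/h)\<^sup>k Y\<^sub>i\<^sup>l K((x - X\<^sub>i)/h)\<close>, \<open>l \<in> {0,1}\<close>. If these converge uniformly to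
  \<open>f\<^sub>X(x) g(x)\<^sup>l \<integral>(-u)\<^sup>k K(u) du\<close>, then the forms become uniformly coercive and their minimisers approach
  \<open>(g(x), 0, \<dots>, 0)\<close>, so no Taylor expansion of \<open>g\<close> is involved.

  For the uniform convergence the line is cut into cells of length \<open>a\<^sub>n\<close>. Expanding the power around an end
  point of each cell writes a local moment as a combination of sums \<open>\<Sum>\<^sub>i v(X\<^sub>i) w(X\<^sub>i, Y\<^sub>i)\<close>, where \<open>v\<close> lies in
  the kernel class and \<open>w\<close> is one of polynomially many weights, each supported on one cell. Here \<open>v\<close> may range
  over the whole class, not only over bandwidths in \<open>[a\<^sub>n, b\<^sub>n]\<close>, so pointwise measurability applies as it
  stands. For fixed \<open>w\<close> the exponential moment of the supremum over \<open>v\<close> is bounded by symmetrization; given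
  the sample, the class is covered in \<open>L\<^sub>1\<close> of the measure proportional to \<open>\<Sum>\<^sub>i |w\<^sub>i| \<delta>(X\<^sub>i)\<close>, so the
  size of the cover does not depend on \<open>n\<close>. The resulting tail bound is \<open>exp(-c n a\<^sub>n / \<tau>\<^sub>n)\<close>, where \<open>\<tau>\<^sub>n\<close> is the level
  at which \<open>Y\<close> is truncated, and \<open>n a\<^sub>n / (\<tau>\<^sub>n log n) \<rightarrow> \<infinity>\<close> makes it summable over all cells.
\<close>

section \<open>Symmetrization\<close>

text \<open>The error has to be small relative to \<open>n * h\<close> for every bandwidth
  \<open>h\<close> above \<open>a n\<close> at once. The cells achieve this without a grid or a
  peeling over \<open>h\<close>: each cell contributes an error of at most \<epsilon> n a, a window
  of length \<open>h\<close> meets at most \<open>3 * h / a\<close> cells, and the product is of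
  order \<epsilon> n h. The price is that a cell has probability only of order \<open>a\<close>, and
  the tail bound has to see this small mass. For this reason every estimate made given the sample is
  kept linear in the random total weight W, the sum of the |w_i|. The discretisation error is linear
  in W because the cover is taken in weighted L1 rather than L2; the sub-Gaussian variance is linear
  in W because one factor of each w_i^2 is bounded by the truncation level. An exponential that is
  linear in W factorises over independent observations, and its expectation is governed by the mean
  of |w|, which is at most C a. The random variance is thereby absorbed into the same
  expectation.\<close>

lemma cosh_le_exp_half_square: "cosh x \<le> exp (x\<^sup>2 / 2)" for x :: real
proof -
  have 1: "(\<lambda>n. if even n then x ^ n /\<^sub>R fact n else 0) sums cosh x"
    by (rule cosh_converges)
  have 2: "(\<lambda>n. (x\<^sup>2/2) ^ n /\<^sub>R fact n) sums exp (x\<^sup>2/2)"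
    by (rule exp_converges)
  have 3: "(\<lambda>n. if even (2*n) then x ^ (2*n) /\<^sub>R fact (2*n) else 0) sums cosh x"
    using 1 by (subst sums_mono_reindex[of "\<lambda>n. 2 * n" "\<lambda>n. if even n then x ^ n /\<^sub>R fact n else 0"])
       (auto simp: strict_mono_def elim!: evenE)
  \<comment> \<open>This lets the even part of the exponential series be compared with the series of
    exp (x^2 / 2) term by term.\<close>
  have f: "fact n * 2 ^ n \<le> (fact (2 * n) :: real)" for n
  proof (induction n)
    case (Suc n)
    have "fact (Suc n) * 2 ^ Suc n = (2 * real n + 2) * (fact n * 2 ^ n)"
      by (simp add: algebra_simps)
    also have "\<dots> \<le> (2 * real n + 2) * fact (2 * n)"
      using Suc by (intro mult_left_mono) auto
    also have "\<dots> \<le> (2 * real n + 2) * ((2 * real n + 1) * fact (2 * n))"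
      by (intro mult_left_mono) (auto simp: algebra_simps)
    also have "\<dots> = fact (2 * Suc n)"
      by (simp add: algebra_simps)
    finally show ?case .
  qed simp
  show ?thesis
  proof (rule sums_le[OF _ 3 2])
    fix n
    have "x ^ (2*n) / fact (2*n) \<le> x ^ (2*n) / (fact n * 2 ^ n)"
      by (rule divide_left_mono[OF f]) auto
    then show "(if even (2*n) then x ^ (2*n) /\<^sub>R fact (2*n) else 0) \<le> (x\<^sup>2/2) ^ n /\<^sub>R fact n"
      by (simp add: power_divide power_mult[of x 2 n, symmetric] field_simps)
  qed
qed

lemma sum_Pow_insert:
  fixes G :: "'i set \<Rightarrow> 'b::comm_monoid_add"
  assumes "finite S" "j \<notin> S"
  shows "(\<Sum>A\<in>Pow (insert j S). G A) = (\<Sum>A\<in>Pow S. G A + G (insert j A))"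
proof -
  have "(\<Sum>A\<in>Pow (insert j S). G A) = (\<Sum>A\<in>Pow S. G A) + (\<Sum>A\<in>insert j ` Pow S. G A)"
    unfolding Pow_insert using assms by (intro sum.union_disjoint) auto
  also have "(\<Sum>A\<in>insert j ` Pow S. G A) = (\<Sum>A\<in>Pow S. G (insert j A))"
    using assms by (intro sum.reindex_cong[where l = "insert j"]) (auto intro!: inj_onI)
  finally show ?thesis by (simp add: sum.distrib)
qed

text \<open>\<open>A\<close> is the set of plus signs. Summing over \<open>Pow S\<close> and
  dividing by \<open>2 ^ card S\<close> is expectation over independent Rademacher signs, without
  enlarging the probability space.\<close>

abbreviation signs :: "'i set \<Rightarrow> 'i \<Rightarrow> real" where
  "signs A i \<equiv> if i \<in> A then 1 else -1"

text \<open>Sub-Gaussianity of Rademacher sums: a new index \<open>j\<close> may or may not enter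
  \<open>A\<close>, and the two cases add up to a factor \<open>2 * cosh (e j)\<close>.\<close>

lemma sum_signs_exp_le:
  fixes e :: "'i \<Rightarrow> real"
  assumes "finite S"
  shows "(\<Sum>A\<in>Pow S. exp (\<Sum>i\<in>S. signs A i * e i)) \<le> 2 ^ card S * exp ((\<Sum>i\<in>S. (e i)\<^sup>2) / 2)"
  using assms
proof (induction S)
  case (insert j S)
  have *: "exp (\<Sum>i\<in>insert j S. signs A i * e i)
      + exp (\<Sum>i\<in>insert j S. signs (insert j A) i * e i)
     = (2 * cosh (e j)) * exp (\<Sum>i\<in>S. signs A i * e i)" if "A \<in> Pow S" for A
  proof -
    have "(\<Sum>i\<in>S. signs (insert j A) i * e i) = (\<Sum>i\<in>S. signs A i * e i)"
      using insert.hyps by (intro sum.cong) auto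
    moreover have "j \<notin> A" using that insert.hyps by auto
    ultimately show ?thesis using insert.hyps
      by (simp add: exp_add exp_diff exp_minus cosh_def field_simps)
  qed
  have "(\<Sum>A\<in>Pow (insert j S). exp (\<Sum>i\<in>insert j S. signs A i * e i))
     = (2 * cosh (e j)) * (\<Sum>A\<in>Pow S. exp (\<Sum>i\<in>S. signs A i * e i))"
    unfolding sum_Pow_insert[OF insert.hyps] sum_distrib_left by (intro sum.cong refl *)
  also have "\<dots> \<le> (2 * exp ((e j)\<^sup>2/2)) * (2 ^ card S * exp ((\<Sum>i\<in>S. (e i)\<^sup>2) / 2))"
    using insert.IH cosh_le_exp_half_square by (intro mult_mono sum_nonneg) auto
  also have "\<dots> = 2 ^ card (insert j S) * exp ((\<Sum>i\<in>insert j S. (e i)\<^sup>2) / 2)"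
    using insert.hyps by (simp add: exp_add add_divide_distrib)
  finally show ?case .
qed simp

text \<open>Since exp |x| is at most exp x + exp (-x), the two-sided version costs a factor
  2.\<close>

lemma sum_signs_exp_abs_le:
  fixes e :: "'i \<Rightarrow> real"
  assumes "finite S"
  shows "(\<Sum>A\<in>Pow S. exp \<bar>\<Sum>i\<in>S. signs A i * e i\<bar>)
    \<le> 2 ^ card S * (2 * exp ((\<Sum>i\<in>S. (e i)\<^sup>2) / 2))"
proof -
  have "(\<Sum>A\<in>Pow S. exp \<bar>\<Sum>i\<in>S. signs A i * e i\<bar>)
     \<le> (\<Sum>A\<in>Pow S. exp (\<Sum>i\<in>S. signs A i * e i)
           + exp (\<Sum>i\<in>S. signs A i * (- e i)))"
    by (intro sum_mono) (auto simp: abs_if sum_negf)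
  also have "\<dots> \<le> 2 ^ card S * (2 * exp ((\<Sum>i\<in>S. (e i)\<^sup>2) / 2))"
    using sum_signs_exp_le[OF assms, of e] sum_signs_exp_le[OF assms, of "\<lambda>i. - e i"]
    by (simp add: sum.distrib)
  finally show ?thesis .
qed

section \<open>Jensen's inequality and the passage to an independent copy\<close>

lemma (in prob_space) exp_abs_diff_expectation_le:
  fixes \<psi> :: "'a \<Rightarrow> real"
  assumes [measurable]: "\<psi> \<in> borel_measurable M" and bd: "\<And>x. \<bar>\<psi> x\<bar> \<le> c"
  shows "ennreal (exp \<bar>B - expectation \<psi>\<bar>) \<le> (\<integral>\<^sup>+y. ennreal (exp \<bar>B - \<psi> y\<bar>) \<partial>M)"
proof -
  have [simp]: "integrable M \<psi>" using bd by (intro integrable_const_bound[where B=c]) auto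
  let ?m = "expectation \<psi>"
  have int: "integrable M (\<lambda>y. exp \<bar>B - \<psi> y\<bar>)"
  proof (intro integrable_const_bound[where B="exp (\<bar>B\<bar> + c)"] AE_I2)
    fix x show "norm (exp \<bar>B - \<psi> x\<bar>) \<le> exp (\<bar>B\<bar> + c)" using bd[of x] by auto
  qed auto
  \<comment> \<open>The convex function t -> exp |B - t| lies above a supporting line at the mean
    \<open>?m\<close>. \<open>sgn\<close> selects the slope, and slope 0 serves when
    \<open>B\<close> equals the mean. Integrating the line gives Jensen's inequality.\<close>
  have key: "exp \<bar>B - ?m\<bar> * (1 + sgn (B - ?m) * (?m - \<psi> y)) \<le> exp \<bar>B - \<psi> y\<bar>" for y
  proof -
    have "exp \<bar>B - ?m\<bar> * (1 + sgn (B - ?m) * (?m - \<psi> y)) \<le> exp \<bar>B - ?m\<bar> * exp (sgn (B - ?m) * (?m - \<psi> y))"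
      by (intro mult_left_mono exp_ge_add_one_self) auto
    also have "\<dots> = exp (\<bar>B - ?m\<bar> + sgn (B - ?m) * (?m - \<psi> y))" by (simp add: exp_add)
    also have "\<dots> \<le> exp \<bar>B - \<psi> y\<bar>" by (auto simp: sgn_if)
    finally show ?thesis .
  qed
  have "exp \<bar>B - ?m\<bar> = expectation (\<lambda>y. exp \<bar>B - ?m\<bar> * (1 + sgn (B - ?m) * (?m - \<psi> y)))"
    by (simp add: prob_space)
  also have "\<dots> \<le> expectation (\<lambda>y. exp \<bar>B - \<psi> y\<bar>)"
    by (intro integral_mono int key) auto
  finally show ?thesis
    by (subst nn_integral_eq_integral[OF int]) (auto intro: ennreal_leI)
qed

context
  fixes D :: "'z measure" and V :: "'v set" and \<phi> :: "'v \<Rightarrow> 'z \<Rightarrow> real" and c :: real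
  assumes D: "prob_space D" and V: "countable V" "V \<noteq> {}"
    and \<phi>[measurable]: "\<And>v. v \<in> V \<Longrightarrow> \<phi> v \<in> borel_measurable D"
    and bd: "\<And>v z. v \<in> V \<Longrightarrow> \<bar>\<phi> v z\<bar> \<le> c"
begin

interpretation D: prob_space D by (rule D)
interpretation DD: pair_prob_space D D ..

abbreviation pairs :: "'i set \<Rightarrow> ('i \<Rightarrow> 'z \<times> 'z) measure" where
  "pairs S \<equiv> PiM S (\<lambda>_. D \<Otimes>\<^sub>M D)"

text \<open>Jensen's inequality replaces the mean by an independent copy, for each \<open>v\<close>
  separately. The offset \<open>b v\<close> stands for the contributions of all other
  observations.\<close>

lemma symmetrization_step:
  "(\<integral>\<^sup>+y. (SUP v\<in>V. ennreal (exp \<bar>b v + \<phi> v y - D.expectation (\<phi> v)\<bar>)) \<partial>D)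
    \<le> (\<integral>\<^sup>+u. (SUP v\<in>V. ennreal (exp \<bar>b v + (\<phi> v (fst u) - \<phi> v (snd u))\<bar>)) \<partial>(D \<Otimes>\<^sub>M D))"
proof -
  have "(\<integral>\<^sup>+y. (SUP v\<in>V. ennreal (exp \<bar>b v + \<phi> v y - D.expectation (\<phi> v)\<bar>)) \<partial>D)
     \<le> (\<integral>\<^sup>+y. (\<integral>\<^sup>+y'. (SUP v\<in>V. ennreal (exp \<bar>b v + (\<phi> v y - \<phi> v y')\<bar>)) \<partial>D) \<partial>D)"
  proof (intro nn_integral_mono SUP_least)
    fix y v assume "v \<in> V"
    have "ennreal (exp \<bar>(b v + \<phi> v y) - D.expectation (\<phi> v)\<bar>) \<le> (\<integral>\<^sup>+y'. ennreal (exp \<bar>(b v + \<phi> v y) - \<phi> v y'\<bar>) \<partial>D)"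
      using \<open>v \<in> V\<close> by (intro D.exp_abs_diff_expectation_le[where c = c] bd) auto
    also have "\<dots> \<le> (\<integral>\<^sup>+y'. (SUP v\<in>V. ennreal (exp \<bar>b v + (\<phi> v y - \<phi> v y')\<bar>)) \<partial>D)"
      using \<open>v \<in> V\<close> by (intro nn_integral_mono SUP_upper2) (auto simp: algebra_simps)
    finally show "ennreal (exp \<bar>b v + \<phi> v y - D.expectation (\<phi> v)\<bar>)
       \<le> (\<integral>\<^sup>+y'. (SUP v\<in>V. ennreal (exp \<bar>b v + (\<phi> v y - \<phi> v y')\<bar>)) \<partial>D)" .
  qed
  also have "\<dots> = (\<integral>\<^sup>+u. (SUP v\<in>V. ennreal (exp \<bar>b v + (\<phi> v (fst u) - \<phi> v (snd u))\<bar>)) \<partial>(D \<Otimes>\<^sub>M D))"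
    using V by (subst D.nn_integral_fst[symmetric]) auto
  finally show ?thesis .
qed

text \<open>The law of the pair is invariant under exchange of its components, which reverses the
  sign of the difference.\<close>

lemma symmetrization_swap:
  "(\<integral>\<^sup>+u. (SUP v\<in>V. ennreal (exp \<bar>b v + (\<phi> v (fst u) - \<phi> v (snd u))\<bar>)) \<partial>(D \<Otimes>\<^sub>M D))
    = (\<integral>\<^sup>+u. (SUP v\<in>V. ennreal (exp \<bar>b v + - (\<phi> v (fst u) - \<phi> v (snd u))\<bar>)) \<partial>(D \<Otimes>\<^sub>M D))"
proof -
  have meas: "(\<lambda>u. SUP v\<in>V. ennreal (exp \<bar>b v + (\<phi> v (fst u) - \<phi> v (snd u))\<bar>)) \<in> borel_measurable (D \<Otimes>\<^sub>M D)"
    by (intro borel_measurable_SUP V) measurable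
  show ?thesis
    apply (subst DD.distr_pair_swap)
    apply (subst nn_integral_distr)
      apply measurable[1]
     apply (simp add: measurable_cong_sets[OF sets_distr refl] meas)
    apply (intro nn_integral_cong SUP_cong refl arg_cong[of _ _ "\<lambda>t. ennreal (exp \<bar>t\<bar>)"])
    apply (simp add: case_prod_beta)
    done
qed

text \<open>Induction on the observations. The offset \<open>b\<close> is arbitrary because the
  value seen at the new coordinate has to be absorbed in it before the induction hypothesis applies.
  The factor \<open>2 ^ card S\<close> on the left stands for the normalisation of the sum over sign
  patterns.\<close>

lemma symmetrization:
  fixes S :: "'i set"
  assumes "finite S"
  shows "2 ^ card S * (\<integral>\<^sup>+z. (SUP v\<in>V. ennreal (exp \<bar>b v + (\<Sum>i\<in>S. \<phi> v (z i) - D.expectation (\<phi> v))\<bar>)) \<partial>PiM S (\<lambda>_. D))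
    \<le> (\<Sum>A\<in>Pow S. \<integral>\<^sup>+z. (SUP v\<in>V. ennreal (exp \<bar>b v +
         (\<Sum>i\<in>S. signs A i * (\<phi> v (fst (z i)) - \<phi> v (snd (z i))))\<bar>)) \<partial>(pairs S))"
  using assms
proof (induction S arbitrary: b)
  case empty
  have "emeasure (PiM {} (\<lambda>_::'i. D)) (space (PiM {} (\<lambda>_. D))) = 1"
    "emeasure (PiM {} (\<lambda>_::'i. D \<Otimes>\<^sub>M D)) (space (PiM {} (\<lambda>_. D \<Otimes>\<^sub>M D))) = 1"
    by (intro prob_space.emeasure_space_1 prob_space_PiM D.prob_space_axioms DD.prob_space_axioms)+
  then show ?case by simp
next
  case (insert j S)
  interpret PD: product_sigma_finite "\<lambda>_::'i. D" ..
  interpret P2: product_sigma_finite "\<lambda>_::'i. D \<Otimes>\<^sub>M D" ..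
  interpret PS: prob_space "PiM S (\<lambda>_::'i. D \<Otimes>\<^sub>M D)"
    by (intro prob_space_PiM) (rule DD.prob_space_axioms)
  interpret PS2: pair_sigma_finite D "PiM S (\<lambda>_::'i. D \<Otimes>\<^sub>M D)" ..
  let ?m = "\<lambda>v. D.expectation (\<phi> v)"
  define \<sigma> where "\<sigma> A v z = (\<Sum>i\<in>S. signs A i * (\<phi> v (fst (z i)) - \<phi> v (snd (z i))))"
    for A v and z :: "'i \<Rightarrow> 'z \<times> 'z"
  have \<sigma>_meas[measurable]: "\<sigma> A v \<in> borel_measurable (pairs S)" if "v \<in> V" for A v
    unfolding \<sigma>_def using that by measurable
  define R where "R A b = (\<integral>\<^sup>+z. (SUP v\<in>V. ennreal (exp \<bar>b v + \<sigma> A v z\<bar>)) \<partial>(pairs S))" for A b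
  \<comment> \<open>Countability of \<open>V\<close> makes the supremum jointly measurable, as the
    use of Fubini below requires.\<close>
  have J_meas: "(\<lambda>(y, z). SUP v\<in>V. ennreal (exp \<bar>(b v + \<phi> v y - ?m v) + \<sigma> A v z\<bar>))
        \<in> borel_measurable (D \<Otimes>\<^sub>M pairs S)" for A b
    unfolding case_prod_beta by (intro borel_measurable_SUP V) measurable
  have R_meas: "(\<lambda>y. R A (\<lambda>v. b v + \<phi> v y - ?m v)) \<in> borel_measurable D" for A b
    unfolding R_def by (rule PS.borel_measurable_nn_integral[OF J_meas])
  define F where "F A z = (SUP v\<in>V. ennreal (exp \<bar>b v +
         (\<Sum>i\<in>insert j S. signs A i * (\<phi> v (fst (z i)) - \<phi> v (snd (z i))))\<bar>))" for A z
  have F_meas[measurable]: "F A \<in> borel_measurable (pairs (insert j S))" for A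
    unfolding F_def by (intro borel_measurable_SUP V) measurable
  have IH: "2 ^ card S * (\<integral>\<^sup>+z. (SUP v\<in>V. ennreal (exp \<bar>b v + (\<Sum>i\<in>S. \<phi> v (z i) - ?m v)\<bar>)) \<partial>PiM S (\<lambda>_. D))
      \<le> (\<Sum>A\<in>Pow S. R A b)" for b
    using insert.IH[of b] by (simp add: R_def \<sigma>_def)
  let ?F = "\<lambda>A. \<integral>\<^sup>+z. F A z \<partial>(pairs (insert j S))"
  let ?H = "\<lambda>s A. \<integral>\<^sup>+z. (\<integral>\<^sup>+u. (SUP v\<in>V. ennreal (exp \<bar>(b v + \<sigma> A v z) + s * (\<phi> v (fst u) - \<phi> v (snd u))\<bar>)) \<partial>(D \<Otimes>\<^sub>M D)) \<partial>(pairs S)"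
  have split: "?F A = ?H (signs A j) A" for A
  proof -
    have *: "(\<Sum>i\<in>S. signs A i * (\<phi> v (fst (if i = j then u else z i)) - \<phi> v (snd (if i = j then u else z i)))) = \<sigma> A v z" for v u z
      unfolding \<sigma>_def using insert.hyps by (auto intro!: sum.cong)
    show ?thesis
      apply (subst P2.product_nn_integral_insert[OF insert.hyps F_meas])
      apply (intro nn_integral_cong)
      apply (simp only: F_def sum.insert[OF insert.hyps] fun_upd_apply * if_True simp_thms)
      apply (intro SUP_cong refl arg_cong[of _ _ "\<lambda>t. ennreal (exp \<bar>t\<bar>)"])
      apply simp
      done
  qed
  have Fsplit: "?F A = ?H (-1) A"
    "?F (insert j A) = ?H 1 A" if "A \<in> Pow S" for A
  proof -
    have "\<sigma> (insert j A) = \<sigma> A"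
      unfolding \<sigma>_def fun_eq_iff using insert.hyps by (auto intro!: sum.cong)
    moreover have "j \<notin> A" using that insert.hyps by auto
    ultimately show "?F A = ?H (-1) A"
      "?F (insert j A) = ?H 1 A" by (simp_all only: split insertI1 if_True if_False)
  qed
  have "2 ^ card (insert j S) * (\<integral>\<^sup>+z. (SUP v\<in>V. ennreal (exp \<bar>b v + (\<Sum>i\<in>insert j S. \<phi> v (z i) - ?m v)\<bar>)) \<partial>PiM (insert j S) (\<lambda>_. D))
    = 2 * (2 ^ card S * (\<integral>\<^sup>+y. \<integral>\<^sup>+z. (SUP v\<in>V. ennreal (exp \<bar>(b v + \<phi> v y - ?m v) + (\<Sum>i\<in>S. \<phi> v (z i) - ?m v)\<bar>)) \<partial>PiM S (\<lambda>_. D) \<partial>D))"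
  proof -
    have *: "(\<Sum>i\<in>S. \<phi> v (if i = j then y else z i) - ?m v) = (\<Sum>i\<in>S. \<phi> v (z i) - ?m v)" for v y z
      using insert.hyps by (intro sum.cong) auto
    have "(\<integral>\<^sup>+z. (SUP v\<in>V. ennreal (exp \<bar>b v + (\<Sum>i\<in>insert j S. \<phi> v (z i) - ?m v)\<bar>)) \<partial>PiM (insert j S) (\<lambda>_. D))
       = (\<integral>\<^sup>+y. \<integral>\<^sup>+z. (SUP v\<in>V. ennreal (exp \<bar>(b v + \<phi> v y - ?m v) + (\<Sum>i\<in>S. \<phi> v (z i) - ?m v)\<bar>)) \<partial>PiM S (\<lambda>_. D) \<partial>D)"
      apply (subst PD.product_nn_integral_insert_rev[OF insert.hyps])
       apply (intro borel_measurable_SUP V, measurable)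
      apply (intro nn_integral_cong)
      apply (simp only: sum.insert[OF insert.hyps] fun_upd_apply * if_True simp_thms)
      apply (intro SUP_cong refl arg_cong[of _ _ "\<lambda>t. ennreal (exp \<bar>t\<bar>)"])
      apply simp
      done
    then show ?thesis using insert.hyps by (simp add: mult.assoc)
  qed
  also have "\<dots> = 2 * (\<integral>\<^sup>+y. 2 ^ card S * (\<integral>\<^sup>+z. (SUP v\<in>V. ennreal (exp \<bar>(b v + \<phi> v y - ?m v) + (\<Sum>i\<in>S. \<phi> v (z i) - ?m v)\<bar>)) \<partial>PiM S (\<lambda>_. D)) \<partial>D)"
  proof -
    interpret PSD: prob_space "PiM S (\<lambda>_::'i. D)"
      by (intro prob_space_PiM) (rule D.prob_space_axioms)
    have "(\<lambda>(y, z). SUP v\<in>V. ennreal (exp \<bar>(b v + \<phi> v y - ?m v) + (\<Sum>i\<in>S. \<phi> v (z i) - ?m v)\<bar>))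
        \<in> borel_measurable (D \<Otimes>\<^sub>M PiM S (\<lambda>_. D))"
      unfolding case_prod_beta by (intro borel_measurable_SUP V) measurable
    then show ?thesis by (subst nn_integral_cmult) (auto intro: PSD.borel_measurable_nn_integral)
  qed
  also have "\<dots> \<le> 2 * (\<integral>\<^sup>+y. (\<Sum>A\<in>Pow S. R A (\<lambda>v. b v + \<phi> v y - ?m v)) \<partial>D)"
    by (intro mult_left_mono nn_integral_mono IH) auto
  also have "\<dots> = (\<Sum>A\<in>Pow S. 2 * (\<integral>\<^sup>+y. R A (\<lambda>v. b v + \<phi> v y - ?m v) \<partial>D))"
    using R_meas by (subst nn_integral_sum) (auto simp: sum_distrib_left)
  \<comment> \<open>Each sign pattern on \<open>S\<close> has two extensions to
    \<open>insert j S\<close>. The independent copy produces one of them, and the exchange of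
    components gives the other the same integral; this accounts for the factor 2.\<close>
  also have "\<dots> \<le> (\<Sum>A\<in>Pow S. ?F A + ?F (insert j A))"
  proof (intro sum_mono)
    fix A assume A: "A \<in> Pow S"
    have "(\<integral>\<^sup>+y. R A (\<lambda>v. b v + \<phi> v y - ?m v) \<partial>D)
       = (\<integral>\<^sup>+z. (\<integral>\<^sup>+y. (SUP v\<in>V. ennreal (exp \<bar>(b v + \<sigma> A v z) + \<phi> v y - ?m v\<bar>)) \<partial>D) \<partial>(pairs S))"
      unfolding R_def
      apply (subst PS2.Fubini'[OF J_meas, symmetric])
      apply (intro nn_integral_cong SUP_cong refl arg_cong[of _ _ "\<lambda>t. ennreal (exp \<bar>t\<bar>)"])
      apply simp
      done
    \<comment> \<open>After Fubini the pairs on \<open>S\<close> are frozen, so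
      \<open>b v + \<sigma> A v z\<close> acts as the offset for the new coordinate.\<close>
    also have "\<dots> \<le> ?H 1 A"
      unfolding mult_1 by (intro nn_integral_mono symmetrization_step)
    finally have 1: "(\<integral>\<^sup>+y. R A (\<lambda>v. b v + \<phi> v y - ?m v) \<partial>D) \<le> ?F (insert j A)"
      unfolding Fsplit[OF A] .
    moreover have "?F (insert j A) = ?F A"
      unfolding Fsplit[OF A] mult_1 mult_minus1 by (intro nn_integral_cong symmetrization_swap)
    ultimately show "2 * (\<integral>\<^sup>+y. R A (\<lambda>v. b v + \<phi> v y - ?m v) \<partial>D)
      \<le> ?F A + ?F (insert j A)"
      by (simp add: mult_2 add_mono)
  qed
  also have "\<dots> = (\<Sum>A\<in>Pow (insert j S). ?F A)"
    using insert.hyps by (subst sum_Pow_insert) auto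
  finally show ?case unfolding F_def .
qed

end

section \<open>Covers and exponential moments\<close>

text \<open>\<open>N\<close> does not depend on \<open>Q\<close>, which permits random measures
  built from the sample. The centres obey the bound \<kappa> because sums over them are estimated by
  their squares, and \<open>1 \<le> N\<close> keeps the resulting bounds valid when all weights
  vanish.\<close>

definition L1_cover :: "(real \<Rightarrow> real) set \<Rightarrow> real \<Rightarrow> real \<Rightarrow> nat \<Rightarrow> bool" where
  "L1_cover V \<kappa> \<delta> N \<longleftrightarrow> 1 \<le> N \<and> (\<forall>Q. prob_space Q \<longrightarrow> sets Q = sets borel \<longrightarrow>
     (\<exists>F. finite F \<and> card F \<le> N \<and> (\<forall>c\<in>F. c \<in> borel_measurable borel \<and> (\<forall>t. \<bar>c t\<bar> \<le> \<kappa>)) \<and>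
        (\<forall>v\<in>V. \<exists>c\<in>F. (\<integral>t. \<bar>v t - c t\<bar> \<partial>Q) \<le> \<delta>)))"

lemma L1_cover_mono: "L1_cover V \<kappa> \<delta> N \<Longrightarrow> W \<subseteq> V \<Longrightarrow> \<delta> \<le> \<delta>' \<Longrightarrow> L1_cover W \<kappa> \<delta>' N"
  unfolding L1_cover_def by (meson order_trans subsetD)

text \<open>The variance of |\<psi>| is nonnegative.\<close>

lemma (in prob_space) expectation_abs_le_sqrt:
  fixes \<psi> :: "'a \<Rightarrow> real"
  assumes [measurable]: "\<psi> \<in> borel_measurable M" and "integrable M (\<lambda>x. (\<psi> x)\<^sup>2)"
  shows "expectation (\<lambda>x. \<bar>\<psi> x\<bar>) \<le> sqrt (expectation (\<lambda>x. (\<psi> x)\<^sup>2))"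
proof -
  have "integrable M \<psi>"
    using assms by (rule square_integrable_imp_integrable)
  then have "variance (\<lambda>x. \<bar>\<psi> x\<bar>) = expectation (\<lambda>x. (\<psi> x)\<^sup>2) - (expectation (\<lambda>x. \<bar>\<psi> x\<bar>))\<^sup>2"
    using assms by (subst variance_eq) auto
  moreover have "0 \<le> variance (\<lambda>x. \<bar>\<psi> x\<bar>)" by (rule variance_positive)
  ultimately show ?thesis by (intro real_le_rsqrt) linarith
qed

text \<open>An L2(Q) ball lies in the L1(Q) ball of the same radius, and the constant envelope makes
  this radius the same for every \<open>Q\<close>. The given centres are arbitrary L2 functions, so
  they still have to be clipped.\<close>

lemma uniform_covering_number_L1_cover:
  fixes \<H> :: "(real \<Rightarrow> real) set"
  assumes "0 < \<kappa>" and \<H>: "\<And>v. v \<in> \<H> \<Longrightarrow> v \<in> borel_measurable borel" "\<And>v t. v \<in> \<H> \<Longrightarrow> \<bar>v t\<bar> \<le> \<kappa>"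
    and ucn: "ereal_of_enat (uniform_covering_number borel (\<lambda>_. \<kappa>) \<epsilon> \<H>) \<le> ereal r"
  shows "\<exists>N. L1_cover \<H> \<kappa> (\<epsilon> * \<kappa>) N"
proof (intro exI[of _ "Suc (nat \<lfloor>r\<rfloor>)"], unfold L1_cover_def, intro conjI allI impI)
  fix Q :: "real measure" assume Q: "prob_space Q" and sQ: "sets Q = sets borel"
  interpret Q: prob_space Q by (rule Q)
  have mQ[measurable_cong]: "sets Q = sets borel" by (rule sQ)
  let ?c = "\<lambda>Q. covering_number (L2_functions Q) (L2_distance Q) (\<epsilon> * sqrt (\<integral>x. \<kappa>\<^sup>2 \<partial>Q)) \<H>"
  have "?c Q \<le> uniform_covering_number borel (\<lambda>_. \<kappa>) \<epsilon> \<H>"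
    unfolding uniform_covering_number_def using Q sQ \<open>0 < \<kappa>\<close> Q.emeasure_space_1
    by (intro SUP_upper) (auto simp: ennreal_mult_less_top)
  then have "ereal_of_enat (?c Q) \<le> ereal r"
    using ucn by (meson ereal_of_enat_le_iff order.trans)
  \<comment> \<open>The successor makes the inequality strict: an infimum strictly below a number
    yields an actual finite cover with fewer elements than that number.\<close>
  then have "?c Q < enat (Suc (nat \<lfloor>r\<rfloor>))"
    apply (cases "?c Q")
     apply (auto)
    by linarith
  then obtain F where F: "finite F" "F \<subseteq> L2_functions Q" "\<H> \<subseteq> (\<Union>v\<in>F. {u. L2_distance Q u v < \<epsilon> * \<kappa>})"
     "card F < Suc (nat \<lfloor>r\<rfloor>)"
    using \<open>0 < \<kappa>\<close> unfolding covering_number_def INF_less_iff by (auto simp: Q.prob_space)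
  \<comment> \<open>Projection onto the interval from -\<kappa> to \<kappa>. The functions to be
    covered take their values there, so a centre moves no further from any of them.\<close>
  define cl where "cl c t = max (-\<kappa>) (min \<kappa> (c t))" for c :: "real \<Rightarrow> real" and t
  have clm: "cl c \<in> borel_measurable borel" if "c \<in> F" for c
  proof -
    have "c \<in> borel_measurable borel"
      using F(2) that by (auto simp: L2_functions_def measurable_cong_sets[OF sQ refl])
    then show ?thesis unfolding cl_def[abs_def] by measurable
  qed
  show "\<exists>F. finite F \<and> card F \<le> Suc (nat \<lfloor>r\<rfloor>) \<and> (\<forall>c\<in>F. c \<in> borel_measurable borel \<and> (\<forall>t. \<bar>c t\<bar> \<le> \<kappa>)) \<and>
        (\<forall>v\<in>\<H>. \<exists>c\<in>F. (\<integral>t. \<bar>v t - c t\<bar> \<partial>Q) \<le> \<epsilon> * \<kappa>)"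
  proof (intro exI[of _ "cl ` F"] conjI ballI)
    show "card (cl ` F) \<le> Suc (nat \<lfloor>r\<rfloor>)" using card_image_le[OF F(1), of cl] F(4) by linarith
    fix v assume v: "v \<in> \<H>"
    then obtain c where c: "c \<in> F" "L2_distance Q v c < \<epsilon> * \<kappa>" using F(3) by blast
    have [measurable]: "v \<in> borel_measurable borel" "c \<in> borel_measurable borel"
      using F(2) c(1) \<H>(1)[OF v] by (auto simp: L2_functions_def measurable_cong_sets[OF sQ refl])
    have ic: "integrable Q (\<lambda>x. (c x)\<^sup>2)" using F(2) c(1) by (auto simp: L2_functions_def)
    have ivc: "integrable Q (\<lambda>x. (v x - c x)\<^sup>2)"
    proof (rule Bochner_Integration.integrable_bound)
      show "integrable Q (\<lambda>x. 2 * \<kappa>\<^sup>2 + 2 * (c x)\<^sup>2)" using ic by auto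
      show "AE x in Q. norm ((v x - c x)\<^sup>2) \<le> norm (2 * \<kappa>\<^sup>2 + 2 * (c x)\<^sup>2)"
      proof (intro AE_I2)
        fix x
        have "(v x)\<^sup>2 \<le> \<kappa>\<^sup>2" using \<H>(2)[OF v, of x] by (metis abs_ge_zero power2_abs power_mono)
        moreover have "(v x - c x)\<^sup>2 \<le> 2 * (v x)\<^sup>2 + 2 * (c x)\<^sup>2"
          using zero_le_power2[of "v x + c x"] by (simp add: power2_eq_square algebra_simps)
        ultimately show "norm ((v x - c x)\<^sup>2) \<le> norm (2 * \<kappa>\<^sup>2 + 2 * (c x)\<^sup>2)" by simp
      qed
    qed measurable
    have clo: "\<bar>v x - cl c x\<bar> \<le> \<bar>v x - c x\<bar>" for x
      using \<H>(2)[OF v, of x] by (auto simp: cl_def)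
    have i1: "integrable Q (\<lambda>x. v x - c x)"
      using ivc by (rule Q.square_integrable_imp_integrable[rotated]) measurable
    have i2: "integrable Q (\<lambda>x. v x - cl c x)"
      using clm[OF c(1)] by (intro Bochner_Integration.integrable_bound[OF i1]) (auto simp: clo)
    have "(\<integral>t. \<bar>v t - cl c t\<bar> \<partial>Q) \<le> (\<integral>t. \<bar>v t - c t\<bar> \<partial>Q)"
      using i1 i2 clo by (intro integral_mono) auto
    also have "\<dots> \<le> L2_distance Q v c"
      unfolding L2_distance_def using ivc by (intro Q.expectation_abs_le_sqrt) auto
    finally show "\<exists>c\<in>cl ` F. (\<integral>t. \<bar>v t - c t\<bar> \<partial>Q) \<le> \<epsilon> * \<kappa>" using c by (intro bexI[of _ "cl c"]) auto
  qed (use F(1) clm \<open>0 < \<kappa>\<close> in \<open>auto simp: cl_def\<close>)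
qed simp

text \<open>The normalised weights form a probability on the index set \<open>T\<close>, and its
  image under \<open>x\<close> is the \<open>Q\<close> of the cover. Weights sit on indices, so
  coinciding points cause no trouble.\<close>

lemma L1_cover_weighted:
  fixes x :: "'t \<Rightarrow> real"
  assumes cov: "L1_cover V \<kappa> \<delta> N" and fin: "finite T" and \<omega>: "\<And>t. t \<in> T \<Longrightarrow> 0 \<le> \<omega> t" and W: "0 < (\<Sum>t\<in>T. \<omega> t)"
    and V: "\<And>v. v \<in> V \<Longrightarrow> v \<in> borel_measurable borel"
  shows "\<exists>F. finite F \<and> card F \<le> N \<and> (\<forall>c\<in>F. \<forall>t. \<bar>c t\<bar> \<le> \<kappa>) \<and>
        (\<forall>v\<in>V. \<exists>c\<in>F. (\<Sum>t\<in>T. \<omega> t * \<bar>v (x t) - c (x t)\<bar>) \<le> \<delta> * (\<Sum>t\<in>T. \<omega> t))"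
proof -
  let ?W = "\<Sum>t\<in>T. \<omega> t"
  define P where "P = point_measure T (\<lambda>t. \<omega> t / ?W)"
  define Q where "Q = distr P borel x"
  have [measurable]: "x \<in> measurable P borel" by (simp add: P_def)
  have "prob_space P"
  proof
    have "emeasure P (space P) = (\<Sum>t\<in>T. ennreal (\<omega> t / ?W))"
      unfolding P_def using fin by (simp add: space_point_measure emeasure_point_measure_finite)
    also have "\<dots> = ennreal (\<Sum>t\<in>T. \<omega> t / ?W)" using \<omega> W by (intro sum_ennreal) auto
    also have "(\<Sum>t\<in>T. \<omega> t / ?W) = 1" using W by (simp add: sum_divide_distrib[symmetric])
    finally show "emeasure P (space P) = 1" by simp
  qed
  then have "prob_space Q" unfolding Q_def by (rule prob_space.prob_space_distr) simp
  moreover have "sets Q = sets borel" by (simp add: Q_def)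
  ultimately have "\<exists>F. finite F \<and> card F \<le> N \<and> (\<forall>c\<in>F. c \<in> borel_measurable borel \<and> (\<forall>t. \<bar>c t\<bar> \<le> \<kappa>)) \<and>
        (\<forall>v\<in>V. \<exists>c\<in>F. (\<integral>t. \<bar>v t - c t\<bar> \<partial>Q) \<le> \<delta>)"
    using cov unfolding L1_cover_def by blast
  then obtain F where F: "finite F" "card F \<le> N" "\<And>c. c\<in>F \<Longrightarrow> c \<in> borel_measurable borel \<and> (\<forall>t. \<bar>c t\<bar> \<le> \<kappa>)"
     "\<And>v. v\<in>V \<Longrightarrow> \<exists>c\<in>F. (\<integral>t. \<bar>v t - c t\<bar> \<partial>Q) \<le> \<delta>"
    by auto
  have int: "(\<integral>t. \<bar>v t - c t\<bar> \<partial>Q) = (\<Sum>t\<in>T. \<omega> t * \<bar>v (x t) - c (x t)\<bar>) / ?W" if "v \<in> V" "c \<in> F" for v c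
  proof -
    have [measurable]: "v \<in> borel_measurable borel" "c \<in> borel_measurable borel" using V F that by auto
    have "(\<integral>t. \<bar>v t - c t\<bar> \<partial>Q) = (\<integral>t. \<bar>v (x t) - c (x t)\<bar> \<partial>P)"
      unfolding Q_def by (subst integral_distr) auto
    also have "\<dots> = (\<Sum>t\<in>T. \<omega> t * \<bar>v (x t) - c (x t)\<bar>) / ?W"
      unfolding P_def using fin \<omega> W
      by (subst lebesgue_integral_point_measure_finite) (auto simp: sum_divide_distrib)
    finally show ?thesis .
  qed
  show ?thesis
  proof (intro exI[of _ F] conjI ballI)
    fix v assume "v \<in> V"
    with F(4) obtain c where "c \<in> F" "(\<integral>t. \<bar>v t - c t\<bar> \<partial>Q) \<le> \<delta>" by blast
    with int[OF \<open>v \<in> V\<close> \<open>c \<in> F\<close>] W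
    show "\<exists>c\<in>F. (\<Sum>t\<in>T. \<omega> t * \<bar>v (x t) - c (x t)\<bar>) \<le> \<delta> * ?W"
      by (intro bexI[of _ c]) (auto simp: pos_divide_le_eq[symmetric])
  qed (use F in auto)
qed

text \<open>For a fixed sample the supremum is replaced by a sum over the centres of a cover. Moving
  from \<open>v\<close> to its centre costs \<open>s * \<delta>\<close> times the total weight, and
  each centre gives a sub-Gaussian sum whose exponent is linear in the total weight as well.\<close>

lemma signed_SUP_le:
  fixes x x' w w' :: "'i \<Rightarrow> real"
  assumes cov: "L1_cover V \<kappa> \<delta> N" and fin: "finite S"
    and V: "\<And>v. v \<in> V \<Longrightarrow> v \<in> borel_measurable borel"
    and w: "\<And>i. i \<in> S \<Longrightarrow> \<bar>w i\<bar> \<le> \<tau>" "\<And>i. i \<in> S \<Longrightarrow> \<bar>w' i\<bar> \<le> \<tau>" and s: "0 \<le> s"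
  shows "(\<Sum>A\<in>Pow S. SUP v\<in>V. ennreal (exp \<bar>\<Sum>i\<in>S. signs A i * (s * (v (x i) * w i) - s * (v (x' i) * w' i))\<bar>))
    \<le> ennreal (2 ^ card S * (2 * real N * exp ((s * \<delta> + s\<^sup>2 * \<kappa>\<^sup>2 * \<tau>) * (\<Sum>i\<in>S. \<bar>w i\<bar> + \<bar>w' i\<bar>))))"
proof (cases "(\<Sum>i\<in>S. \<bar>w i\<bar> + \<bar>w' i\<bar>) = 0")
  \<comment> \<open>Without weight there is nothing to normalise into a probability measure. All
    sums vanish, and \<open>1 \<le> N\<close> suffices.\<close>
  case True
  let ?d = "\<lambda>A v. \<Sum>i\<in>S. signs A i * (s * (v (x i) * w i) - s * (v (x' i) * w' i))"
  have N: "1 \<le> N" using cov by (simp add: L1_cover_def)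
  have z: "w i = 0" "w' i = 0" if "i \<in> S" for i
  proof -
    have "\<bar>w i\<bar> + \<bar>w' i\<bar> = 0"
      using True fin that by (subst (asm) sum_nonneg_eq_0_iff) auto
    then show "w i = 0" "w' i = 0" by auto
  qed
  have "(\<Sum>A\<in>Pow S. SUP v\<in>V. ennreal (exp \<bar>?d A v\<bar>))
     \<le> (\<Sum>A\<in>Pow S. 1)"
  proof (intro sum_mono SUP_least)
    fix A v
    have "?d A v = 0"
      by (intro sum.neutral) (simp add: z)
    then show "ennreal (exp \<bar>?d A v\<bar>) \<le> 1" by simp
  qed
  also have "\<dots> = ennreal (2 ^ card S)" using fin by (simp add: card_Pow ennreal_power[symmetric])
  also have "\<dots> \<le> ennreal (2 ^ card S * (2 * real N * exp ((s * \<delta> + s\<^sup>2 * \<kappa>\<^sup>2 * \<tau>) * (\<Sum>i\<in>S. \<bar>w i\<bar> + \<bar>w' i\<bar>))))"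
    unfolding True using N by (intro ennreal_leI) auto
  finally show ?thesis .
next
  case False
  define W where "W = (\<Sum>i\<in>S. \<bar>w i\<bar> + \<bar>w' i\<bar>)"
  have Wpos: "0 < W" using False sum_nonneg[of S "\<lambda>i. \<bar>w i\<bar> + \<bar>w' i\<bar>"] unfolding W_def by (simp add: less_le)
  \<comment> \<open>The sample and its independent copy need a common cover, so the weighted points
    are indexed by the disjoint sum.\<close>
  let ?T = "S <+> S"
  let ?\<Delta> = "\<lambda>v c. \<Sum>i\<in>S. \<bar>w i\<bar> * \<bar>v (x i) - c (x i)\<bar> + \<bar>w' i\<bar> * \<bar>v (x' i) - c (x' i)\<bar>"
  have sT: "(\<Sum>t\<in>?T. case t of Inl i \<Rightarrow> G i | Inr i \<Rightarrow> H i) = (\<Sum>i\<in>S. G i + H i)" for G H :: "'i \<Rightarrow> real"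
    using fin by (subst sum.Plus) (auto simp: sum.distrib)
  define d where "d c i = s * (c (x i) * w i) - s * (c (x' i) * w' i)" for c :: "real \<Rightarrow> real" and i
  obtain F where F: "finite F" "card F \<le> N" "\<And>c t. c\<in>F \<Longrightarrow> \<bar>c t\<bar> \<le> \<kappa>"
    "\<And>v. v\<in>V \<Longrightarrow> \<exists>c\<in>F. ?\<Delta> v c \<le> \<delta> * W"
  proof -
    have "\<exists>F. finite F \<and> card F \<le> N \<and> (\<forall>c\<in>F. \<forall>t. \<bar>c t\<bar> \<le> \<kappa>) \<and>
        (\<forall>v\<in>V. \<exists>c\<in>F. (\<Sum>t\<in>?T. (case t of Inl i \<Rightarrow> \<bar>w i\<bar> | Inr i \<Rightarrow> \<bar>w' i\<bar>) *
            \<bar>v (case_sum x x' t) - c (case_sum x x' t)\<bar>) \<le> \<delta> * (\<Sum>t\<in>?T. case t of Inl i \<Rightarrow> \<bar>w i\<bar> | Inr i \<Rightarrow> \<bar>w' i\<bar>))"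
      using fin Wpos by (intro L1_cover_weighted[OF cov _ _ _ V]) (auto simp: sT W_def split: sum.split)
    moreover have "(case t of Inl i \<Rightarrow> \<bar>w i\<bar> | Inr i \<Rightarrow> \<bar>w' i\<bar>) * \<bar>v (case_sum x x' t) - c (case_sum x x' t)\<bar>
       = (case t of Inl i \<Rightarrow> \<bar>w i\<bar> * \<bar>v (x i) - c (x i)\<bar> | Inr i \<Rightarrow> \<bar>w' i\<bar> * \<bar>v (x' i) - c (x' i)\<bar>)" for v c t
      by (cases t) auto
    ultimately show ?thesis using that unfolding sT W_def by (simp only: sT) blast
  qed
  have disc: "\<bar>\<Sum>i\<in>S. signs A i * d v i\<bar> \<le> s * \<delta> * W + \<bar>\<Sum>i\<in>S. signs A i * d c i\<bar>"
    if "?\<Delta> v c \<le> \<delta> * W" for A v c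
  proof -
    have "(\<Sum>i\<in>S. signs A i * d v i)
       = (\<Sum>i\<in>S. signs A i * (d v i - d c i)) + (\<Sum>i\<in>S. signs A i * d c i)"
      unfolding sum.distrib[symmetric] by (intro sum.cong) (auto simp: algebra_simps)
    moreover have "\<bar>\<Sum>i\<in>S. signs A i * (d v i - d c i)\<bar> \<le> s * ?\<Delta> v c"
      unfolding sum_distrib_left
    proof (rule sum_abs[THEN order_trans], intro sum_mono)
      fix i
      have "d v i - d c i = s * (w i * (v (x i) - c (x i)) - w' i * (v (x' i) - c (x' i)))"
        unfolding d_def by (simp add: algebra_simps)
      then have "\<bar>signs A i * (d v i - d c i)\<bar> = s * \<bar>w i * (v (x i) - c (x i)) - w' i * (v (x' i) - c (x' i))\<bar>"
        using \<open>0 \<le> s\<close> by (auto simp: abs_mult)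
      also have "\<dots> \<le> s * (\<bar>w i * (v (x i) - c (x i))\<bar> + \<bar>w' i * (v (x' i) - c (x' i))\<bar>)"
        using \<open>0 \<le> s\<close> by (intro mult_left_mono abs_triangle_ineq4)
      finally show "\<bar>signs A i * (d v i - d c i)\<bar> \<le> s * (\<bar>w i\<bar> * \<bar>v (x i) - c (x i)\<bar> + \<bar>w' i\<bar> * \<bar>v (x' i) - c (x' i)\<bar>)"
        by (simp add: abs_mult)
    qed
    moreover have "s * ?\<Delta> v c \<le> s * (\<delta> * W)"
      using that s by (intro mult_left_mono) auto
    ultimately show ?thesis by (simp add: mult.assoc)
  qed
  \<comment> \<open>In the square, one factor |w| + |w'| is bounded by \<open>2 * \<tau>\<close> and
    the other is kept. This trades a quadratic exponent for one that is linear in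
    \<open>W\<close>.\<close>
  have dsq: "(\<Sum>i\<in>S. (d c i)\<^sup>2) / 2 \<le> s\<^sup>2 * \<kappa>\<^sup>2 * \<tau> * W" if "c \<in> F" for c
  proof -
    have "(d c i)\<^sup>2 \<le> s\<^sup>2 * \<kappa>\<^sup>2 * \<tau> * 2 * (\<bar>w i\<bar> + \<bar>w' i\<bar>)" if "i \<in> S" for i
    proof -
      have "\<bar>d c i\<bar> \<le> s * (\<bar>c (x i)\<bar> * \<bar>w i\<bar> + \<bar>c (x' i)\<bar> * \<bar>w' i\<bar>)"
        using s abs_triangle_ineq4[of "s * (c (x i) * w i)" "s * (c (x' i) * w' i)"]
        by (simp add: d_def abs_mult algebra_simps)
      also have "\<dots> \<le> s * (\<kappa> * \<bar>w i\<bar> + \<kappa> * \<bar>w' i\<bar>)"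
        using s F(3)[OF \<open>c \<in> F\<close>] by (intro mult_left_mono add_mono mult_right_mono) auto
      finally have "\<bar>d c i\<bar> \<le> s * \<kappa> * (\<bar>w i\<bar> + \<bar>w' i\<bar>)" by (simp add: algebra_simps)
      then have "(d c i)\<^sup>2 \<le> (s * \<kappa> * (\<bar>w i\<bar> + \<bar>w' i\<bar>))\<^sup>2"
        by (metis abs_ge_zero power2_abs power_mono)
      also have "\<dots> = s\<^sup>2 * \<kappa>\<^sup>2 * ((\<bar>w i\<bar> + \<bar>w' i\<bar>) * (\<bar>w i\<bar> + \<bar>w' i\<bar>))"
        by (simp add: power2_eq_square algebra_simps)
      also have "\<dots> \<le> s\<^sup>2 * \<kappa>\<^sup>2 * ((2 * \<tau>) * (\<bar>w i\<bar> + \<bar>w' i\<bar>))"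
        using w[OF that] by (intro mult_left_mono mult_right_mono) auto
      finally show ?thesis by (simp add: algebra_simps)
    qed
    then have "(\<Sum>i\<in>S. (d c i)\<^sup>2) \<le> (\<Sum>i\<in>S. s\<^sup>2 * \<kappa>\<^sup>2 * \<tau> * 2 * (\<bar>w i\<bar> + \<bar>w' i\<bar>))" by (rule sum_mono)
    also have "\<dots> = s\<^sup>2 * \<kappa>\<^sup>2 * \<tau> * 2 * W" unfolding W_def by (simp add: sum_distrib_left)
    finally show ?thesis by simp
  qed
  have "(\<Sum>A\<in>Pow S. SUP v\<in>V. ennreal (exp \<bar>\<Sum>i\<in>S. signs A i * d v i\<bar>))
    \<le> (\<Sum>A\<in>Pow S. ennreal (exp (s * \<delta> * W) * (\<Sum>c\<in>F. exp \<bar>\<Sum>i\<in>S. signs A i * d c i\<bar>)))"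
  proof (intro sum_mono SUP_least ennreal_leI)
    fix A v assume "v \<in> V"
    then obtain c where c: "c \<in> F" "?\<Delta> v c \<le> \<delta> * W"
      using F(4) by blast
    have "exp \<bar>\<Sum>i\<in>S. signs A i * d v i\<bar> \<le> exp (s * \<delta> * W) * exp \<bar>\<Sum>i\<in>S. signs A i * d c i\<bar>"
      using disc[OF c(2), of A] by (simp add: exp_add[symmetric])
    also have "\<dots> \<le> exp (s * \<delta> * W) * (\<Sum>c\<in>F. exp \<bar>\<Sum>i\<in>S. signs A i * d c i\<bar>)"
      using c(1) F(1) by (intro mult_left_mono member_le_sum) auto
    finally show "exp \<bar>\<Sum>i\<in>S. signs A i * d v i\<bar> \<le> \<dots>" .
  qed
  also have "\<dots> = ennreal (\<Sum>A\<in>Pow S. exp (s * \<delta> * W) * (\<Sum>c\<in>F. exp \<bar>\<Sum>i\<in>S. signs A i * d c i\<bar>))"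
    by (intro sum_ennreal) (auto intro!: mult_nonneg_nonneg sum_nonneg)
  also have "\<dots> \<le> ennreal (2 ^ card S * (2 * real N * exp ((s * \<delta> + s\<^sup>2 * \<kappa>\<^sup>2 * \<tau>) * W)))"
  proof (intro ennreal_leI)
    have "(\<Sum>A\<in>Pow S. exp (s * \<delta> * W) * (\<Sum>c\<in>F. exp \<bar>\<Sum>i\<in>S. signs A i * d c i\<bar>))
      = exp (s * \<delta> * W) * (\<Sum>c\<in>F. \<Sum>A\<in>Pow S. exp \<bar>\<Sum>i\<in>S. signs A i * d c i\<bar>)"
      unfolding sum_distrib_left[symmetric] by (subst sum.swap) simp
    also have "\<dots> \<le> exp (s * \<delta> * W) * (\<Sum>c\<in>F. 2 ^ card S * (2 * exp (s\<^sup>2 * \<kappa>\<^sup>2 * \<tau> * W)))"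
    proof (intro mult_left_mono sum_mono)
      fix c assume "c \<in> F"
      have "(\<Sum>A\<in>Pow S. exp \<bar>\<Sum>i\<in>S. signs A i * d c i\<bar>) \<le> 2 ^ card S * (2 * exp ((\<Sum>i\<in>S. (d c i)\<^sup>2) / 2))"
        by (rule sum_signs_exp_abs_le[OF fin])
      also have "\<dots> \<le> 2 ^ card S * (2 * exp (s\<^sup>2 * \<kappa>\<^sup>2 * \<tau> * W))"
        using dsq[OF \<open>c \<in> F\<close>] by (intro mult_left_mono) auto
      finally show "(\<Sum>A\<in>Pow S. exp \<bar>\<Sum>i\<in>S. signs A i * d c i\<bar>) \<le> \<dots>" .
    qed auto
    also have "\<dots> = real (card F) * (2 ^ card S * (2 * exp (s * \<delta> * W + s\<^sup>2 * \<kappa>\<^sup>2 * \<tau> * W)))"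
      by (simp add: exp_add algebra_simps)
    also have "\<dots> \<le> real N * (2 ^ card S * (2 * exp (s * \<delta> * W + s\<^sup>2 * \<kappa>\<^sup>2 * \<tau> * W)))"
      using F(2) by (intro mult_right_mono) auto
    also have "\<dots> = 2 ^ card S * (2 * real N * exp ((s * \<delta> + s\<^sup>2 * \<kappa>\<^sup>2 * \<tau>) * W))"
      by (simp add: algebra_simps)
    finally show "(\<Sum>A\<in>Pow S. exp (s * \<delta> * W) * (\<Sum>c\<in>F. exp \<bar>\<Sum>i\<in>S. signs A i * d c i\<bar>)) \<le> \<dots>" .
  qed
  finally show ?thesis unfolding d_def W_def .
qed

section \<open>Exponential moments and tails of the supremum\<close>

lemma measurable_fst_snd_borel:
  "(fst :: real \<times> real \<Rightarrow> real) \<in> borel_measurable borel" "(snd :: real \<times> real \<Rightarrow> real) \<in> borel_measurable borel"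
  by (auto intro!: borel_measurable_continuous_onI continuous_intros)

lemma exp_le_one_plus_twice: "0 \<le> x \<Longrightarrow> x \<le> 1 \<Longrightarrow> exp x \<le> 1 + 2 * (x::real)"
  using exp_bound[of x] power_decreasing[of 1 2 x] by simp

text \<open>After symmetrization the bound is a product over independent pairs. Because of
  \<open>\<theta> * \<tau> \<le> 1\<close>, the exponential of
  \<open>\<theta> * \<bar>w z\<bar>\<close> is at most one plus twice its argument, so that its mean
  involves \<open>m\<close>, the mean of |w|, rather than the level \<tau>. This is where the
  smallness of a cell enters.\<close>

lemma exp_moment_SUP_le:
  fixes D :: "(real \<times> real) measure" and S :: "'i set"
  assumes D: "prob_space D" and sD[measurable_cong]: "sets D = sets borel" and fin: "finite S"
    and w[measurable]: "w \<in> borel_measurable borel" and w\<tau>: "\<And>z. \<bar>w z\<bar> \<le> \<tau>" and wm: "(\<integral>z. \<bar>w z\<bar> \<partial>D) \<le> m"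
    and V: "countable V" "V \<noteq> {}" and Vm: "\<And>v. v \<in> V \<Longrightarrow> v \<in> borel_measurable borel"
    and V\<kappa>: "\<And>v t. v \<in> V \<Longrightarrow> \<bar>v t\<bar> \<le> \<kappa>"
    and cov: "L1_cover V \<kappa> \<delta> N" and nn: "0 \<le> s" "0 \<le> \<delta>" and \<theta>: "\<theta> = s * \<delta> + s\<^sup>2 * \<kappa>\<^sup>2 * \<tau>" "\<theta> * \<tau> \<le> 1"
  shows "(\<integral>\<^sup>+z. (SUP v\<in>V. ennreal (exp \<bar>\<Sum>i\<in>S. s * (v (fst (z i)) * w (z i)) - (\<integral>z. s * (v (fst z) * w z) \<partial>D)\<bar>)) \<partial>PiM S (\<lambda>_. D))
    \<le> ennreal (2 * real N * exp (4 * \<theta> * m * real (card S)))"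
proof -
  interpret D: prob_space D by (rule D)
  interpret DD: pair_prob_space D D ..
  interpret P2: product_sigma_finite "\<lambda>_::'i. D \<Otimes>\<^sub>M D" ..
  have \<tau>0: "0 \<le> \<tau>" using w\<tau>[of undefined] by linarith
  have \<kappa>0: "0 \<le> \<kappa>" using V(2) V\<kappa> by (metis abs_ge_zero all_not_in_conv order_trans)
  have \<theta>0: "0 \<le> \<theta>" using nn \<tau>0 by (simp add: \<theta>)
  let ?\<phi> = "\<lambda>v z. s * (v (fst z) * w z)"
  let ?C = "2 ^ card S * (2 * real N)"
  note [measurable] = measurable_fst_snd_borel
  have \<phi>m: "?\<phi> v \<in> borel_measurable D" if "v \<in> V" for v
    using Vm[OF that] by measurable
  have one: "(\<integral>\<^sup>+z. ennreal (exp (\<theta> * \<bar>w z\<bar>)) \<partial>D) \<le> ennreal (exp (2 * \<theta> * m))"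
  proof -
    have iw: "integrable D (\<lambda>z. \<bar>w z\<bar>)"
      using w\<tau> by (intro D.integrable_const_bound[where B=\<tau>]) auto
    have "(\<integral>\<^sup>+z. ennreal (exp (\<theta> * \<bar>w z\<bar>)) \<partial>D) \<le> (\<integral>\<^sup>+z. ennreal (1 + 2 * \<theta> * \<bar>w z\<bar>) \<partial>D)"
    proof (intro nn_integral_mono ennreal_leI)
      fix z
      have "\<theta> * \<bar>w z\<bar> \<le> 1" using \<theta>(2) mult_left_mono[OF w\<tau> \<theta>0, of z] by linarith
      then show "exp (\<theta> * \<bar>w z\<bar>) \<le> 1 + 2 * \<theta> * \<bar>w z\<bar>"
        using exp_le_one_plus_twice[of "\<theta> * \<bar>w z\<bar>"] \<theta>0 by simp
    qed
    also have "\<dots> = ennreal (\<integral>z. 1 + 2 * \<theta> * \<bar>w z\<bar> \<partial>D)"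
      using iw \<theta>0 by (intro nn_integral_eq_integral) auto
    also have "(\<integral>z. 1 + 2 * \<theta> * \<bar>w z\<bar> \<partial>D) = 1 + 2 * \<theta> * (\<integral>z. \<bar>w z\<bar> \<partial>D)"
      using iw by (simp add: D.prob_space)
    also have "\<dots> \<le> 1 + 2 * \<theta> * m" using wm \<theta>0 by (intro add_left_mono mult_left_mono) auto
    also have "\<dots> \<le> exp (2 * \<theta> * m)" by (rule exp_ge_add_one_self)
    finally show ?thesis by (simp add: ennreal_leI)
  qed
  \<comment> \<open>A pair carries two independent weights, hence 4 in place of 2.\<close>
  have two: "(\<integral>\<^sup>+u. ennreal (exp (\<theta> * (\<bar>w (fst u)\<bar> + \<bar>w (snd u)\<bar>))) \<partial>(D \<Otimes>\<^sub>M D)) \<le> ennreal (exp (4 * \<theta> * m))"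
  proof -
    have "(\<integral>\<^sup>+u. ennreal (exp (\<theta> * (\<bar>w (fst u)\<bar> + \<bar>w (snd u)\<bar>))) \<partial>(D \<Otimes>\<^sub>M D))
       = (\<integral>\<^sup>+y. \<integral>\<^sup>+y'. ennreal (exp (\<theta> * \<bar>w y\<bar>)) * ennreal (exp (\<theta> * \<bar>w y'\<bar>)) \<partial>D \<partial>D)"
      by (subst D.nn_integral_fst[symmetric]) (auto simp: distrib_left exp_add ennreal_mult)
    also have "\<dots> = (\<integral>\<^sup>+y. ennreal (exp (\<theta> * \<bar>w y\<bar>)) \<partial>D) * (\<integral>\<^sup>+y. ennreal (exp (\<theta> * \<bar>w y\<bar>)) \<partial>D)"
      by (simp add: nn_integral_cmult nn_integral_multc)
    also have "\<dots> \<le> ennreal (exp (2 * \<theta> * m)) * ennreal (exp (2 * \<theta> * m))"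
      by (intro mult_mono one) auto
    also have "\<dots> = ennreal (exp (4 * \<theta> * m))"
      by (simp add: ennreal_mult[symmetric] exp_add[symmetric])
    finally show ?thesis .
  qed
  let ?L = "(\<integral>\<^sup>+z. (SUP v\<in>V. ennreal (exp \<bar>\<Sum>i\<in>S. s * (v (fst (z i)) * w (z i)) - (\<integral>z. s * (v (fst z) * w z) \<partial>D)\<bar>)) \<partial>PiM S (\<lambda>_. D))"
  have bd: "\<bar>?\<phi> v z\<bar> \<le> s * (\<kappa> * \<tau>)" if "v \<in> V" for v z
    unfolding abs_mult using nn V\<kappa>[OF that] w\<tau> \<kappa>0 by (intro mult_mono) auto
  have "2 ^ card S * ?L \<le> (\<Sum>A\<in>Pow S. \<integral>\<^sup>+z. (SUP v\<in>V. ennreal (exp \<bar>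
         (\<Sum>i\<in>S. signs A i * (?\<phi> v (fst (z i)) - ?\<phi> v (snd (z i))))\<bar>)) \<partial>PiM S (\<lambda>_. D \<Otimes>\<^sub>M D))"
  proof -
    define \<phi> where "\<phi> = ?\<phi>"
    have "\<And>v. v \<in> V \<Longrightarrow> \<phi> v \<in> borel_measurable D" "\<And>v z. v \<in> V \<Longrightarrow> \<bar>\<phi> v z\<bar> \<le> s * (\<kappa> * \<tau>)"
      unfolding \<phi>_def by (fact \<phi>m, fact bd)
    from symmetrization[where b = "\<lambda>_. 0", OF D V this fin] show ?thesis by (simp add: \<phi>_def)
  qed
  also have "\<dots> = (\<integral>\<^sup>+z. (\<Sum>A\<in>Pow S. SUP v\<in>V. ennreal (exp \<bar>
         (\<Sum>i\<in>S. signs A i * (?\<phi> v (fst (z i)) - ?\<phi> v (snd (z i))))\<bar>)) \<partial>PiM S (\<lambda>_. D \<Otimes>\<^sub>M D))"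
  proof (intro nn_integral_sum[symmetric] borel_measurable_SUP V)
    fix A v assume "v \<in> V"
    note [measurable] = Vm[OF this]
    show "(\<lambda>z. ennreal (exp \<bar>(\<Sum>i\<in>S. signs A i * (?\<phi> v (fst (z i)) - ?\<phi> v (snd (z i))))\<bar>))
      \<in> borel_measurable (PiM S (\<lambda>_. D \<Otimes>\<^sub>M D))" by measurable
  qed
  also have "\<dots> \<le> (\<integral>\<^sup>+z. ennreal ?C * (\<Prod>i\<in>S. ennreal (exp (\<theta> * (\<bar>w (fst (z i))\<bar> + \<bar>w (snd (z i))\<bar>)))) \<partial>PiM S (\<lambda>_. D \<Otimes>\<^sub>M D))"
  proof (intro nn_integral_mono)
    fix z
    have "(\<Sum>A\<in>Pow S. SUP v\<in>V. ennreal (exp \<bar>(\<Sum>i\<in>S. signs A i * (?\<phi> v (fst (z i)) - ?\<phi> v (snd (z i))))\<bar>))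
      \<le> ennreal (2 ^ card S * (2 * real N * exp (\<theta> * (\<Sum>i\<in>S. \<bar>w (fst (z i))\<bar> + \<bar>w (snd (z i))\<bar>))))"
      unfolding \<theta> using signed_SUP_le[OF cov fin Vm, of "\<lambda>i. w (fst (z i))" \<tau> "\<lambda>i. w (snd (z i))" s
         "\<lambda>i. fst (fst (z i))" "\<lambda>i. fst (snd (z i))"] w\<tau> nn \<kappa>0 by simp
    also have "\<dots> = ennreal ?C * (\<Prod>i\<in>S. ennreal (exp (\<theta> * (\<bar>w (fst (z i))\<bar> + \<bar>w (snd (z i))\<bar>))))"
      using fin by (simp add: sum_distrib_left exp_sum prod_ennreal ennreal_mult[symmetric] prod_nonneg mult.assoc)
    finally show "(\<Sum>A\<in>Pow S. SUP v\<in>V. ennreal (exp \<bar>(\<Sum>i\<in>S. signs A i * (?\<phi> v (fst (z i)) - ?\<phi> v (snd (z i))))\<bar>)) \<le> \<dots>" .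
  qed
  also have "\<dots> = ennreal ?C * (\<integral>\<^sup>+z. (\<Prod>i\<in>S. ennreal (exp (\<theta> * (\<bar>w (fst (z i))\<bar> + \<bar>w (snd (z i))\<bar>)))) \<partial>PiM S (\<lambda>_. D \<Otimes>\<^sub>M D))"
    by (intro nn_integral_cmult) measurable
  also have "\<dots> = ennreal ?C * (\<Prod>i\<in>S. (\<integral>\<^sup>+u. ennreal (exp (\<theta> * (\<bar>w (fst u)\<bar> + \<bar>w (snd u)\<bar>))) \<partial>(D \<Otimes>\<^sub>M D)))"
    using fin by (subst P2.product_nn_integral_prod[where f = "\<lambda>_ u. ennreal (exp (\<theta> * (\<bar>w (fst u)\<bar> + \<bar>w (snd u)\<bar>)))"]) auto
  also have "\<dots> \<le> ennreal ?C * (\<Prod>i\<in>S. ennreal (exp (4 * \<theta> * m)))"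
    using two by (auto intro!: mult_left_mono power_mono)
  also have "\<dots> = 2 ^ card S * ennreal (2 * real N * exp (4 * \<theta> * m * real (card S)))"
  proof -
    have 1: "(\<Prod>i\<in>S. ennreal (exp (4 * \<theta> * m))) = ennreal (exp (4 * \<theta> * m * real (card S)))"
      by (simp add: ennreal_power exp_of_nat_mult[symmetric] mult.commute)
    have 2: "(2::ennreal) ^ card S = ennreal (2 ^ card S)"
      by (simp add: ennreal_power[symmetric])
    show ?thesis unfolding 1 2 by (simp add: ennreal_mult[symmetric] mult.assoc)
  qed
  finally show ?thesis
    by (subst (asm) ennreal_mult_le_mult_iff) (auto simp: power_eq_top_ennreal)
qed

text \<open>Chernoff's bound: Markov's inequality for the exponential of the scaled supremum. The
  scale \<open>s\<close> and the radius \<delta> stay free, to be balanced later against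
  \<open>m\<close> and \<tau>.\<close>

lemma (in prob_space) empirical_deviation_tail:
  fixes Z :: "nat \<Rightarrow> 'a \<Rightarrow> real \<times> real"
  assumes ind: "indep_vars (\<lambda>_. borel) Z UNIV" and dist: "\<And>i. distr M borel (Z i) = D" and "1 \<le> n"
    and w[measurable]: "w \<in> borel_measurable borel" and w\<tau>: "\<And>z. \<bar>w z\<bar> \<le> \<tau>" and wm: "(\<integral>z. \<bar>w z\<bar> \<partial>D) \<le> m"
    and V: "countable V" "V \<noteq> {}" and Vm: "\<And>v. v \<in> V \<Longrightarrow> v \<in> borel_measurable borel"
    and V\<kappa>: "\<And>v t. v \<in> V \<Longrightarrow> \<bar>v t\<bar> \<le> \<kappa>"
    and cov: "L1_cover V \<kappa> \<delta> N" and nn: "0 < s" "0 \<le> \<delta>" and \<theta>: "\<theta> = s * \<delta> + s\<^sup>2 * \<kappa>\<^sup>2 * \<tau>" "\<theta> * \<tau> \<le> 1"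
  shows "{\<omega>\<in>space M. \<exists>v\<in>V. t < \<bar>(\<Sum>i=1..n. v (fst (Z i \<omega>)) * w (Z i \<omega>)) - real n * (\<integral>z. v (fst z) * w z \<partial>D)\<bar>} \<in> events"
    and "prob {\<omega>\<in>space M. \<exists>v\<in>V. t < \<bar>(\<Sum>i=1..n. v (fst (Z i \<omega>)) * w (Z i \<omega>)) - real n * (\<integral>z. v (fst z) * w z \<partial>D)\<bar>}
      \<le> 2 * real N * exp (4 * \<theta> * m * real n - s * t)"
proof -
  have [measurable]: "Z i \<in> borel_measurable M" for i using ind by (auto simp: indep_vars_def)
  note [measurable] = measurable_fst_snd_borel
  let ?S = "{1..n}"
  let ?dev = "\<lambda>v \<omega>. (\<Sum>i=1..n. v (fst (Z i \<omega>)) * w (Z i \<omega>)) - real n * (\<integral>z. v (fst z) * w z \<partial>D)"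
  have D: "prob_space D" using prob_space_distr[of "Z 0" borel] dist by simp
  have sD[measurable_cong]: "sets D = sets borel" using dist[of 0] sets_distr by blast
  show meas: "{\<omega>\<in>space M. \<exists>v\<in>V. t < \<bar>?dev v \<omega>\<bar>} \<in> events"
  proof -
    have "{\<omega>\<in>space M. \<exists>v\<in>V. t < \<bar>?dev v \<omega>\<bar>} = (\<Union>v\<in>V. {\<omega>\<in>space M. t < \<bar>?dev v \<omega>\<bar>})" by auto
    also have "\<dots> \<in> events"
    proof (intro sets.countable_UN'' V(1))
      fix v assume "v \<in> V"
      note [measurable] = Vm[OF this]
      show "{\<omega>\<in>space M. t < \<bar>?dev v \<omega>\<bar>} \<in> events" by measurable
    qed
    finally show ?thesis .
  qed
  define U where "U \<omega> = (SUP v\<in>V. ennreal (exp \<bar>s * ?dev v \<omega>\<bar>))" for \<omega>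
  define G where "G z = (SUP v\<in>V. ennreal (exp \<bar>\<Sum>i\<in>?S. s * (v (fst (z i)) * w (z i)) - (\<integral>z. s * (v (fst z) * w z) \<partial>D)\<bar>))" for z
  have Gm: "G \<in> borel_measurable (PiM ?S (\<lambda>_. borel))"
    unfolding G_def
  proof (intro borel_measurable_SUP V(1))
    fix v assume "v \<in> V"
    note [measurable] = Vm[OF this]
    show "(\<lambda>z. ennreal (exp \<bar>\<Sum>i\<in>?S. s * (v (fst (z i)) * w (z i)) - (\<integral>z. s * (v (fst z) * w z) \<partial>D)\<bar>)) \<in> borel_measurable (PiM ?S (\<lambda>_. borel))"
      by measurable
  qed
  have UG: "U \<omega> = G (\<lambda>i\<in>?S. Z i \<omega>)" for \<omega>
    unfolding U_def G_def
    by (intro SUP_cong refl arg_cong[of _ _ "\<lambda>t. ennreal (exp \<bar>t\<bar>)"])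
       (simp add: sum_subtractf right_diff_distrib sum_distrib_left)
  have Um[measurable]: "U \<in> borel_measurable M"
    unfolding U_def
  proof (intro borel_measurable_SUP V(1))
    fix v assume "v \<in> V"
    note [measurable] = Vm[OF this]
    show "(\<lambda>\<omega>. ennreal (exp \<bar>s * ?dev v \<omega>\<bar>)) \<in> borel_measurable M" by measurable
  qed
  have "indep_vars (\<lambda>_. borel) Z ?S" using ind by (rule indep_vars_subset) auto
  then have pim: "distr M (PiM ?S (\<lambda>_. borel)) (\<lambda>\<omega>. \<lambda>i\<in>?S. Z i \<omega>) = PiM ?S (\<lambda>_. D)"
    using \<open>1 \<le> n\<close> by (subst (asm) indep_vars_iff_distr_eq_PiM) (auto simp: dist)
  have "(\<integral>\<^sup>+\<omega>. U \<omega> \<partial>M) = (\<integral>\<^sup>+z. G z \<partial>distr M (PiM ?S (\<lambda>_. borel)) (\<lambda>\<omega>. \<lambda>i\<in>?S. Z i \<omega>))"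
    unfolding UG using Gm by (subst nn_integral_distr) auto
  also have "\<dots> = (\<integral>\<^sup>+z. G z \<partial>PiM ?S (\<lambda>_. D))" by (simp only: pim)
  also have "\<dots> \<le> ennreal (2 * real N * exp (4 * \<theta> * m * real (card ?S)))"
    unfolding G_def
    by (rule exp_moment_SUP_le[where \<kappa> = \<kappa> and \<delta> = \<delta> and \<tau> = \<tau>])
       (fact D sD w w\<tau> wm V Vm V\<kappa> cov \<theta> nn less_imp_le[OF nn(1)] | simp)+
  finally have Uint: "(\<integral>\<^sup>+\<omega>. U \<omega> \<partial>M) \<le> ennreal (2 * real N * exp (4 * \<theta> * m * real n))" by simp
  have "emeasure M {\<omega>\<in>space M. \<exists>v\<in>V. t < \<bar>?dev v \<omega>\<bar>} \<le> emeasure M {\<omega>\<in>space M. 1 \<le> ennreal (exp (- s * t)) * U \<omega>}"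
  proof (intro emeasure_mono subsetI)
    fix \<omega> assume "\<omega> \<in> {\<omega>\<in>space M. \<exists>v\<in>V. t < \<bar>?dev v \<omega>\<bar>}"
    then obtain v where v: "v \<in> V" "t < \<bar>?dev v \<omega>\<bar>" and \<omega>: "\<omega> \<in> space M" by auto
    have "s * t \<le> s * \<bar>?dev v \<omega>\<bar>" using v(2) nn by (intro mult_left_mono) auto
    then have "s * t \<le> \<bar>s * ?dev v \<omega>\<bar>" using nn by (simp add: abs_mult)
    then have "ennreal 1 \<le> ennreal (exp (- s * t) * exp \<bar>s * ?dev v \<omega>\<bar>)"
      by (intro ennreal_leI) (simp add: exp_add[symmetric])
    also have "\<dots> = ennreal (exp (- s * t)) * ennreal (exp \<bar>s * ?dev v \<omega>\<bar>)" by (simp add: ennreal_mult)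
    also have "\<dots> \<le> ennreal (exp (- s * t)) * U \<omega>"
      unfolding U_def using v(1) by (intro mult_left_mono SUP_upper) auto
    finally show "\<omega> \<in> {\<omega>\<in>space M. 1 \<le> ennreal (exp (- s * t)) * U \<omega>}" using \<omega> by simp
  qed measurable
  also have "\<dots> \<le> ennreal (exp (- s * t)) * (\<integral>\<^sup>+\<omega>. U \<omega> * indicator (space M) \<omega> \<partial>M)"
    by (rule nn_integral_Markov_inequality) auto
  also have "\<dots> = ennreal (exp (- s * t)) * (\<integral>\<^sup>+\<omega>. U \<omega> \<partial>M)"
    by (intro arg_cong2[of _ _ _ _ "(*)"] refl nn_integral_cong) auto
  also have "\<dots> \<le> ennreal (exp (- s * t)) * ennreal (2 * real N * exp (4 * \<theta> * m * real n))"
    by (intro mult_left_mono Uint) auto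
  also have "\<dots> = ennreal (2 * real N * exp (4 * \<theta> * m * real n - s * t))"
    by (simp add: ennreal_mult[symmetric] exp_diff exp_minus field_simps)
  finally show "prob {\<omega>\<in>space M. \<exists>v\<in>V. t < \<bar>?dev v \<omega>\<bar>} \<le> 2 * real N * exp (4 * \<theta> * m * real n - s * t)"
    by (simp add: emeasure_eq_measure ennreal_le_iff)
qed

section \<open>Weighted least squares\<close>

text \<open>Extensional functions on \<open>{0..p}\<close> are a product over all naturals with the
  factor \<open>{undefined}\<close> beyond \<open>p\<close>, so Tychonoff's theorem applies.\<close>

lemma compact_PiE_cube: "compact ({0..p::nat} \<rightarrow>\<^sub>E {-R..R::real})"
proof -
  have "{0..p} \<rightarrow>\<^sub>E {-R..R} = PiE UNIV (\<lambda>i. if i \<le> p then {-R..R} else {undefined})"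
    by (auto simp: PiE_def Pi_def extensional_def split: if_splits)
  moreover have "compactin (product_topology (\<lambda>_. euclidean) UNIV) (PiE UNIV (\<lambda>i. if i \<le> p then {-R..R} else {undefined}))"
    by (subst compactin_PiE) auto
  ultimately show ?thesis by (simp add: euclidean_product_topology)
qed

text \<open>The form attains a positive minimum on the compact unit sphere, and homogeneity of
  degree two extends the bound to all vectors. Coordinates beyond \<open>p\<close> do not enter, so
  vectors may be normalised within the extensional functions.\<close>

lemma positive_quadratic_form_coercive:
  fixes A :: "nat \<Rightarrow> nat \<Rightarrow> real" and p :: nat
  defines "q \<equiv> \<lambda>\<gamma>. \<Sum>j=0..p. \<Sum>k=0..p. \<gamma> j * \<gamma> k * A j k"
  assumes pos: "\<And>\<gamma>. (\<exists>j\<le>p. \<gamma> j \<noteq> 0) \<Longrightarrow> 0 < q \<gamma>"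
  shows "\<exists>\<Lambda>>0. \<forall>\<gamma>. \<Lambda> * (\<Sum>j=0..p. (\<gamma> j)\<^sup>2) \<le> q \<gamma>"
proof -
  let ?C = "{0..p} \<rightarrow>\<^sub>E {-1..1::real}"
  let ?N = "\<lambda>\<gamma>::nat \<Rightarrow> real. \<Sum>j=0..p. (\<gamma> j)\<^sup>2"
  have cc: "continuous_on UNIV (\<lambda>\<gamma>::nat \<Rightarrow> real. \<gamma> j)" for j
    by (rule continuous_on_product_coordinates)
  have cN: "continuous_on UNIV ?N" by (intro continuous_intros cc)
  have cq: "continuous_on UNIV q" unfolding q_def by (intro continuous_intros cc)
  have "compact (?C \<inter> {\<gamma>. ?N \<gamma> = 1})"
    using cN by (intro compact_Int_closed compact_PiE_cube closed_Collect_eq) (auto intro: continuous_intros)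
  moreover have "(\<lambda>i\<in>{0..p}. if i = 0 then 1 else 0) \<in> ?C \<inter> {\<gamma>. ?N \<gamma> = 1}"
    by (auto simp: sum.atLeast_Suc_atMost)
  ultimately have "\<exists>\<gamma>0\<in>?C \<inter> {\<gamma>. ?N \<gamma> = 1}. \<forall>\<gamma>\<in>?C \<inter> {\<gamma>. ?N \<gamma> = 1}. q \<gamma>0 \<le> q \<gamma>"
    by (intro continuous_attains_inf continuous_on_subset[OF cq subset_UNIV]) blast+
  then obtain \<gamma>0 where \<gamma>0: "\<gamma>0 \<in> ?C \<inter> {\<gamma>. ?N \<gamma> = 1}" "\<And>\<gamma>. \<gamma> \<in> ?C \<inter> {\<gamma>. ?N \<gamma> = 1} \<Longrightarrow> q \<gamma>0 \<le> q \<gamma>"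
    by auto
  have "\<exists>j\<le>p. \<gamma>0 j \<noteq> 0"
  proof (rule ccontr)
    assume "\<not> ?thesis" then have "?N \<gamma>0 = 0" by (intro sum.neutral) auto
    with \<gamma>0(1) show False by simp
  qed
  then have "0 < q \<gamma>0" by (rule pos)
  moreover have "q \<gamma>0 * ?N \<gamma> \<le> q \<gamma>" for \<gamma>
  proof (cases "?N \<gamma> = 0")
    case True
    then have "\<gamma> j = 0" if "j \<le> p" for j
      using that by (subst (asm) sum_nonneg_eq_0_iff) auto
    then have "q \<gamma> = 0" unfolding q_def by (intro sum.neutral) auto
    with True show ?thesis by simp
  next
    case False
    define s where "s = sqrt (?N \<gamma>)"
    have "0 \<le> ?N \<gamma>" by (intro sum_nonneg) auto
    with False have s: "0 < s" "s\<^sup>2 = ?N \<gamma>" by (auto simp: s_def)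
    define \<gamma>' where "\<gamma>' = (\<lambda>j\<in>{0..p}. \<gamma> j / s)"
    have N': "?N \<gamma>' = 1"
    proof -
      have "?N \<gamma>' = (\<Sum>j=0..p. (\<gamma> j)\<^sup>2 / s\<^sup>2)"
        by (intro sum.cong) (auto simp: \<gamma>'_def power_divide)
      also have "\<dots> = 1" using s False by (simp add: sum_divide_distrib[symmetric])
      finally show ?thesis .
    qed
    have "\<gamma>' j \<in> {-1..1}" if "j \<in> {0..p}" for j
    proof -
      have "(\<gamma>' j)\<^sup>2 \<le> ?N \<gamma>'" using that by (intro member_le_sum) auto
      then have "\<bar>\<gamma>' j\<bar> \<le> 1" unfolding N' by (simp add: abs_square_le_1)
      then show ?thesis by auto
    qed
    then have "\<gamma>' \<in> ?C" by (auto simp: \<gamma>'_def)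
    then have "q \<gamma>0 \<le> q \<gamma>'" using N' by (intro \<gamma>0(2)) auto
    moreover have "q \<gamma> = s\<^sup>2 * q \<gamma>'"
      unfolding q_def sum_distrib_left
      using s(1) by (intro sum.cong refl) (auto simp: \<gamma>'_def power2_eq_square)
    ultimately show ?thesis unfolding s(2)[symmetric] by (simp add: mult.commute mult_right_mono)
  qed
  ultimately show ?thesis by blast
qed

section \<open>Moments of the kernel\<close>

lemma weighted_kernel_integrable:
  fixes K c :: "real \<Rightarrow> real"
  assumes [measurable]: "K \<in> borel_measurable borel" "c \<in> borel_measurable borel"
    and K: "\<And>u. \<bar>K u\<bar> \<le> \<kappa>" "\<And>u. 1/2 < \<bar>u\<bar> \<Longrightarrow> K u = 0" and c: "\<And>u. \<bar>u\<bar> \<le> 1/2 \<Longrightarrow> \<bar>c u\<bar> \<le> B"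
  shows "integrable lborel (\<lambda>u. c u * K u)"
proof (rule Bochner_Integration.integrable_bound)
  show "integrable lborel (\<lambda>u::real. (B * \<kappa>) * indicator {-1/2..1/2} u)" by simp
  show "AE u in lborel. norm (c u * K u) \<le> norm (B * \<kappa> * indicator {-1/2..1/2} u)"
  proof (intro AE_I2)
    fix u show "norm (c u * K u) \<le> norm (B * \<kappa> * indicator {-1/2..1/2} u)"
    proof (cases "\<bar>u\<bar> \<le> 1/2")
      case True
      then have "\<bar>c u\<bar> * \<bar>K u\<bar> \<le> B * \<kappa>" using c[OF True] K(1)[of u] by (intro mult_mono) auto
      moreover have "u \<in> {-1/2..1/2}" using True by auto
      ultimately show ?thesis using abs_ge_self[of "B * \<kappa>"] by (simp add: abs_mult[of "c u" "K u"])
    next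
      case False then show ?thesis using K(2)[of u] by auto
    qed
  qed
qed measurable

lemma abs_power_le_one: "\<bar>u\<bar> \<le> 1 \<Longrightarrow> \<bar>u ^ k\<bar> \<le> (1::real)"
  by (simp add: power_abs power_le_one)

text \<open>The sign arises because the design variable \<open>(t - x) / h\<close> is the negative
  of the argument \<open>(x - t) / h\<close> of the kernel.\<close>

abbreviation kernel_moment :: "(real \<Rightarrow> real) \<Rightarrow> nat \<Rightarrow> real" where
  "kernel_moment K k \<equiv> \<integral>u. (-u) ^ k * K u \<partial>lborel"

text \<open>The form is the integral of P^2 K, where P is the polynomial with coefficients \<gamma>
  evaluated at \<open>-u\<close>. A nonzero P has finitely many roots, so if the integral vanished,
  then \<open>K\<close> would vanish almost everywhere, against its total mass 1.\<close>

lemma moment_form_coercive: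
  fixes K :: "real \<Rightarrow> real"
  assumes Km[measurable]: "K \<in> borel_measurable borel" and K0: "\<And>u. 0 \<le> K u" and K\<kappa>: "\<And>u. K u \<le> \<kappa>"
    and Ks: "\<And>u. 1/2 < \<bar>u\<bar> \<Longrightarrow> K u = 0" and K1: "(\<integral>u. K u \<partial>lborel) = 1"
  shows "\<exists>\<Lambda>>0. \<forall>\<gamma>. \<Lambda> * (\<Sum>j=0..p. (\<gamma> j)\<^sup>2) \<le> (\<Sum>j=0..p. \<Sum>k=0..p. \<gamma> j * \<gamma> k * kernel_moment K (j + k))"
proof (rule positive_quadratic_form_coercive)
  fix \<gamma> :: "nat \<Rightarrow> real" assume \<gamma>: "\<exists>j\<le>p. \<gamma> j \<noteq> 0"
  let ?P = "\<lambda>u::real. \<Sum>j=0..p. \<gamma> j * (-u)^j"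
  have int: "integrable lborel (\<lambda>u. (-u)^k * K u)" for k
    using K0 K\<kappa> Ks by (intro weighted_kernel_integrable[where \<kappa>=\<kappa> and B=1] abs_power_le_one) auto
  have sq: "(?P u)\<^sup>2 * K u = (\<Sum>j=0..p. \<Sum>k=0..p. \<gamma> j * \<gamma> k * ((-u)^(j+k) * K u))" for u
    unfolding power2_eq_square sum_product
    unfolding sum_distrib_right
    by (intro sum.cong refl) (simp add: power_add algebra_simps)
  have eq: "(\<Sum>j=0..p. \<Sum>k=0..p. \<gamma> j * \<gamma> k * kernel_moment K (j + k)) = (\<integral>u. (?P u)\<^sup>2 * K u \<partial>lborel)"
    unfolding sq using int by (simp add: Bochner_Integration.integral_sum)
  have int2: "integrable lborel (\<lambda>u. (?P u)\<^sup>2 * K u)"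
    unfolding sq using int by auto
  have fin: "finite {u. ?P u = 0}"
  proof -
    have "finite {z. (\<Sum>j\<le>p. \<gamma> j * z^j) = 0}"
      unfolding polyfun_finite_roots by (rule \<gamma>)
    then have "finite (uminus ` {z. (\<Sum>j\<le>p. \<gamma> j * z^j) = 0})" by simp
    moreover have "{u. ?P u = 0} \<subseteq> uminus ` {z. (\<Sum>j\<le>p. \<gamma> j * z^j) = 0}"
    proof
      fix u assume "u \<in> {u. ?P u = 0}"
      then show "u \<in> uminus ` {z. (\<Sum>j\<le>p. \<gamma> j * z^j) = 0}"
        by (intro image_eqI[of _ _ "-u"]) (auto simp: atLeast0AtMost)
    qed
    ultimately show ?thesis by (rule finite_subset[rotated])
  qed
  have "0 \<le> (\<integral>u. (?P u)\<^sup>2 * K u \<partial>lborel)" using K0 by simp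
  moreover have "(\<integral>u. (?P u)\<^sup>2 * K u \<partial>lborel) \<noteq> 0"
  proof
    assume "(\<integral>u. (?P u)\<^sup>2 * K u \<partial>lborel) = 0"
    then have "AE u in lborel. (?P u)\<^sup>2 * K u = 0"
      using int2 K0 by (subst (asm) integral_nonneg_eq_0_iff_AE) auto
    moreover have "AE u in lborel. u \<notin> {u. ?P u = 0}"
      using fin by (intro AE_not_in countable_imp_null_set_lborel) (rule countable_finite)
    ultimately have "AE u in lborel. K u = 0" by eventually_elim auto
    then have "(\<integral>u. K u \<partial>lborel) = 0" by (rule integral_eq_zero_AE)
    with K1 show False by simp
  qed
  ultimately show "0 < (\<Sum>j=0..p. \<Sum>k=0..p. \<gamma> j * \<gamma> k * kernel_moment K (j + k))"
    unfolding eq by linarith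
qed

section \<open>Existence, uniqueness and stability in coercive least squares\<close>

definition wls_objective :: "'i set \<Rightarrow> ('i \<Rightarrow> real) \<Rightarrow> ('i \<Rightarrow> real) \<Rightarrow> ('i \<Rightarrow> real) \<Rightarrow> nat \<Rightarrow> (nat \<Rightarrow> real) \<Rightarrow> real" where
  "wls_objective A c u y p \<gamma> = (\<Sum>i\<in>A. c i * (y i - (\<Sum>j=0..p. \<gamma> j * u i ^ j))\<^sup>2)"

text \<open>In the application \<open>u\<close> is the rescaled design
  \<open>(x i - x\<^sub>0) / h\<close> and \<open>c\<close> are the kernel weights divided by
  \<open>n * h\<close>. Coercivity expresses invertibility of the design matrix, and the explicit
  constant \<Lambda> also measures how far the minimiser can move.\<close>

context
  fixes A :: "'i set" and c u y :: "'i \<Rightarrow> real" and p :: nat and \<Lambda> :: real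
  assumes c0: "\<And>i. i \<in> A \<Longrightarrow> 0 \<le> c i" and \<Lambda>: "0 < \<Lambda>"
    and coer: "\<And>\<gamma>. \<Lambda> * (\<Sum>j=0..p. (\<gamma> j)\<^sup>2) \<le> (\<Sum>i\<in>A. c i * (\<Sum>j=0..p. \<gamma> j * u i ^ j)\<^sup>2)"
begin

abbreviation "obj \<equiv> wls_objective A c u y p"

text \<open>A vector doing at least as well as 0 satisfies \<Lambda> |\<gamma>|^2 \<le> 2 obj
  \<gamma> + 2 Y \<le> 4 Y, where Y is the value at 0. A minimum over a large enough cube is
  therefore global.\<close>

lemma wls_minimizer_exists:
  "\<exists>\<gamma>\<in>{0..p} \<rightarrow>\<^sub>E UNIV. \<forall>\<gamma>'\<in>{0..p} \<rightarrow>\<^sub>E UNIV. obj \<gamma> \<le> obj \<gamma>'"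
proof -
  define Y where "Y = (\<Sum>i\<in>A. c i * (y i)\<^sup>2)"
  \<comment> \<open>\<open>4 * Y / \<Lambda>\<close> bounds the squared norm of every competitor
    that is no worse than 0. Adding 1 gives \<open>R \<le> R\<^sup>2\<close>, so that
    \<open>R\<close> also bounds the coordinates themselves.\<close>
  define R where "R = 4 * Y / \<Lambda> + 1"
  have "0 \<le> Y" unfolding Y_def using c0 by (intro sum_nonneg) auto
  then have R: "1 \<le> R" using \<Lambda> by (simp add: R_def)
  let ?C = "{0..p} \<rightarrow>\<^sub>E {-R..R}"
  let ?z = "\<lambda>j\<in>{0..p}. 0::real"
  have z: "?z \<in> ?C" using R by auto
  have cont: "continuous_on UNIV obj"
    unfolding wls_objective_def by (intro continuous_intros continuous_on_product_coordinates)
  obtain \<gamma> where \<gamma>: "\<gamma> \<in> ?C" "\<And>\<gamma>'. \<gamma>' \<in> ?C \<Longrightarrow> obj \<gamma> \<le> obj \<gamma>'"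
  proof -
    have "\<exists>\<gamma>\<in>?C. \<forall>\<gamma>'\<in>?C. obj \<gamma> \<le> obj \<gamma>'"
      by (rule continuous_attains_inf[OF compact_PiE_cube _ continuous_on_subset[OF cont subset_UNIV]]) (use z in blast)
    then show ?thesis using that by auto
  qed
  have zY: "obj ?z = Y"
    unfolding wls_objective_def Y_def by (intro sum.cong refl) simp
  have "obj \<gamma> \<le> obj \<gamma>'" if \<gamma>': "\<gamma>' \<in> {0..p} \<rightarrow>\<^sub>E UNIV" for \<gamma>'
  proof (cases "obj \<gamma>' \<le> Y")
    case False then show ?thesis using \<gamma>(2)[OF z] zY by linarith
  next
    case True
    have "\<Lambda> * (\<Sum>j=0..p. (\<gamma>' j)\<^sup>2) \<le> (\<Sum>i\<in>A. c i * (\<Sum>j=0..p. \<gamma>' j * u i ^ j)\<^sup>2)" by (rule coer)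
    also have "\<dots> \<le> (\<Sum>i\<in>A. c i * (2 * (y i - (\<Sum>j=0..p. \<gamma>' j * u i ^ j))\<^sup>2 + 2 * (y i)\<^sup>2))"
    proof (intro sum_mono mult_left_mono c0)
      fix i
      show "(\<Sum>j=0..p. \<gamma>' j * u i ^ j)\<^sup>2 \<le> 2 * (y i - (\<Sum>j=0..p. \<gamma>' j * u i ^ j))\<^sup>2 + 2 * (y i)\<^sup>2"
        using zero_le_power2[of "2 * y i - (\<Sum>j=0..p. \<gamma>' j * u i ^ j)"] by (simp add: power2_eq_square algebra_simps)
    qed
    also have "\<dots> = 2 * obj \<gamma>' + 2 * Y"
      unfolding wls_objective_def Y_def by (simp add: sum.distrib sum_distrib_left algebra_simps)
    also have "\<dots> \<le> 4 * Y" using True by simp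
    finally have le: "(\<Sum>j=0..p. (\<gamma>' j)\<^sup>2) \<le> 4 * Y / \<Lambda>" using \<Lambda> by (simp add: field_simps)
    have "\<gamma>' j \<in> {-R..R}" if "j \<in> {0..p}" for j
    proof -
      have "(\<gamma>' j)\<^sup>2 \<le> (\<Sum>j=0..p. (\<gamma>' j)\<^sup>2)" using that by (intro member_le_sum) auto
      also have "\<dots> \<le> R" using le by (simp add: R_def)
      also have "\<dots> \<le> R\<^sup>2" using R by (simp add: power2_eq_square)
      finally have "\<bar>\<gamma>' j\<bar> \<le> \<bar>R\<bar>" by (simp add: abs_le_square_iff)
      then show ?thesis using R by auto
    qed
    then have "\<gamma>' \<in> ?C" using \<gamma>' by (auto simp: PiE_def Pi_def)
    then show ?thesis by (rule \<gamma>(2))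
  qed
  moreover have "\<gamma> \<in> {0..p} \<rightarrow>\<^sub>E UNIV" using \<gamma>(1) by (auto simp: PiE_def Pi_def)
  ultimately show ?thesis by blast
qed

text \<open>Parallelogram identity: at the midpoint \<open>m\<close> of two minimisers the objective
  drops by a quarter of the form at their difference \<open>d\<close>, and coercivity then forces
  \<open>d\<close> to vanish.\<close>

lemma wls_minimizer_unique:
  assumes "\<gamma> \<in> {0..p} \<rightarrow>\<^sub>E UNIV" "\<And>\<gamma>'. \<gamma>' \<in> {0..p} \<rightarrow>\<^sub>E UNIV \<Longrightarrow> obj \<gamma> \<le> obj \<gamma>'"
    and "\<beta> \<in> {0..p} \<rightarrow>\<^sub>E UNIV" "\<And>\<gamma>'. \<gamma>' \<in> {0..p} \<rightarrow>\<^sub>E UNIV \<Longrightarrow> obj \<beta> \<le> obj \<gamma>'"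
  shows "\<gamma> = \<beta>"
proof -
  let ?P = "\<lambda>\<gamma> i. \<Sum>j=0..p. \<gamma> j * u i ^ j"
  define m where "m = (\<lambda>j\<in>{0..p}. (\<gamma> j + \<beta> j) / 2)"
  define d where "d j = \<gamma> j - \<beta> j" for j
  have Pm: "?P m i = (?P \<gamma> i + ?P \<beta> i) / 2" for i
    unfolding m_def sum.distrib[symmetric] sum_divide_distrib by (intro sum.cong refl) (auto simp: field_simps)
  have Pd: "?P d i = ?P \<gamma> i - ?P \<beta> i" for i
    unfolding d_def by (simp add: sum_subtractf left_diff_distrib)
  have "obj m = (\<Sum>i\<in>A. c i * (y i - ?P \<gamma> i)\<^sup>2 / 2 + c i * (y i - ?P \<beta> i)\<^sup>2 / 2 - c i * (?P d i)\<^sup>2 / 4)"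
    unfolding wls_objective_def Pm Pd by (intro sum.cong refl) (simp add: power2_eq_square field_simps)
  also have "\<dots> = obj \<gamma> / 2 + obj \<beta> / 2 - (\<Sum>i\<in>A. c i * (?P d i)\<^sup>2) / 4"
    unfolding wls_objective_def by (simp add: sum.distrib sum_subtractf sum_divide_distrib)
  finally have "(\<Sum>i\<in>A. c i * (?P d i)\<^sup>2) \<le> 0"
    using assms(2)[of m] assms(4)[of m] by (simp add: m_def)
  with coer[of d] have "\<Lambda> * (\<Sum>j=0..p. (d j)\<^sup>2) \<le> 0" by linarith
  then have "(\<Sum>j=0..p. (d j)\<^sup>2) \<le> 0" using \<Lambda> by (simp add: mult_le_0_iff)
  moreover have "0 \<le> (\<Sum>j=0..p. (d j)\<^sup>2)" by (intro sum_nonneg) auto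
  ultimately have "(\<Sum>j=0..p. (d j)\<^sup>2) = 0" by linarith
  then have "\<gamma> j = \<beta> j" if "j \<le> p" for j
    using that by (subst (asm) sum_nonneg_eq_0_iff) (auto simp: d_def)
  then show ?thesis using assms(1,3) by (intro PiE_ext[of \<gamma> "{0..p}" "\<lambda>_. UNIV" \<beta>]) auto
qed

text \<open>The competitor \<beta> represents the constant polynomial \<open>g\<close>. Expanding
  the square around it, minimality bounds \<Lambda> D^2 by the residual moments paired with
  \<open>d\<close>, which is linear in D, the norm of \<open>d\<close>. One factor D
  cancels.\<close>

lemma wls_minimizer_close:
  assumes \<gamma>: "\<And>\<gamma>'. \<gamma>' \<in> {0..p} \<rightarrow>\<^sub>E UNIV \<Longrightarrow> obj \<gamma> \<le> obj \<gamma>'"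
    and e: "\<And>j. j \<le> p \<Longrightarrow> \<bar>(\<Sum>i\<in>A. c i * (y i - g) * u i ^ j)\<bar> \<le> \<epsilon>"
  shows "\<bar>\<gamma> 0 - g\<bar> \<le> 2 * \<epsilon> * (real p + 1) / \<Lambda>"
proof -
  let ?P = "\<lambda>\<gamma> i. \<Sum>j=0..p. \<gamma> j * u i ^ j"
  define \<beta> where "\<beta> = (\<lambda>j\<in>{0..p}. if j = 0 then g else 0)"
  define d where "d j = \<gamma> j - \<beta> j" for j
  define D where "D = sqrt (\<Sum>j=0..p. (d j)\<^sup>2)"
  have nn: "0 \<le> (\<Sum>j=0..p. (d j)\<^sup>2)" by (intro sum_nonneg) auto
  have D2: "D\<^sup>2 = (\<Sum>j=0..p. (d j)\<^sup>2)" using nn by (simp add: D_def)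
  have D0: "0 \<le> D" using nn by (simp add: D_def)
  have dD: "\<bar>d j\<bar> \<le> D" if "j \<le> p" for j
  proof -
    have "(d j)\<^sup>2 \<le> (\<Sum>j=0..p. (d j)\<^sup>2)" using that by (intro member_le_sum) auto
    then show ?thesis unfolding D2[symmetric] using D0 by (metis abs_le_square_iff abs_of_nonneg)
  qed
  have P\<beta>: "?P \<beta> i = g" for i
    by (simp add: \<beta>_def sum.atLeast_Suc_atMost)
  have Pd: "?P d i = ?P \<gamma> i - g" for i
    unfolding d_def P\<beta>[of i, symmetric] by (simp add: sum_subtractf left_diff_distrib)
  have "obj \<gamma> = (\<Sum>i\<in>A. c i * (y i - g)\<^sup>2 + c i * (?P d i)\<^sup>2 - 2 * (c i * (y i - g) * ?P d i))"
    unfolding wls_objective_def Pd by (intro sum.cong refl) (simp add: power2_eq_square algebra_simps)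
  also have "\<dots> = obj \<beta> + (\<Sum>i\<in>A. c i * (?P d i)\<^sup>2) - 2 * (\<Sum>i\<in>A. c i * (y i - g) * ?P d i)"
    unfolding wls_objective_def P\<beta> by (simp add: sum.distrib sum_subtractf sum_distrib_left)
  finally have "(\<Sum>i\<in>A. c i * (?P d i)\<^sup>2) \<le> 2 * (\<Sum>i\<in>A. c i * (y i - g) * ?P d i)"
    using \<gamma>[of \<beta>] by (simp add: \<beta>_def)
  with coer[of d] have "\<Lambda> * D\<^sup>2 \<le> 2 * (\<Sum>i\<in>A. c i * (y i - g) * ?P d i)" by (simp add: D2)
  also have "(\<Sum>i\<in>A. c i * (y i - g) * ?P d i) = (\<Sum>j=0..p. d j * (\<Sum>i\<in>A. c i * (y i - g) * u i ^ j))"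
    unfolding sum_distrib_left by (subst sum.swap) (simp add: mult_ac)
  also have "\<dots> \<le> (\<Sum>j=0..p. D * \<epsilon>)"
  proof (intro sum_mono)
    fix j assume "j \<in> {0..p}"
    have "d j * (\<Sum>i\<in>A. c i * (y i - g) * u i ^ j) \<le> \<bar>d j\<bar> * \<bar>\<Sum>i\<in>A. c i * (y i - g) * u i ^ j\<bar>"
      by (simp add: abs_mult[symmetric])
    also have "\<dots> \<le> D * \<epsilon>" using \<open>j \<in> {0..p}\<close> D0 by (intro mult_mono dD e) auto
    finally show "d j * (\<Sum>i\<in>A. c i * (y i - g) * u i ^ j) \<le> D * \<epsilon>" .
  qed
  also have "\<dots> = (real p + 1) * (D * \<epsilon>)" by simp
  finally have main: "\<Lambda> * D\<^sup>2 \<le> 2 * ((real p + 1) * (D * \<epsilon>))" by simp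
  have "0 \<le> \<epsilon>" using e[of 0] by linarith
  have "D \<le> 2 * \<epsilon> * (real p + 1) / \<Lambda>"
  proof (cases "D = 0")
    case True then show ?thesis using \<open>0 \<le> \<epsilon>\<close> \<Lambda> by simp
  next
    case False
    with D0 have "0 < D" by simp
    have "D * (\<Lambda> * D) \<le> D * (2 * \<epsilon> * (real p + 1))" using main by (simp add: power2_eq_square mult_ac)
    then have "\<Lambda> * D \<le> 2 * \<epsilon> * (real p + 1)" using \<open>0 < D\<close> by (rule mult_left_le_imp_le)
    then show ?thesis using \<Lambda> by (simp add: field_simps)
  qed
  moreover have "\<bar>\<gamma> 0 - g\<bar> \<le> D" using dD[of 0] by (simp add: d_def \<beta>_def)
  ultimately show ?thesis by linarith
qed

end

text \<open>Multiplying the j-th coefficient by h^j is a bijection of the parameter space that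
  preserves the objective, so solutions correspond. The intercept is multiplied by h^0 = 1, hence
  the estimator is \<open>\<gamma> 0\<close>.\<close>

lemma lp_estimator_close:
  fixes K :: "real \<Rightarrow> real"
  assumes K0: "\<And>u. 0 \<le> K u" and h: "0 < h" and \<Lambda>: "0 < \<Lambda>"
    and coer: "\<And>\<gamma>. \<Lambda> * (\<Sum>j=0..p. (\<gamma> j)\<^sup>2)
       \<le> (\<Sum>i=1..n. K ((x\<^sub>0 - x i) / h) / (real n * h) * (\<Sum>j=0..p. \<gamma> j * ((x i - x\<^sub>0) / h) ^ j)\<^sup>2)"
    and e: "\<And>j. j \<le> p \<Longrightarrow> \<bar>(\<Sum>i=1..n. K ((x\<^sub>0 - x i) / h) / (real n * h) * (y i - g) * ((x i - x\<^sub>0) / h) ^ j)\<bar> \<le> \<epsilon>"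
  shows "lp_well_defined K p x y n h x\<^sub>0" and "\<bar>lp_estimator K p x y n h x\<^sub>0 - g\<bar> \<le> 2 * \<epsilon> * (real p + 1) / \<Lambda>"
proof -
  let ?c = "\<lambda>i. K ((x\<^sub>0 - x i) / h) / (real n * h)" and ?u = "\<lambda>i. (x i - x\<^sub>0) / h"
  let ?E = "{0..p} \<rightarrow>\<^sub>E (UNIV::real set)"
  let ?ob = "wls_objective {1..n} ?c ?u y p"
  have c0: "0 \<le> ?c i" for i using K0 h by simp
  define sc where "sc \<beta> = (\<lambda>j\<in>{0..p}. \<beta> j * h ^ j)" for \<beta> :: "nat \<Rightarrow> real"
  define us where "us \<gamma> = (\<lambda>j\<in>{0..p}. \<gamma> j / h ^ j)" for \<gamma> :: "nat \<Rightarrow> real"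
  have scE: "sc \<beta> \<in> ?E" "us \<beta> \<in> ?E" for \<beta> by (auto simp: sc_def us_def)
  have scus: "sc (us \<gamma>) = \<gamma>" "us (sc \<gamma>) = \<gamma>" if "\<gamma> \<in> ?E" for \<gamma>
    using that h by (auto simp: sc_def us_def fun_eq_iff PiE_def extensional_def)
  have obj: "lp_objective K p x y n h x\<^sub>0 \<beta> = ?ob (sc \<beta>)" for \<beta>
  proof -
    have 1: "(\<Sum>j=0..p. \<beta> j * (x i - x\<^sub>0) ^ j) = (\<Sum>j=0..p. sc \<beta> j * ((x i - x\<^sub>0) / h) ^ j)" for i
      using h by (intro sum.cong refl) (auto simp: sc_def power_divide)
    show ?thesis
      unfolding lp_objective_def wls_objective_def 1
      unfolding sum_distrib_left by (intro sum.cong refl) simp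
  qed
  have min_iff: "lp_solution K p x y n h x\<^sub>0 \<beta> \<longleftrightarrow> \<beta> \<in> ?E \<and> (\<forall>\<gamma>\<in>?E. ?ob (sc \<beta>) \<le> ?ob \<gamma>)" for \<beta>
    unfolding lp_solution_def is_arg_min_linorder obj using scE scus by metis
  note ex = wls_minimizer_exists[OF c0 \<Lambda> coer, where y = y]
  note un = wls_minimizer_unique[OF c0 \<Lambda> coer, where y = y]
  note cl = wls_minimizer_close[OF c0 \<Lambda> coer, where y = y]
  obtain \<gamma> where \<gamma>: "\<gamma> \<in> ?E" "\<And>\<gamma>'. \<gamma>' \<in> ?E \<Longrightarrow> ?ob \<gamma> \<le> ?ob \<gamma>'" using ex by blast
  have sol: "lp_solution K p x y n h x\<^sub>0 (us \<gamma>)" unfolding min_iff using \<gamma> scus scE by auto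
  have uniq: "\<beta> = us \<gamma>" if "lp_solution K p x y n h x\<^sub>0 \<beta>" for \<beta>
  proof -
    have "sc \<beta> = \<gamma>" using that[unfolded min_iff] \<gamma> scE by (intro un) auto
    then show ?thesis using that[unfolded min_iff] scus by auto
  qed
  show "lp_well_defined K p x y n h x\<^sub>0" unfolding lp_well_defined_def using sol uniq by blast
  have "(THE \<beta>. lp_solution K p x y n h x\<^sub>0 \<beta>) = us \<gamma>" using sol uniq by (rule the_equality)
  then have "lp_estimator K p x y n h x\<^sub>0 = \<gamma> 0" by (simp add: lp_estimator_def us_def)
  moreover have "\<bar>\<gamma> 0 - g\<bar> \<le> 2 * \<epsilon> * (real p + 1) / \<Lambda>" using \<gamma>(2) e by (rule cl)
  ultimately show "\<bar>lp_estimator K p x y n h x\<^sub>0 - g\<bar> \<le> 2 * \<epsilon> * (real p + 1) / \<Lambda>" by simp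
qed

section \<open>Decomposition into cells\<close>

text \<open>The monomial is centred at the left end point and measured in units of the cell length,
  which keeps it bounded by 1. Cutting with \<open>J\<close> confines it to the region where density
  and moments are controlled.\<close>

definition cell_weight :: "real set \<Rightarrow> real \<Rightarrow> int \<Rightarrow> nat \<Rightarrow> real \<Rightarrow> real" where
  "cell_weight J a j m t = indicator ({real_of_int j * a..<(real_of_int j + 1) * a} \<inter> J) t * ((t - real_of_int j * a) / a) ^ m"

lemma cell_index_unique:
  assumes "0 < a"
  shows "t \<in> {real_of_int j * a..<(real_of_int j + 1) * a} \<longleftrightarrow> j = \<lfloor>t / a\<rfloor>"
  unfolding eq_commute[of j] floor_eq_iff using assms by (auto simp: field_simps)

lemma cell_weight_measurable:
  assumes [measurable]: "J \<in> sets borel"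
  shows "cell_weight J a j m \<in> borel_measurable borel"
  unfolding cell_weight_def[abs_def] by measurable

lemma cell_weight_abs_le:
  assumes "0 < a" shows "\<bar>cell_weight J a j m t\<bar> \<le> indicator ({real_of_int j * a..<(real_of_int j + 1) * a} \<inter> J) t"
proof (cases "t \<in> {real_of_int j * a..<(real_of_int j + 1) * a} \<inter> J")
  case True
  then have "0 \<le> (t - real_of_int j * a) / a" "(t - real_of_int j * a) / a \<le> 1"
    using assms by (auto simp: field_simps)
  then have "\<bar>((t - real_of_int j * a) / a) ^ m\<bar> \<le> 1" by (intro abs_power_le_one) auto
  then show ?thesis using True by (simp add: cell_weight_def)
qed (simp add: cell_weight_def)

lemma cell_weight_mult_le:
  assumes "0 < a" "\<bar>y\<bar> \<le> \<tau>"
  shows "\<bar>cell_weight J a j m t * y\<bar> \<le> \<tau>"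
proof -
  have "\<bar>cell_weight J a j m t\<bar> \<le> 1"
    using cell_weight_abs_le[OF assms(1), of J j m t] by (rule order_trans) (simp add: indicator_def)
  then have "\<bar>cell_weight J a j m t\<bar> * \<bar>y\<bar> \<le> 1 * \<tau>" using assms(2) by (intro mult_mono) auto
  then show ?thesis by (simp add: abs_mult)
qed

abbreviation cells :: "real \<Rightarrow> real \<Rightarrow> real \<Rightarrow> int set" where
  "cells a l r \<equiv> {\<lfloor>l / a\<rfloor>..\<lfloor>r / a\<rfloor>}"

text \<open>On the one cell containing \<open>t\<close>, the binomial theorem is applied to (t -
  x)/h = (t - j a)/h + (j a - x)/h. The coefficients depend on \<open>x\<close> and \<open>h\<close>
  but not on \<open>t\<close>, so bounds for the cell weights pass to all locations and bandwidths
  by linearity. The window lies in \<open>J\<close>, so cutting the cells by \<open>J\<close> loses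
  nothing.\<close>

lemma kernel_cell_decomposition:
  fixes K :: "real \<Rightarrow> real"
  assumes a: "0 < a" and h: "0 < h" and Ks: "\<And>u. 1/2 < \<bar>u\<bar> \<Longrightarrow> K u = 0" and J: "{x - h/2..x + h/2} \<subseteq> J"
  shows "((t - x) / h) ^ k * K ((x - t) / h) =
    (\<Sum>j\<in>cells a (x - h/2) (x + h/2). \<Sum>m\<le>k.
       (real (k choose m) * (a / h) ^ m * ((real_of_int j * a - x) / h) ^ (k - m)) * (K ((x - t) / h) * cell_weight J a j m t))"
proof (cases "\<bar>(x - t) / h\<bar> \<le> 1/2")
  case False
  then show ?thesis using Ks by simp
next
  case True
  then have "\<bar>x - t\<bar> \<le> h / 2" using h by (simp add: abs_divide field_simps)
  then have t: "x - h/2 \<le> t" "t \<le> x + h/2" unfolding abs_le_iff by linarith+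
  define j0 where "j0 = \<lfloor>t / a\<rfloor>"
  have j0: "j0 \<in> cells a (x - h/2) (x + h/2)"
    using t a by (auto simp: j0_def intro!: floor_mono divide_right_mono)
  have "t \<in> J" using t J by auto
  have cw: "cell_weight J a j m t = (if j = j0 then ((t - real_of_int j0 * a) / a) ^ m else 0)" for j m
    unfolding cell_weight_def indicator_def Int_iff cell_index_unique[OF a] using \<open>t \<in> J\<close> by (auto simp: j0_def)
  let ?c = "\<lambda>j m. real (k choose m) * (a / h) ^ m * ((real_of_int j * a - x) / h) ^ (k - m)"
  have "(\<Sum>j\<in>cells a (x - h/2) (x + h/2). \<Sum>m\<le>k. ?c j m * (K ((x - t) / h) * cell_weight J a j m t))
     = (\<Sum>j\<in>cells a (x - h/2) (x + h/2). if j = j0 then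
          \<Sum>m\<le>k. ?c j0 m * (K ((x - t) / h) * ((t - real_of_int j0 * a) / a) ^ m) else 0)"
    unfolding cw by (intro sum.cong refl) auto
  also have "\<dots> = (\<Sum>m\<le>k. ?c j0 m * (K ((x - t) / h) * ((t - real_of_int j0 * a) / a) ^ m))"
    using j0 by (subst sum.delta) auto
  also have "\<dots> = (\<Sum>m\<le>k. real (k choose m) * ((t - real_of_int j0 * a) / h) ^ m * ((real_of_int j0 * a - x) / h) ^ (k - m)) * K ((x - t) / h)"
    unfolding sum_distrib_right using a h by (intro sum.cong refl) (simp add: power_divide)
  also have "\<dots> = ((t - real_of_int j0 * a) / h + (real_of_int j0 * a - x) / h) ^ k * K ((x - t) / h)"
    by (subst binomial_ring) simp
  also have "(t - real_of_int j0 * a) / h + (real_of_int j0 * a - x) / h = (t - x) / h"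
    by (simp add: add_divide_distrib[symmetric])
  finally show ?thesis by simp
qed

text \<open>An interval of length \<open>h\<close> meets at most h/a + 2 cells, and
  \<open>a \<le> h\<close> absorbs the 2.\<close>

lemma cell_count_le:
  assumes a: "0 < a" "a \<le> h"
  shows "real (card (cells a (x - h/2) (x + h/2))) \<le> 3 * h / a"
proof -
  have "\<lfloor>(x - h/2) / a\<rfloor> \<le> \<lfloor>(x + h/2) / a\<rfloor>" using a by (intro floor_mono divide_right_mono) auto
  then have "real (card (cells a (x - h/2) (x + h/2))) = real_of_int \<lfloor>(x + h/2) / a\<rfloor> - real_of_int \<lfloor>(x - h/2) / a\<rfloor> + 1"
    by simp
  also have "\<dots> \<le> (x + h/2) / a - ((x - h/2) / a - 1) + 1" by linarith
  also have "\<dots> = h / a + 2" using a by (simp add: field_simps)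
  also have "\<dots> \<le> 3 * h / a" using a by (simp add: field_simps)
  finally show ?thesis .
qed

text \<open>The left end point of a cell that meets the window is within h/2 + a \<le> 2 h of
  \<open>x\<close>, and a/h \<le> 1; the sum is thus dominated by the binomial expansion of (1 +
  2)^k.\<close>

lemma cell_coefficient_sum_le:
  assumes a: "0 < a" "a \<le> h" and j: "j \<in> cells a (x - h/2) (x + h/2)"
  shows "(\<Sum>m\<le>k. \<bar>real (k choose m) * (a / h) ^ m * ((real_of_int j * a - x) / h) ^ (k - m)\<bar>) \<le> 3 ^ k"
proof -
  have h: "0 < h" using a by linarith
  have "(x - h/2) / a - 1 \<le> real_of_int j" "real_of_int j \<le> (x + h/2) / a" using j by (auto simp: le_floor_iff) linarith
  then have "x - h/2 - a \<le> real_of_int j * a" "real_of_int j * a \<le> x + h/2" using a by (auto simp: field_simps)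
  then have "\<bar>real_of_int j * a - x\<bar> \<le> 2 * h" using a by (auto simp: abs_le_iff)
  then have b: "\<bar>(real_of_int j * a - x) / h\<bar> \<le> 2" using h by (simp add: abs_divide field_simps)
  have "(\<Sum>m\<le>k. \<bar>real (k choose m) * (a / h) ^ m * ((real_of_int j * a - x) / h) ^ (k - m)\<bar>)
     \<le> (\<Sum>m\<le>k. real (k choose m) * 1 ^ m * 2 ^ (k - m))"
    unfolding abs_mult power_abs using a h b by (intro sum_mono mult_mono power_mono) auto
  also have "\<dots> = (1 + 2) ^ k" by (subst binomial_ring) simp
  finally show ?thesis by simp
qed

text \<open>At most \<open>3 * h / a\<close> cells contribute, each with an error of at most 3^k
  \<epsilon> n a. The cell length cancels, which makes the error relative to \<open>n * h\<close>
  the same for all bandwidths from \<open>a\<close> upwards.\<close>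

lemma kernel_deviation_le:
  fixes K \<psi> :: "real \<Rightarrow> real" and D :: "(real \<times> real) measure" and z :: "nat \<Rightarrow> real \<times> real"
  assumes D: "prob_space D" and sD[measurable_cong]: "sets D = sets borel"
    and Km[measurable]: "K \<in> borel_measurable borel" and K\<kappa>: "\<And>u. \<bar>K u\<bar> \<le> \<kappa>" and Ks: "\<And>u. 1/2 < \<bar>u\<bar> \<Longrightarrow> K u = 0"
    and \<psi>[measurable]: "\<psi> \<in> borel_measurable borel" and \<psi>B: "\<And>y. \<bar>\<psi> y\<bar> \<le> B"
    and Jm: "J \<in> sets borel" and J: "{x - h/2..x + h/2} \<subseteq> J" and a: "0 < a" "a \<le> h" and n: "0 < n"
    and dev: "\<And>j m. j \<in> cells a (x - h/2) (x + h/2) \<Longrightarrow> m \<le> k \<Longrightarrow>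
      \<bar>(\<Sum>i=1..n. K ((x - fst (z i)) / h) * (cell_weight J a j m (fst (z i)) * \<psi> (snd (z i))))
        - real n * (\<integral>u. K ((x - fst u) / h) * (cell_weight J a j m (fst u) * \<psi> (snd u)) \<partial>D)\<bar> \<le> \<epsilon> * real n * a"
  shows "\<bar>(\<Sum>i=1..n. ((fst (z i) - x) / h) ^ k * K ((x - fst (z i)) / h) * \<psi> (snd (z i))) / (real n * h)
      - (\<integral>u. ((fst u - x) / h) ^ k * K ((x - fst u) / h) * \<psi> (snd u) \<partial>D) / h\<bar> \<le> 3 * 3 ^ k * \<epsilon>"
proof -
  interpret D: prob_space D by (rule D)
  note [measurable] = measurable_fst_snd_borel
  note [measurable] = cell_weight_measurable[OF Jm]
  have h: "0 < h" using a by linarith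
  \<comment> \<open>Every window meets some cell, so the hypothesis on the deviations already
    determines the sign of \<epsilon>.\<close>
  have \<epsilon>0: "0 \<le> \<epsilon>"
  proof -
    have "\<lfloor>(x - h/2) / a\<rfloor> \<le> \<lfloor>(x + h/2) / a\<rfloor>" using a h by (intro floor_mono divide_right_mono) auto
    then have "0 \<le> \<epsilon> * real n * a" by (intro order_trans[OF abs_ge_zero dev[of "\<lfloor>(x + h/2) / a\<rfloor>" 0]]) auto
    then show ?thesis using n a by (simp add: zero_le_mult_iff)
  qed
  let ?JJ = "cells a (x - h/2) (x + h/2)"
  let ?c = "\<lambda>j m. real (k choose m) * (a / h) ^ m * ((real_of_int j * a - x) / h) ^ (k - m)"
  let ?G = "\<lambda>j m u. K ((x - fst u) / h) * (cell_weight J a j m (fst u) * \<psi> (snd u))"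
  define L where "L F = (\<Sum>i=1..n. F (z i)) - real n * (\<integral>u. F u \<partial>D)" for F :: "real \<times> real \<Rightarrow> real"
  have K0: "0 \<le> \<kappa>" using K\<kappa>[of 0] by linarith
  have int: "integrable D (?G j m)" for j m
  proof (rule D.integrable_const_bound[where B = "\<kappa> * B"])
    show "AE u in D. norm (?G j m u) \<le> \<kappa> * B"
      unfolding real_norm_def abs_mult[of "K _"]
      using K\<kappa> K0 by (intro AE_I2 mult_mono cell_weight_mult_le[OF a(1)] \<psi>B) auto
  qed measurable
  have dec: "((fst u - x) / h) ^ k * K ((x - fst u) / h) * \<psi> (snd u) = (\<Sum>j\<in>?JJ. \<Sum>m\<le>k. ?c j m * ?G j m u)" for u
    using kernel_cell_decomposition[where K = K and J = J and t = "fst u" and k = k, OF a(1) h Ks J]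
    by (simp only: sum_distrib_right mult.assoc)
  have lin: "L (\<lambda>u. \<Sum>j\<in>?JJ. \<Sum>m\<le>k. ?c j m * ?G j m u) = (\<Sum>j\<in>?JJ. \<Sum>m\<le>k. ?c j m * L (?G j m))"
  proof -
    have 1: "(\<integral>u. (\<Sum>j\<in>?JJ. \<Sum>m\<le>k. ?c j m * ?G j m u) \<partial>D) = (\<Sum>j\<in>?JJ. \<Sum>m\<le>k. ?c j m * (\<integral>u. ?G j m u \<partial>D))"
      using int by (simp add: Bochner_Integration.integral_sum)
    have 2: "(\<Sum>i=1..n. \<Sum>j\<in>?JJ. \<Sum>m\<le>k. ?c j m * ?G j m (z i)) = (\<Sum>j\<in>?JJ. \<Sum>m\<le>k. ?c j m * (\<Sum>i=1..n. ?G j m (z i)))"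
      unfolding sum_distrib_left by (subst sum.swap) (intro sum.cong refl sum.swap)
    show ?thesis unfolding L_def 1 2
      by (simp add: sum_distrib_left sum_subtractf right_diff_distrib mult_ac)
  qed
  have "\<bar>L (\<lambda>u. \<Sum>j\<in>?JJ. \<Sum>m\<le>k. ?c j m * ?G j m u)\<bar> \<le> (\<Sum>j\<in>?JJ. \<Sum>m\<le>k. \<bar>?c j m\<bar> * (\<epsilon> * real n * a))"
    unfolding lin
  proof (rule order_trans[OF sum_abs], intro sum_mono)
    fix j assume j: "j \<in> ?JJ"
    show "\<bar>\<Sum>m\<le>k. ?c j m * L (?G j m)\<bar> \<le> (\<Sum>m\<le>k. \<bar>?c j m\<bar> * (\<epsilon> * real n * a))"
    proof (rule order_trans[OF sum_abs], intro sum_mono)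
      fix m assume "m \<in> {..k}"
      then have "\<bar>L (?G j m)\<bar> \<le> \<epsilon> * real n * a" using dev[OF j, of m] by (simp add: L_def)
      then show "\<bar>?c j m * L (?G j m)\<bar> \<le> \<bar>?c j m\<bar> * (\<epsilon> * real n * a)"
        unfolding abs_mult[of "?c j m"] by (intro mult_left_mono) auto
    qed
  qed
  also have "\<dots> = (\<Sum>j\<in>?JJ. (\<Sum>m\<le>k. \<bar>?c j m\<bar>) * (\<epsilon> * real n * a))" by (simp only: sum_distrib_right)
  also have "\<dots> \<le> (\<Sum>j\<in>?JJ. 3 ^ k * (\<epsilon> * real n * a))"
    using a \<epsilon>0 by (intro sum_mono mult_right_mono cell_coefficient_sum_le) auto
  also have "\<dots> = real (card ?JJ) * (3 ^ k * (\<epsilon> * real n * a))" by simp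
  also have "\<dots> \<le> (3 * h / a) * (3 ^ k * (\<epsilon> * real n * a))"
    using a \<epsilon>0 by (intro mult_right_mono cell_count_le) auto
  also have "\<dots> = 3 * 3 ^ k * \<epsilon> * (real n * h)" using a by simp
  finally have "\<bar>L (\<lambda>u. ((fst u - x) / h) ^ k * K ((x - fst u) / h) * \<psi> (snd u))\<bar> \<le> 3 * 3 ^ k * \<epsilon> * (real n * h)"
    unfolding dec .
  then have "\<bar>L (\<lambda>u. ((fst u - x) / h) ^ k * K ((x - fst u) / h) * \<psi> (snd u)) / (real n * h)\<bar> \<le> 3 * 3 ^ k * \<epsilon>"
    using n h by (simp add: abs_divide pos_divide_le_eq abs_mult)
  then show ?thesis using n h unfolding L_def by (simp add: diff_divide_distrib)
qed

section \<open>Bias\<close>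

abbreviation law :: "(real \<times> real \<Rightarrow> real) \<Rightarrow> (real \<times> real) measure" where
  "law f \<equiv> density lborel (\<lambda>z. ennreal (f z))"

lemma bounded_product_density_integral:
  fixes f :: "real \<times> real \<Rightarrow> real" and c \<psi> :: "real \<Rightarrow> real"
  assumes f0: "\<And>z. 0 \<le> f z" and fm: "f \<in> borel_measurable borel" and D: "prob_space (law f)"
    and cm: "c \<in> borel_measurable borel" and cB: "\<And>t. \<bar>c t\<bar> \<le> B" and \<psi>m: "\<psi> \<in> borel_measurable borel" and \<psi>B: "\<And>y. \<bar>\<psi> y\<bar> \<le> B'"
  shows "(\<integral>z. c (fst z) * \<psi> (snd z) \<partial>law f) = (\<integral>t. c t * (\<integral>y. \<psi> y * f (t, y) \<partial>lborel) \<partial>lborel)"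
    and "integrable lborel (\<lambda>t. c t * (\<integral>y. \<psi> y * f (t, y) \<partial>lborel))"
proof -
  let ?D = "law f"
  interpret D: prob_space ?D by (rule D)
  note [measurable] = measurable_fst_snd_borel
  note [measurable] = fm cm \<psi>m
  let ?G = "\<lambda>z. c (fst z) * \<psi> (snd z)"
  have Gm: "?G \<in> borel_measurable borel" by measurable
  have B: "0 \<le> B" using cB[of 0] by linarith
  have intD: "integrable ?D ?G"
  proof (rule D.integrable_const_bound[where B = "B * B'"])
    show "AE z in ?D. norm (?G z) \<le> B * B'"
      unfolding real_norm_def abs_mult using cB \<psi>B B by (intro AE_I2 mult_mono) auto
  qed measurable
  then have int: "integrable lborel (\<lambda>z. f z * ?G z)"
    using f0 Gm fm by (subst (asm) integrable_density) auto
  then have int': "integrable (lborel \<Otimes>\<^sub>M lborel) (\<lambda>z. f z * ?G z)" by (simp add: lborel_prod)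
  have eq: "(\<integral>y. f (t, y) * ?G (t, y) \<partial>lborel) = c t * (\<integral>y. \<psi> y * f (t, y) \<partial>lborel)" for t
  proof -
    have "(\<integral>y. f (t, y) * ?G (t, y) \<partial>lborel) = (\<integral>y. c t * (\<psi> y * f (t, y)) \<partial>lborel)"
      by (intro Bochner_Integration.integral_cong refl) (simp add: mult_ac)
    then show ?thesis by simp
  qed
  have "(\<integral>z. ?G z \<partial>?D) = (\<integral>z. f z * ?G z \<partial>lborel)"
    using f0 Gm fm by (subst integral_density) auto
  also have "\<dots> = (\<integral>z. f z * ?G z \<partial>(lborel \<Otimes>\<^sub>M lborel))" by (simp add: lborel_prod)
  also have "\<dots> = (\<integral>t. (\<integral>y. f (t, y) * ?G (t, y) \<partial>lborel) \<partial>lborel)"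
    by (rule lborel_pair.integral_fst'[OF int', symmetric])
  finally show "(\<integral>z. ?G z \<partial>?D) = (\<integral>t. c t * (\<integral>y. \<psi> y * f (t, y) \<partial>lborel) \<partial>lborel)"
    unfolding eq .
  show "integrable lborel (\<lambda>t. c t * (\<integral>y. \<psi> y * f (t, y) \<partial>lborel))"
    using lborel_pair.integrable_fst'[OF int'] unfolding eq .
qed

text \<open>This supplies the mean weight \<open>m\<close> of the tail bound, of the order of the
  cell length: the inner integral over the response is at most \<open>C\<close> for almost every
  \<open>t\<close> in \<open>J\<close>, and the outer one runs over an interval of length
  \<open>a\<close>.\<close>

lemma cell_mass_le:
  fixes f :: "real \<times> real \<Rightarrow> real" and c \<psi> :: "real \<Rightarrow> real"
  assumes f0: "\<And>z. 0 \<le> f z" and fm: "f \<in> borel_measurable borel" and D: "prob_space (law f)"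
    and cm: "c \<in> borel_measurable borel" and cB: "\<And>t. \<bar>c t\<bar> \<le> indicator ({l..<l+a} \<inter> J) t"
    and \<psi>m: "\<psi> \<in> borel_measurable borel" and a: "0 < a" and C: "0 \<le> C"
    and mass: "AE t\<in>J in lborel. (\<integral>\<^sup>+y. ennreal (\<bar>\<psi> y\<bar> * f (t, y)) \<partial>lborel) \<le> ennreal C"
  shows "(\<integral>z. \<bar>c (fst z) * \<psi> (snd z)\<bar> \<partial>law f) \<le> C * a"
proof -
  let ?D = "law f"
  interpret D: prob_space ?D by (rule D)
  note [measurable] = measurable_fst_snd_borel
  note [measurable] = fm cm \<psi>m
  have fm2[measurable]: "f \<in> borel_measurable (lborel \<Otimes>\<^sub>M lborel)" using fm by (simp add: lborel_prod)
  let ?G = "\<lambda>z. \<bar>c (fst z) * \<psi> (snd z)\<bar>"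
  have "(\<integral>\<^sup>+z. ennreal (?G z) \<partial>?D) = (\<integral>\<^sup>+z. ennreal (f z) * ennreal (?G z) \<partial>lborel)"
    by (subst nn_integral_density) auto
  also have "\<dots> = (\<integral>\<^sup>+z. ennreal (f z) * ennreal (?G z) \<partial>(lborel \<Otimes>\<^sub>M lborel))" by (simp add: lborel_prod)
  also have "\<dots> = (\<integral>\<^sup>+t. (\<integral>\<^sup>+y. ennreal (f (t, y)) * ennreal (?G (t, y)) \<partial>lborel) \<partial>lborel)"
    by (rule lborel.nn_integral_fst[symmetric]) measurable
  also have "\<dots> \<le> (\<integral>\<^sup>+t. ennreal C * indicator {l..<l+a} t \<partial>lborel)"
  proof (rule nn_integral_mono_AE, use mass in eventually_elim)
    fix t assume m: "t \<in> J \<longrightarrow> (\<integral>\<^sup>+y. ennreal (\<bar>\<psi> y\<bar> * f (t, y)) \<partial>lborel) \<le> ennreal C"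
    have [measurable]: "(\<lambda>y. f (t, y)) \<in> borel_measurable borel" using measurable_Pair2[OF fm2, of t] by simp
    have "(\<integral>\<^sup>+y. ennreal (f (t, y)) * ennreal (?G (t, y)) \<partial>lborel) = (\<integral>\<^sup>+y. ennreal \<bar>c t\<bar> * ennreal (\<bar>\<psi> y\<bar> * f (t, y)) \<partial>lborel)"
      using f0 by (intro nn_integral_cong) (simp add: abs_mult ennreal_mult[symmetric] mult_ac)
    also have "\<dots> = ennreal \<bar>c t\<bar> * (\<integral>\<^sup>+y. ennreal (\<bar>\<psi> y\<bar> * f (t, y)) \<partial>lborel)"
      by (rule nn_integral_cmult) measurable
    also have "\<dots> \<le> ennreal C * indicator {l..<l+a} t"
    proof (cases "t \<in> {l..<l+a} \<inter> J")
      case True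
      then have "ennreal \<bar>c t\<bar> \<le> 1" using cB[of t] by (simp add: ennreal_le_1)
      then have "ennreal \<bar>c t\<bar> * (\<integral>\<^sup>+y. ennreal (\<bar>\<psi> y\<bar> * f (t, y)) \<partial>lborel) \<le> 1 * ennreal C"
        using m True by (intro mult_mono) auto
      then show ?thesis using True by simp
    next
      case False then show ?thesis using cB[of t] by simp
    qed
    finally show "(\<integral>\<^sup>+y. ennreal (f (t, y)) * ennreal (?G (t, y)) \<partial>lborel) \<le> ennreal C * indicator {l..<l+a} t" .
  qed
  also have "\<dots> = ennreal (C * a)" using a C by (simp add: nn_integral_cmult ennreal_mult)
  finally have le: "(\<integral>\<^sup>+z. ennreal (?G z) \<partial>?D) \<le> ennreal (C * a)" .
  have "(\<integral>z. ?G z \<partial>?D) = enn2real (\<integral>\<^sup>+z. ennreal (?G z) \<partial>?D)"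
    by (rule integral_eq_nn_integral) auto
  also have "\<dots> \<le> C * a" using le a C by (intro enn2real_leI) auto
  finally show ?thesis .
qed

text \<open>Substitution t = x - h u, whose negative slope is the source of the power of
  \<open>-u\<close>.\<close>

lemma kernel_affine_moment:
  fixes K :: "real \<Rightarrow> real"
  assumes Km[measurable]: "K \<in> borel_measurable borel" and K\<kappa>: "\<And>u. \<bar>K u\<bar> \<le> \<kappa>"
    and Ks: "\<And>u. 1/2 < \<bar>u\<bar> \<Longrightarrow> K u = 0" and h: "0 < h"
  shows "integrable lborel (\<lambda>t. ((t - x) / h) ^ k * K ((x - t) / h))"
    and "(\<integral>t. ((t - x) / h) ^ k * K ((x - t) / h) \<partial>lborel) = h * kernel_moment K k"
proof -
  have eq: "((x + (-h) * u - x) / h) ^ k * K ((x - (x + (-h) * u)) / h) = (-u) ^ k * K u" for u using h by simp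
  have int: "integrable lborel (\<lambda>u. (-u) ^ k * K u)"
    using K\<kappa> Ks by (intro weighted_kernel_integrable[where \<kappa>=\<kappa> and B=1] abs_power_le_one) auto
  have h': "-h \<noteq> 0" using h by simp
  show "integrable lborel (\<lambda>t. ((t - x) / h) ^ k * K ((x - t) / h))"
    using int unfolding eq[symmetric]
    by (rule lborel_integrable_real_affine_iff[OF h', of "\<lambda>t. ((t - x) / h) ^ k * K ((x - t) / h)" x, THEN iffD1])
  have "(\<integral>t. ((t - x) / h) ^ k * K ((x - t) / h) \<partial>lborel)
      = \<bar>-h\<bar> *\<^sub>R (\<integral>u. ((x + (-h) * u - x) / h) ^ k * K ((x - (x + (-h) * u)) / h) \<partial>lborel)"
    by (rule lborel_integral_real_affine[OF h'])
  then show "(\<integral>t. ((t - x) / h) ^ k * K ((x - t) / h) \<partial>lborel) = h * kernel_moment K k"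
    unfolding eq using h by simp
qed

text \<open>Across the window the power is at most 1 in absolute value and \<open>r\<close> differs
  from \<open>R\<close> by at most \<epsilon>, while \<open>K ((x - t) / h)\<close> has integral
  \<open>h\<close>, which the division removes. The bound on \<open>r\<close> is asked almost
  everywhere because truncated conditional moments are controlled only up to null sets.\<close>

lemma kernel_bias_le:
  fixes K r :: "real \<Rightarrow> real"
  assumes Km[measurable]: "K \<in> borel_measurable borel" and K0: "\<And>u. 0 \<le> K u" and K\<kappa>: "\<And>u. K u \<le> \<kappa>"
    and Ks: "\<And>u. 1/2 < \<bar>u\<bar> \<Longrightarrow> K u = 0" and K1: "(\<integral>u. K u \<partial>lborel) = 1" and h: "0 < h"
    and int: "integrable lborel (\<lambda>t. ((t - x) / h) ^ k * K ((x - t) / h) * r t)"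
    and r: "AE t in lborel. \<bar>t - x\<bar> \<le> h / 2 \<longrightarrow> \<bar>r t - R\<bar> \<le> \<epsilon>"
  shows "\<bar>(\<integral>t. ((t - x) / h) ^ k * K ((x - t) / h) * r t \<partial>lborel) / h - R * kernel_moment K k\<bar> \<le> \<epsilon>"
proof -
  let ?w = "\<lambda>t. ((t - x) / h) ^ k * K ((x - t) / h)"
  have K\<kappa>': "\<bar>K u\<bar> \<le> \<kappa>" for u using K0 K\<kappa> by simp
  note mom = kernel_affine_moment[OF Km K\<kappa>' Ks h, of x]
  have i0: "integrable lborel (\<lambda>t. K ((x - t) / h))" and e0: "(\<integral>t. K ((x - t) / h) \<partial>lborel) = h"
    using mom[of 0] K1 by auto
  have id: "integrable lborel (\<lambda>t. ?w t * (r t - R))"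
    using Bochner_Integration.integrable_diff[OF int integrable_mult_left[OF mom(1)[of k], of R]]
    by (simp add: right_diff_distrib)
  have "(\<integral>t. ?w t * r t \<partial>lborel) - R * (h * kernel_moment K k) = (\<integral>t. ?w t * (r t - R) \<partial>lborel)"
    using int mom(1)[of k] mom(2)[of k] by (simp add: right_diff_distrib)
  also have "\<bar>\<dots>\<bar> \<le> (\<integral>t. \<bar>?w t * (r t - R)\<bar> \<partial>lborel)" by (rule integral_abs_bound)
  also have "\<dots> \<le> (\<integral>t. \<epsilon> * K ((x - t) / h) \<partial>lborel)"
  proof (intro integral_mono_AE)
    show "AE t in lborel. \<bar>?w t * (r t - R)\<bar> \<le> \<epsilon> * K ((x - t) / h)"
      using r
    proof eventually_elim
      fix t assume rt: "\<bar>t - x\<bar> \<le> h / 2 \<longrightarrow> \<bar>r t - R\<bar> \<le> \<epsilon>"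
      show "\<bar>?w t * (r t - R)\<bar> \<le> \<epsilon> * K ((x - t) / h)"
      proof (cases "\<bar>(x - t) / h\<bar> \<le> 1/2")
        case True
        then have tx: "\<bar>t - x\<bar> \<le> h / 2" using h by (simp add: abs_divide field_simps abs_minus_commute)
        then have "\<bar>(t - x) / h\<bar> \<le> 1" using h by (simp add: abs_divide field_simps)
        then have "\<bar>((t - x) / h) ^ k\<bar> \<le> 1" by (rule abs_power_le_one)
        then have "\<bar>((t - x) / h) ^ k\<bar> * K ((x - t) / h) * \<bar>r t - R\<bar> \<le> 1 * K ((x - t) / h) * \<epsilon>"
          using rt tx K0 by (intro mult_mono) auto
        then show ?thesis using K0 by (simp add: abs_mult mult.commute)
      next
        case False then show ?thesis using Ks by simp
      qed
    qed
  qed (use id i0 in auto)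
  also have "\<dots> = \<epsilon> * h" using e0 by simp
  finally have "\<bar>(\<integral>t. ?w t * r t \<partial>lborel) - R * (h * kernel_moment K k)\<bar> \<le> \<epsilon> * h" .
  then have "\<bar>((\<integral>t. ?w t * r t \<partial>lborel) - R * (h * kernel_moment K k)) / h\<bar> \<le> \<epsilon>"
    using h by (simp add: abs_divide pos_divide_le_eq)
  then show ?thesis using h by (simp add: diff_divide_distrib)
qed

section \<open>From convergent moments to the estimator along a single sample path\<close>

lemma tendsto_zero_ennrealI:
  fixes F :: "'a \<Rightarrow> ennreal"
  assumes "\<And>\<epsilon>::real. 0 < \<epsilon> \<Longrightarrow> eventually (\<lambda>n. F n \<le> ennreal \<epsilon>) A"
  shows "(F \<longlongrightarrow> 0) A"
proof (rule order_tendstoI)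
  fix e :: ennreal assume "0 < e"
  then obtain r where r: "0 < r" "r < e" using dense by blast
  then obtain s where s: "r = ennreal s" "0 < s" by (cases r) auto
  from assms[OF s(2)] show "eventually (\<lambda>n. F n < e) A"
    by eventually_elim (use r s in auto)
qed simp

text \<open>A deterministic statement, to be applied at almost every sample point. Orders up to
  \<open>2 * p\<close> occur because the quadratic form has the moment of order \<open>j + k\<close>
  as its entry.\<close>

lemma lp_uniform_conclusion:
  fixes K \<phi> g :: "real \<Rightarrow> real" and xs ys :: "nat \<Rightarrow> real"
  assumes Km: "K \<in> borel_measurable borel" and K0: "\<And>u. 0 \<le> K u" and K\<kappa>: "\<And>u. K u \<le> \<kappa>"
    and Ks: "\<And>u. 1/2 < \<bar>u\<bar> \<Longrightarrow> K u = 0" and K1: "(\<integral>u. K u \<partial>lborel) = 1"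
    and \<phi>: "0 < \<phi>\<^sub>0" "\<And>x. x \<in> I \<Longrightarrow> \<phi>\<^sub>0 \<le> \<phi> x" and g: "\<And>x. x \<in> I \<Longrightarrow> \<bar>g x\<bar> \<le> G"
    and a: "eventually (\<lambda>n. 0 < a n) sequentially"
    and conv: "\<And>\<epsilon>. 0 < \<epsilon> \<Longrightarrow> eventually (\<lambda>n. \<forall>x\<in>I. \<forall>h\<in>{a n..b n}. \<forall>k\<le>2*p.
       \<bar>(\<Sum>i=1..n. ((xs i - x) / h) ^ k * K ((x - xs i) / h)) / (real n * h) - \<phi> x * kernel_moment K k\<bar> \<le> \<epsilon> \<and>
       \<bar>(\<Sum>i=1..n. ((xs i - x) / h) ^ k * K ((x - xs i) / h) * ys i) / (real n * h) - g x * \<phi> x * kernel_moment K k\<bar> \<le> \<epsilon>)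
       sequentially"
  shows "eventually (\<lambda>n. \<forall>x\<in>I. \<forall>h\<in>{a n..b n}. lp_well_defined K p xs ys n h x) sequentially"
    and "(\<lambda>n. SUP h\<in>{a n..b n}. SUP x\<in>I. ennreal \<bar>lp_estimator K p xs ys n h x - g x\<bar>) \<longlonglongrightarrow> 0"
proof -
  let ?\<mu> = "\<lambda>k. \<integral>u. (-u) ^ k * K u \<partial>lborel"
  obtain \<Lambda> where \<Lambda>: "0 < \<Lambda>" "\<And>\<gamma>. \<Lambda> * (\<Sum>j=0..p. (\<gamma> j)\<^sup>2) \<le> (\<Sum>j=0..p. \<Sum>k=0..p. \<gamma> j * \<gamma> k * ?\<mu> (j + k))"
    using moment_form_coercive[OF Km K0 K\<kappa> Ks K1, of p] by blast
  \<comment> \<open>Half of the limiting constant; the other half pays for replacing limiting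
    moments by empirical ones.\<close>
  define L where "L = \<phi>\<^sub>0 * \<Lambda> / 2"
  have L: "0 < L" using \<Lambda> \<phi> by (simp add: L_def)
  define G' where "G' = 1 + \<bar>G\<bar>"
  have G': "1 \<le> G'" "\<And>x. x \<in> I \<Longrightarrow> \<bar>g x\<bar> + 1 \<le> G'" using g by (force simp: G'_def)+
  have key: "eventually (\<lambda>n. \<forall>x\<in>I. \<forall>h\<in>{a n..b n}. lp_well_defined K p xs ys n h x \<and> \<bar>lp_estimator K p xs ys n h x - g x\<bar> \<le> \<epsilon>) sequentially"
    if "0 < \<epsilon>" for \<epsilon>
  proof -
    \<comment> \<open>The first bound keeps the empirical form coercive with constant
      \<open>L\<close>, the second makes the final error
      \<open>2 * (e * G') * (real p + 1) / L\<close> at most \<epsilon>.\<close>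
    define e where "e = min (L / (real p + 1)) (\<epsilon> * L / (2 * G' * (real p + 1)))"
    have e: "0 < e" using L \<open>0 < \<epsilon>\<close> G'(1) by (auto simp: e_def intro!: divide_pos_pos mult_pos_pos)
    have e1: "e * (real p + 1) \<le> L"
    proof -
      have "e \<le> L / (real p + 1)" by (simp add: e_def)
      then show ?thesis by (simp add: pos_le_divide_eq)
    qed
    have e2: "2 * (e * G') * (real p + 1) / L \<le> \<epsilon>"
    proof -
      have "e \<le> \<epsilon> * L / (2 * G' * (real p + 1))" by (simp add: e_def)
      then have "e * (2 * G' * (real p + 1)) \<le> \<epsilon> * L" using G'(1) by (subst (asm) pos_le_divide_eq) auto
      then show ?thesis using L by (simp add: pos_divide_le_eq mult_ac)
    qed
    show ?thesis
      using conv[OF e] a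
    proof eventually_elim
      case (elim n)
      show ?case
      proof (intro ballI)
        fix x h assume x: "x \<in> I" and h: "h \<in> {a n..b n}"
        have h0: "0 < h" using elim(2) h by auto
        let ?c = "\<lambda>i. K ((x - xs i) / h) / (real n * h)" and ?u = "\<lambda>i. (xs i - x) / h"
        define S where "S k = (\<Sum>i=1..n. ?c i * ?u i ^ k)" for k
        define T where "T k = (\<Sum>i=1..n. ?c i * ys i * ?u i ^ k)" for k
        have S: "\<bar>S k - \<phi> x * ?\<mu> k\<bar> \<le> e" if "k \<le> 2 * p" for k
        proof -
          have "S k = (\<Sum>i=1..n. ((xs i - x) / h) ^ k * K ((x - xs i) / h)) / (real n * h)"
            unfolding S_def sum_divide_distrib by (intro sum.cong refl) simp
          then show ?thesis using elim(1) x h that by auto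
        qed
        have T: "\<bar>T k - g x * \<phi> x * ?\<mu> k\<bar> \<le> e" if "k \<le> 2 * p" for k
        proof -
          have "T k = (\<Sum>i=1..n. ((xs i - x) / h) ^ k * K ((x - xs i) / h) * ys i) / (real n * h)"
            unfolding T_def sum_divide_distrib by (intro sum.cong refl) simp
          then show ?thesis using elim(1) x h that by auto
        qed
        have coer: "L * (\<Sum>j=0..p. (\<gamma> j)\<^sup>2) \<le> (\<Sum>i=1..n. ?c i * (\<Sum>j=0..p. \<gamma> j * ?u i ^ j)\<^sup>2)" for \<gamma>
        proof -
          let ?N = "\<Sum>j=0..p. (\<gamma> j)\<^sup>2" and ?q = "\<Sum>j=0..p. \<Sum>k=0..p. \<gamma> j * \<gamma> k * ?\<mu> (j + k)"
          have N0: "0 \<le> ?N" by (intro sum_nonneg) auto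
          have "(\<Sum>i=1..n. ?c i * (\<Sum>j=0..p. \<gamma> j * ?u i ^ j)\<^sup>2) = (\<Sum>i=1..n. \<Sum>j=0..p. \<Sum>k=0..p. \<gamma> j * \<gamma> k * (?c i * ?u i ^ (j + k)))"
            unfolding power2_eq_square sum_product unfolding sum_distrib_left
            by (intro sum.cong refl) (simp add: power_add mult_ac)
          also have "\<dots> = (\<Sum>j=0..p. \<Sum>k=0..p. \<gamma> j * \<gamma> k * S (j + k))"
            unfolding S_def sum_distrib_left by (subst sum.swap) (intro sum.cong refl sum.swap)
          finally have eq: "(\<Sum>i=1..n. ?c i * (\<Sum>j=0..p. \<gamma> j * ?u i ^ j)\<^sup>2) = (\<Sum>j=0..p. \<Sum>k=0..p. \<gamma> j * \<gamma> k * S (j + k))" .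
          have "\<phi> x * ?q - (\<Sum>j=0..p. \<Sum>k=0..p. \<gamma> j * \<gamma> k * S (j + k))
              = (\<Sum>j=0..p. \<Sum>k=0..p. \<gamma> j * \<gamma> k * (\<phi> x * ?\<mu> (j + k) - S (j + k)))"
            by (simp add: sum_distrib_left sum_subtractf right_diff_distrib mult_ac)
          also have "\<dots> \<le> (\<Sum>j=0..p. \<Sum>k=0..p. \<bar>\<gamma> j\<bar> * \<bar>\<gamma> k\<bar> * e)"
          proof (intro sum_mono)
            fix j k assume "j \<in> {0..p}" "k \<in> {0..p}"
            then have b: "\<bar>\<phi> x * ?\<mu> (j + k) - S (j + k)\<bar> \<le> e" using S[of "j + k"] by (simp add: abs_minus_commute)
            have "\<gamma> j * \<gamma> k * (\<phi> x * ?\<mu> (j + k) - S (j + k)) \<le> \<bar>\<gamma> j * \<gamma> k * (\<phi> x * ?\<mu> (j + k) - S (j + k))\<bar>" by simp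
            also have "\<dots> = \<bar>\<gamma> j\<bar> * \<bar>\<gamma> k\<bar> * \<bar>\<phi> x * ?\<mu> (j + k) - S (j + k)\<bar>" by (simp only: abs_mult)
            also have "\<dots> \<le> \<bar>\<gamma> j\<bar> * \<bar>\<gamma> k\<bar> * e" using b by (intro mult_left_mono) auto
            finally show "\<gamma> j * \<gamma> k * (\<phi> x * ?\<mu> (j + k) - S (j + k)) \<le> \<bar>\<gamma> j\<bar> * \<bar>\<gamma> k\<bar> * e" .
          qed
          also have "\<dots> = (\<Sum>j=0..p. \<bar>\<gamma> j\<bar>)\<^sup>2 * e"
            unfolding power2_eq_square sum_product unfolding sum_distrib_right ..
          \<comment> \<open>Cauchy-Schwarz over the \<open>p + 1\<close> coordinates.\<close>
          also have "\<dots> \<le> (real p + 1) * ?N * e"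
          proof (intro mult_right_mono)
            have "(\<Sum>j=0..p. \<bar>\<gamma> j\<bar>)\<^sup>2 \<le> (\<Sum>j=0..p. \<bar>\<gamma> j\<bar>\<^sup>2) * real (card {0..p})"
              by (rule sum_squared_le_sum_of_squares)
            then show "(\<Sum>j=0..p. \<bar>\<gamma> j\<bar>)\<^sup>2 \<le> (real p + 1) * ?N" by (simp add: mult.commute add.commute)
          qed (use e in simp)
          also have "\<dots> = (e * (real p + 1)) * ?N" by (simp add: mult_ac)
          also have "\<dots> \<le> L * ?N" using e1 N0 by (intro mult_right_mono)
          finally have 1: "\<phi> x * ?q - L * ?N \<le> (\<Sum>j=0..p. \<Sum>k=0..p. \<gamma> j * \<gamma> k * S (j + k))" by linarith
          have "\<phi>\<^sub>0 * (\<Lambda> * ?N) \<le> \<phi> x * ?q"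
            using \<phi> x \<Lambda> N0 by (intro mult_mono) (auto intro: order_trans[OF less_imp_le])
          moreover have "\<phi>\<^sub>0 * (\<Lambda> * ?N) = 2 * (L * ?N)" by (simp add: L_def)
          ultimately show ?thesis using 1 unfolding eq by linarith
        qed
        \<comment> \<open>Subtracting \<open>g x\<close> times the moment without response from the
          moment with response cancels the common limit \<open>g x * \<phi> x * ?\<mu> j\<close>, so
          the residual moments of all orders are small.\<close>
        have ee: "\<bar>(\<Sum>i=1..n. ?c i * (ys i - g x) * ?u i ^ j)\<bar> \<le> e * G'" if "j \<le> p" for j
        proof -
          have "(\<Sum>i=1..n. ?c i * (ys i - g x) * ?u i ^ j) = T j - g x * S j"
            unfolding T_def S_def sum_distrib_left sum_subtractf[symmetric]
            by (intro sum.cong refl) (simp only: right_diff_distrib left_diff_distrib mult_ac)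
          also have "\<dots> = (T j - g x * \<phi> x * ?\<mu> j) - g x * (S j - \<phi> x * ?\<mu> j)" by (simp add: algebra_simps)
          also have "\<bar>\<dots>\<bar> \<le> \<bar>T j - g x * \<phi> x * ?\<mu> j\<bar> + \<bar>g x\<bar> * \<bar>S j - \<phi> x * ?\<mu> j\<bar>"
            unfolding abs_mult[symmetric] by (rule abs_triangle_ineq4)
          also have "\<dots> \<le> e + \<bar>g x\<bar> * e" using S[of j] T[of j] that by (intro add_mono mult_left_mono) auto
          also have "\<dots> = (\<bar>g x\<bar> + 1) * e" by (simp add: algebra_simps)
          also have "\<dots> \<le> G' * e" using G'(2)[OF x] e by (intro mult_right_mono) auto
          finally show ?thesis by (simp add: mult.commute)
        qed
        show "lp_well_defined K p xs ys n h x \<and> \<bar>lp_estimator K p xs ys n h x - g x\<bar> \<le> \<epsilon>"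
          using lp_estimator_close[OF K0 h0 L coer ee] e2 by (meson order_trans)
      qed
    qed
  qed
  show "eventually (\<lambda>n. \<forall>x\<in>I. \<forall>h\<in>{a n..b n}. lp_well_defined K p xs ys n h x) sequentially"
    using key[OF zero_less_one] by (rule eventually_mono) auto
  show "(\<lambda>n. SUP h\<in>{a n..b n}. SUP x\<in>I. ennreal \<bar>lp_estimator K p xs ys n h x - g x\<bar>) \<longlonglongrightarrow> 0"
  proof (rule tendsto_zero_ennrealI)
    fix \<epsilon> :: real assume "0 < \<epsilon>"
    from key[OF this] show "eventually (\<lambda>n. (SUP h\<in>{a n..b n}. SUP x\<in>I. ennreal \<bar>lp_estimator K p xs ys n h x - g x\<bar>) \<le> ennreal \<epsilon>) sequentially"
      by eventually_elim (auto intro!: SUP_least ennreal_leI)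
  qed
qed

section \<open>Almost sure convergence of the local moments\<close>

text \<open>Each pair of a cell and a degree fails with probability of order n^(-3). Since n a is
  eventually at least 1, there are at most of order n cells, and Borel-Cantelli applies to a series
  of order n^(-2).\<close>

lemma (in prob_space) cells_uniform_deviation:
  fixes Z :: "nat \<Rightarrow> 'a \<Rightarrow> real \<times> real" and f :: "real \<times> real \<Rightarrow> real" and \<psi> :: "nat \<Rightarrow> real \<Rightarrow> real" and a \<tau> :: "nat \<Rightarrow> real"
  defines "D \<equiv> law f"
  assumes ind: "indep_vars (\<lambda>_. borel) Z UNIV" and dist: "\<And>i. distr M borel (Z i) = D"
    and f0: "\<And>z. 0 \<le> f z" and fm: "f \<in> borel_measurable borel"
    and V: "countable V" "V \<noteq> {}" and Vm: "\<And>v. v \<in> V \<Longrightarrow> v \<in> borel_measurable borel"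
    and V\<kappa>: "\<And>v t. v \<in> V \<Longrightarrow> \<bar>v t\<bar> \<le> \<kappa>" and \<kappa>: "0 < \<kappa>"
    and cov: "\<And>\<delta>. 0 < \<delta> \<Longrightarrow> \<exists>N. L1_cover V \<kappa> \<delta> N"
    and \<psi>m: "\<And>n. \<psi> n \<in> borel_measurable borel" and \<psi>B: "\<And>n y. \<bar>\<psi> n y\<bar> \<le> \<tau> n" and \<tau>: "\<And>n. 1 \<le> \<tau> n"
    and C: "0 < C" and mass: "\<And>n. AE t\<in>J in lborel. (\<integral>\<^sup>+y. ennreal (\<bar>\<psi> n y\<bar> * f (t, y)) \<partial>lborel) \<le> ennreal C"
    and a: "eventually (\<lambda>n. 0 < a n) sequentially" "a \<longlonglongrightarrow> 0"
    and rate: "filterlim (\<lambda>n. real n * a n / (\<tau> n * ln (real n))) at_top sequentially"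
    and J: "J \<in> sets borel" and lohi: "lo \<le> hi" and \<epsilon>: "0 < \<epsilon>"
  shows "AE \<omega> in M. eventually (\<lambda>n. \<forall>j\<in>cells (a n) lo hi. \<forall>m\<le>q. \<forall>v\<in>V.
      \<bar>(\<Sum>i=1..n. v (fst (Z i \<omega>)) * (cell_weight J (a n) j m (fst (Z i \<omega>)) * \<psi> n (snd (Z i \<omega>))))
        - real n * (\<integral>z. v (fst z) * (cell_weight J (a n) j m (fst z) * \<psi> n (snd z)) \<partial>D)\<bar> \<le> \<epsilon> * real n * a n) sequentially"
proof -
  let ?dev = "\<lambda>\<omega> n j m v. \<bar>(\<Sum>i=1..n. v (fst (Z i \<omega>)) * (cell_weight J (a n) j m (fst (Z i \<omega>)) * \<psi> n (snd (Z i \<omega>))))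
        - real n * (\<integral>z. v (fst z) * (cell_weight J (a n) j m (fst z) * \<psi> n (snd z)) \<partial>D)\<bar>"
  note [measurable] = measurable_fst_snd_borel cell_weight_measurable[OF J] \<psi>m
  have Zm: "random_variable borel (Z 0)" using ind by (auto simp: indep_vars_def)
  have Dp: "prob_space (law f)"
    using prob_space_distr[OF Zm] dist unfolding D_def by simp
  \<comment> \<open>In the exponent, 4 C (s0 \<delta> + s0^2 \<kappa>^2) competes with s0
    \<epsilon>. This \<delta> makes the first summand s0 \<epsilon> / 4. The three bounds in
    \<open>s0\<close> give s0^2 \<le> s0, then the condition \<theta> \<tau> \<le> 1, and then at
    most s0 \<epsilon> / 4 for the second summand. What remains is half of s0 \<epsilon>, which is
    \<open>c0\<close>.\<close>
  define \<delta> where "\<delta> = \<epsilon> / (16 * C)"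
  define s0 where "s0 = min 1 (min (1 / (\<delta> + \<kappa>\<^sup>2)) (\<epsilon> / (16 * C * \<kappa>\<^sup>2)))"
  have \<delta>0: "0 < \<delta>" using \<epsilon> C by (simp add: \<delta>_def)
  have s0: "0 < s0" "s0 \<le> 1" using \<delta>0 \<epsilon> C \<kappa> by (auto simp: s0_def intro!: divide_pos_pos add_pos_pos)
  have s1: "s0 * \<delta> + s0\<^sup>2 * \<kappa>\<^sup>2 \<le> 1"
  proof -
    have "s0\<^sup>2 \<le> s0" using s0 by (simp add: power2_eq_square mult_left_le)
    then have "s0 * \<delta> + s0\<^sup>2 * \<kappa>\<^sup>2 \<le> s0 * \<delta> + s0 * \<kappa>\<^sup>2" by (intro add_left_mono mult_right_mono) auto
    also have "\<dots> = s0 * (\<delta> + \<kappa>\<^sup>2)" by (simp add: algebra_simps)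
    also have "\<dots> \<le> 1 / (\<delta> + \<kappa>\<^sup>2) * (\<delta> + \<kappa>\<^sup>2)" using \<delta>0 by (intro mult_right_mono) (auto simp: s0_def)
    also have "\<dots> = 1" using add_pos_nonneg[OF \<delta>0 zero_le_power2[of \<kappa>]] by simp
    finally show ?thesis .
  qed
  have s2: "4 * C * (s0 * \<delta> + s0\<^sup>2 * \<kappa>\<^sup>2) - s0 * \<epsilon> \<le> - (s0 * \<epsilon> / 2)"
  proof -
    have "s0 \<le> \<epsilon> / (16 * C * \<kappa>\<^sup>2)" by (simp add: s0_def)
    then have "s0 * (16 * C * \<kappa>\<^sup>2) \<le> \<epsilon>" using C \<kappa> by (subst (asm) pos_le_divide_eq) auto
    then have "s0 * (s0 * (16 * C * \<kappa>\<^sup>2)) \<le> s0 * \<epsilon>" using s0 by (intro mult_left_mono) auto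
    then have "4 * C * (s0\<^sup>2 * \<kappa>\<^sup>2) \<le> s0 * \<epsilon> / 4" by (simp add: power2_eq_square mult_ac)
    moreover have "4 * C * (s0 * \<delta>) = s0 * \<epsilon> / 4" using C by (simp add: \<delta>_def)
    ultimately show ?thesis unfolding distrib_left by linarith
  qed
  define c0 where "c0 = s0 * \<epsilon> / 2"
  have c0: "0 < c0" using s0 \<epsilon> by (simp add: c0_def)
  obtain N where N: "L1_cover V \<kappa> \<delta> N" using cov[OF \<delta>0] by blast
  \<comment> \<open>\<open>1 \<le> real n * a n\<close> limits the number of cells to order n, and
    the last condition turns the exponential tail into n^(-3).\<close>
  define good where "good n \<longleftrightarrow> 3 \<le> n \<and> 0 < a n \<and> a n \<le> 1 \<and> 1 \<le> real n * a n \<and> 3 * ln (real n) \<le> c0 * (real n * a n / \<tau> n)" for n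
  have ev_good: "eventually good sequentially"
  proof -
    have "eventually (\<lambda>n. a n < 1) sequentially" using a(2) by (rule order_tendstoD) simp
    moreover have "eventually (\<lambda>n. max 1 (3 / c0) \<le> real n * a n / (\<tau> n * ln (real n))) sequentially"
      using rate unfolding filterlim_at_top by blast
    ultimately show ?thesis using a(1) eventually_ge_at_top[of 3]
    proof eventually_elim
      case (elim n)
      have "ln (exp 1) \<le> ln (real n)" using exp_le \<open>3 \<le> n\<close> by (subst ln_le_cancel_iff) (auto intro: order_trans)
      then have ln1: "1 \<le> ln (real n)" by simp
      have pos: "0 < \<tau> n * ln (real n)" using \<tau>[of n] ln1 by (intro mult_pos_pos) linarith+
      have "max 1 (3 / c0) * (\<tau> n * ln (real n)) \<le> real n * a n" using elim(2) unfolding pos_le_divide_eq[OF pos] .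
      moreover have "1 * (\<tau> n * ln (real n)) \<le> max 1 (3 / c0) * (\<tau> n * ln (real n))"
        "3 / c0 * (\<tau> n * ln (real n)) \<le> max 1 (3 / c0) * (\<tau> n * ln (real n))"
        using pos by (intro mult_right_mono; simp)+
      moreover have "1 * 1 \<le> \<tau> n * ln (real n)" using \<tau>[of n] ln1 by (intro mult_mono) auto
      ultimately have 1: "1 \<le> real n * a n" "3 / c0 * (\<tau> n * ln (real n)) \<le> real n * a n" by linarith+
      have "3 * ln (real n) \<le> c0 * (real n * a n / \<tau> n)"
        using 1(2) c0 \<tau>[of n] by (simp add: field_simps)
      then show ?case using elim 1 by (simp add: good_def)
    qed
  qed
  define B where "B n j m = {\<omega>\<in>space M. \<exists>v\<in>V. \<epsilon> * real n * a n < ?dev \<omega> n j m v}" for n j m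
  have B: "B n j m \<in> events \<and> prob (B n j m) \<le> 2 * real N * (1 / real n ^ 3)" if "good n" for n j m
  proof -
    have g: "3 \<le> n" "0 < a n" "3 * ln (real n) \<le> c0 * (real n * a n / \<tau> n)" using that by (auto simp: good_def)
    let ?w = "\<lambda>z. cell_weight J (a n) j m (fst z) * \<psi> n (snd z)"
    have \<tau>0: "0 < \<tau> n" using \<tau>[of n] by linarith
    \<comment> \<open>Dividing by the truncation level turns \<open>\<theta> * \<tau> n\<close> into
      a constant, bounded by 1 through the choice of \<open>s0\<close>, and leaves a constant
      multiple of \<open>real n * a n / \<tau> n\<close> in the exponent.\<close>
    define s where "s = s0 / \<tau> n"
    define \<theta> where "\<theta> = s * \<delta> + s\<^sup>2 * \<kappa>\<^sup>2 * \<tau> n"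
    have \<theta>: "\<theta> = (s0 * \<delta> + s0\<^sup>2 * \<kappa>\<^sup>2) / \<tau> n"
      using \<tau>0 by (simp add: \<theta>_def s_def power2_eq_square field_simps)
    have w\<tau>: "\<bar>?w z\<bar> \<le> \<tau> n" for z
      using g(2) \<psi>B by (rule cell_weight_mult_le)
    have wm: "(\<integral>z. \<bar>?w z\<bar> \<partial>D) \<le> C * a n"
      unfolding D_def
    proof (rule cell_mass_le[OF f0 fm Dp _ _ \<psi>m g(2) _ mass])
      show "cell_weight J (a n) j m \<in> borel_measurable borel" by measurable
      show "\<bar>cell_weight J (a n) j m t\<bar> \<le> indicator ({real_of_int j * a n..<real_of_int j * a n + a n} \<inter> J) t" for t
        using cell_weight_abs_le[OF g(2), of J j m t] by (simp add: algebra_simps)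
    qed (use C in simp)
    have sp: "0 < s" using s0 \<tau>0 by (simp add: s_def)
    have th: "\<theta> * \<tau> n \<le> 1" using s1 \<tau>0 by (simp add: \<theta>)
    have wmeas: "?w \<in> borel_measurable borel" by measurable
    have n1: "1 \<le> n" using g by simp
    have ev: "B n j m \<in> events"
      unfolding B_def by (rule empirical_deviation_tail(1)[where \<kappa> = \<kappa> and \<delta> = \<delta> and \<tau> = "\<tau> n" and s = s and \<theta> = \<theta> and m = "C * a n" and N = N])
        (fact ind dist n1 wmeas w\<tau> wm V Vm V\<kappa> N sp less_imp_le[OF \<delta>0] \<theta>_def th)+
    have "prob (B n j m) \<le> 2 * real N * exp (4 * \<theta> * (C * a n) * real n - s * (\<epsilon> * real n * a n))"
      unfolding B_def by (rule empirical_deviation_tail(2)[where \<kappa> = \<kappa> and \<delta> = \<delta> and \<tau> = "\<tau> n" and s = s and \<theta> = \<theta> and m = "C * a n" and N = N])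
        (fact ind dist n1 wmeas w\<tau> wm V Vm V\<kappa> N sp less_imp_le[OF \<delta>0] \<theta>_def th)+
    also have "4 * \<theta> * (C * a n) * real n - s * (\<epsilon> * real n * a n) = (4 * C * (s0 * \<delta> + s0\<^sup>2 * \<kappa>\<^sup>2) - s0 * \<epsilon>) * (real n * a n / \<tau> n)"
      using \<tau>0 by (simp add: \<theta> s_def field_simps)
    also have "2 * real N * exp \<dots> \<le> 2 * real N * exp (- (c0 * (real n * a n / \<tau> n)))"
    proof -
      have "(4 * C * (s0 * \<delta> + s0\<^sup>2 * \<kappa>\<^sup>2) - s0 * \<epsilon>) * (real n * a n / \<tau> n) \<le> (- (s0 * \<epsilon> / 2)) * (real n * a n / \<tau> n)"
        using s2 g \<tau>0 by (intro mult_right_mono) auto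
      then show ?thesis by (intro mult_left_mono) (auto simp: c0_def)
    qed
    also have "\<dots> \<le> 2 * real N * exp (- (3 * ln (real n)))" using g by (intro mult_left_mono) auto
    also have "exp (- (3 * ln (real n))) = 1 / real n ^ 3"
    proof -
      have "exp (3 * ln (real n)) = real n ^ 3"
        using exp_of_nat_mult[of 3 "ln (real n)"] g by simp
      then show ?thesis by (simp add: exp_minus divide_inverse)
    qed
    finally show ?thesis using ev by simp
  qed
  \<comment> \<open>Empty for the finitely many \<open>n\<close> that are not good, so that the
    probability bound below holds for every \<open>n\<close>.\<close>
  define A where "A n = (if good n then (\<Union>j\<in>cells (a n) lo hi. \<Union>m\<in>{..q}. B n j m) else {})" for n
  have Bm: "(\<Union>m\<in>{..q}. B n j m) \<in> events" if "good n" for n j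
    using B[OF that] by (intro sets.finite_UN) auto
  have Am: "A n \<in> events" for n
  proof (cases "good n")
    case True
    then have "(\<Union>j\<in>cells (a n) lo hi. \<Union>m\<in>{..q}. B n j m) \<in> events"
      using B[OF True] by (intro sets.finite_UN) auto
    then show ?thesis using True by (simp add: A_def)
  qed (simp add: A_def)
  define L where "L = (hi - lo + 2) * (real q + 1) * (2 * real N)"
  have AP: "prob (A n) \<le> L * inverse (real n ^ 2)" for n
  proof (cases "good n")
    case False
    then show ?thesis using lohi by (simp add: A_def L_def)
  next
    case True
    then have g: "3 \<le> n" "0 < a n" "a n \<le> 1" "1 \<le> real n * a n" by (auto simp: good_def)
    let ?JJ = "cells (a n) lo hi"
    have "A n = (\<Union>j\<in>?JJ. \<Union>m\<in>{..q}. B n j m)" using True by (simp add: A_def)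
    then have "prob (A n) \<le> (\<Sum>j\<in>?JJ. prob (\<Union>m\<in>{..q}. B n j m))"
      using Bm[OF True] by (simp only:) (rule finite_measure_subadditive_finite; blast intro: finite_atLeastAtMost_int)
    also have "\<dots> \<le> (\<Sum>j\<in>?JJ. \<Sum>m\<in>{..q}. prob (B n j m))"
      using B[OF True] by (intro sum_mono finite_measure_subadditive_finite) auto
    also have "\<dots> \<le> (\<Sum>j\<in>?JJ. \<Sum>m\<in>{..q}. 2 * real N * (1 / real n ^ 3))"
      using B[OF True] by (intro sum_mono) auto
    also have "\<dots> = real (card ?JJ) * ((real q + 1) * (2 * real N * (1 / real n ^ 3)))" by simp
    also have "\<dots> \<le> ((hi - lo + 2) * real n) * ((real q + 1) * (2 * real N * (1 / real n ^ 3)))"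
    proof (intro mult_right_mono)
      have "\<lfloor>lo / a n\<rfloor> \<le> \<lfloor>hi / a n\<rfloor>" using lohi g by (intro floor_mono divide_right_mono) auto
      then have "real (card ?JJ) = real_of_int \<lfloor>hi / a n\<rfloor> - real_of_int \<lfloor>lo / a n\<rfloor> + 1" by simp
      also have "\<dots> \<le> hi / a n - (lo / a n - 1) + 1" by linarith
      also have "\<dots> = (hi - lo) * (1 / a n) + 2 * 1" using g by (simp add: field_simps)
      also have "\<dots> \<le> (hi - lo) * (1 / a n) + 2 * (1 / a n)" using g by (intro add_left_mono mult_left_mono) auto
      also have "\<dots> = (hi - lo + 2) * (1 / a n)" by (simp only: distrib_right)
      also have "\<dots> \<le> (hi - lo + 2) * real n" using g lohi by (intro mult_left_mono) (auto simp: pos_divide_le_eq)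
      finally show "real (card ?JJ) \<le> (hi - lo + 2) * real n" .
    qed simp
    also have "\<dots> = L * inverse (real n ^ 2)"
      using g unfolding L_def by (simp add: power2_eq_square power3_eq_cube field_simps)
    finally show ?thesis .
  qed
  have "summable (\<lambda>n. L * inverse (real n ^ 2))" by (intro summable_mult inverse_power_summable) simp
  then have "summable (\<lambda>n. prob (A n))"
    by (rule summable_comparison_test'[where N = 0]) (use AP in simp)
  then have "AE \<omega> in M. eventually (\<lambda>n. \<omega> \<in> space M - A n) sequentially"
    using Am by (intro borel_cantelli_AE1) (auto simp: emeasure_eq_measure)
  then show ?thesis
  proof eventually_elim
    case (elim \<omega>)
    show ?case
      using elim ev_good
    proof eventually_elim
      case (elim n)
      show ?case
      proof (intro ballI allI impI)
        fix j m v assume j: "j \<in> cells (a n) lo hi" and m: "m \<le> q" and v: "v \<in> V"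
        have "\<omega> \<notin> B n j m" using elim j m by (auto simp: A_def)
        then show "?dev \<omega> n j m v \<le> \<epsilon> * real n * a n"
          using elim(1) v unfolding B_def by (auto simp: not_less)
      qed
    qed
  qed
qed

text \<open>Dominated convergence with the weight \<open>w\<close> held fixed. The approximating
  kernels supplied by pointwise measurability may have any bandwidths, which does no harm because
  the deviation bound holds on all of the countable subclass.\<close>

lemma deviation_pointwise_limit:
  fixes D :: "(real \<times> real) measure" and z :: "nat \<Rightarrow> real \<times> real" and s :: "nat \<Rightarrow> real \<Rightarrow> real"
  assumes D: "prob_space D" and sD[measurable_cong]: "sets D = sets borel"
    and w[measurable]: "w \<in> borel_measurable borel" and w\<tau>: "\<And>z. \<bar>w z\<bar> \<le> \<tau>"
    and s[measurable]: "\<And>m. s m \<in> borel_measurable borel" and s\<kappa>: "\<And>m t. \<bar>s m t\<bar> \<le> \<kappa>"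
    and u[measurable]: "u \<in> borel_measurable borel" and lim: "\<And>t. (\<lambda>m. s m t) \<longlonglongrightarrow> u t"
    and dev: "\<And>m. \<bar>(\<Sum>i=1..n. s m (fst (z i)) * w (z i)) - real n * (\<integral>z. s m (fst z) * w z \<partial>D)\<bar> \<le> e"
  shows "\<bar>(\<Sum>i=1..n. u (fst (z i)) * w (z i)) - real n * (\<integral>z. u (fst z) * w z \<partial>D)\<bar> \<le> e"
proof -
  interpret D: prob_space D by (rule D)
  note [measurable] = measurable_fst_snd_borel
  have \<kappa>0: "0 \<le> \<kappa>" using s\<kappa>[of 0 0] by linarith
  have "(\<lambda>m. \<integral>z. s m (fst z) * w z \<partial>D) \<longlonglongrightarrow> (\<integral>z. u (fst z) * w z \<partial>D)"
  proof (rule integral_dominated_convergence[where w = "\<lambda>_. \<kappa> * \<tau>"])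
    show "AE z in D. (\<lambda>m. s m (fst z) * w z) \<longlonglongrightarrow> u (fst z) * w z"
      by (intro AE_I2 tendsto_intros lim)
    show "AE z in D. norm (s m (fst z) * w z) \<le> \<kappa> * \<tau>" for m
      unfolding real_norm_def abs_mult using s\<kappa> w\<tau> \<kappa>0 by (intro AE_I2 mult_mono) auto
  qed auto
  then have "(\<lambda>m. \<bar>(\<Sum>i=1..n. s m (fst (z i)) * w (z i)) - real n * (\<integral>z. s m (fst z) * w z \<partial>D)\<bar>)
     \<longlonglongrightarrow> \<bar>(\<Sum>i=1..n. u (fst (z i)) * w (z i)) - real n * (\<integral>z. u (fst z) * w z \<partial>D)\<bar>"
    by (intro tendsto_intros lim)
  then show ?thesis by (rule LIMSEQ_le_const2) (use dev in auto)
qed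

text \<open>To be used with \<open>\<psi> n\<close> constantly 1 and with the response truncated at
  \<open>\<tau> n\<close>. The stochastic error and the bias each take half of
  \<open>e\<close>.\<close>

lemma (in prob_space) local_moment_convergence:
  fixes Z :: "nat \<Rightarrow> 'a \<Rightarrow> real \<times> real" and f :: "real \<times> real \<Rightarrow> real" and K :: "real \<Rightarrow> real"
    and \<psi> :: "nat \<Rightarrow> real \<Rightarrow> real" and a b \<tau> :: "nat \<Rightarrow> real"
  defines "D \<equiv> law f"
  assumes ind: "indep_vars (\<lambda>_. borel) Z UNIV" and dist: "\<And>i. distr M borel (Z i) = D"
    and f0: "\<And>z. 0 \<le> f z" and fm: "f \<in> borel_measurable borel"
    and Km[measurable]: "K \<in> borel_measurable borel" and K0: "\<And>u. 0 \<le> K u" and K\<kappa>: "\<And>u. K u \<le> \<kappa>" and \<kappa>: "0 < \<kappa>"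
    and Ks: "\<And>u. 1/2 < \<bar>u\<bar> \<Longrightarrow> K u = 0" and K1: "(\<integral>u. K u \<partial>lborel) = 1"
    and pm: "pointwise_measurable_class borel (kernel_class K)"
    and cov: "\<And>\<delta>. 0 < \<delta> \<Longrightarrow> \<exists>N. L1_cover (kernel_class K) \<kappa> \<delta> N"
    and \<psi>m[measurable]: "\<And>n. \<psi> n \<in> borel_measurable borel" and \<psi>B: "\<And>n y. \<bar>\<psi> n y\<bar> \<le> \<tau> n" and \<tau>: "\<And>n. 1 \<le> \<tau> n"
    and C: "0 < C" and mass: "\<And>n. AE t\<in>J in lborel. (\<integral>\<^sup>+y. ennreal (\<bar>\<psi> n y\<bar> * f (t, y)) \<partial>lborel) \<le> ennreal C"
    and a: "eventually (\<lambda>n. 0 < a n) sequentially" "a \<longlonglongrightarrow> 0" and b: "b \<longlonglongrightarrow> 0"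
    and rate: "filterlim (\<lambda>n. real n * a n / (\<tau> n * ln (real n))) at_top sequentially"
    and J: "compact J" and \<eta>: "0 < \<eta>" "\<And>x. x \<in> I \<Longrightarrow> {x - \<eta>..x + \<eta>} \<subseteq> J"
    and R: "continuous_on J R"
    and bias: "\<And>e. 0 < e \<Longrightarrow> eventually (\<lambda>n. AE t\<in>J in lborel. \<bar>(\<integral>y. \<psi> n y * f (t, y) \<partial>lborel) - R t\<bar> \<le> e) sequentially"
  shows "AE \<omega> in M. \<forall>e>0. eventually (\<lambda>n. \<forall>x\<in>I. \<forall>h\<in>{a n..b n}. \<forall>k\<le>q.
     \<bar>(\<Sum>i=1..n. ((fst (Z i \<omega>) - x) / h) ^ k * K ((x - fst (Z i \<omega>)) / h) * \<psi> n (snd (Z i \<omega>))) / (real n * h)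
        - R x * kernel_moment K k\<bar> \<le> e) sequentially"
proof -
  let ?err = "\<lambda>\<omega> n x h k. \<bar>(\<Sum>i=1..n. ((fst (Z i \<omega>) - x) / h) ^ k * K ((x - fst (Z i \<omega>)) / h) * \<psi> n (snd (Z i \<omega>))) / (real n * h)
        - R x * kernel_moment K k\<bar>"
  let ?dev = "\<lambda>\<omega> n j m v. \<bar>(\<Sum>i=1..n. v (fst (Z i \<omega>)) * (cell_weight J (a n) j m (fst (Z i \<omega>)) * \<psi> n (snd (Z i \<omega>))))
        - real n * (\<integral>z. v (fst z) * (cell_weight J (a n) j m (fst z) * \<psi> n (snd z)) \<partial>D)\<bar>"
  have Zm: "random_variable borel (Z 0)" using ind by (auto simp: indep_vars_def)
  have Dp: "prob_space D" using prob_space_distr[OF Zm] dist by simp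
  have sD: "sets D = sets borel" by (simp add: D_def)
  have Jb: "J \<in> sets borel" using J by (simp add: borel_compact)
  have IJ: "x \<in> J" if "x \<in> I" for x using \<eta>(2)[OF that] \<eta>(1) by (auto simp: subset_iff)
  obtain V where V: "V \<subseteq> kernel_class K" "countable V"
    "\<And>u. u \<in> kernel_class K \<Longrightarrow> \<exists>s. (\<forall>m. s m \<in> V) \<and> (\<forall>x. (\<lambda>m. s m x) \<longlonglongrightarrow> u x)"
    using pm unfolding pointwise_measurable_class_def by (auto simp: space_borel)
  have kc: "(\<lambda>t. K ((x - t) / h)) \<in> kernel_class K" if "0 < h" for x h using that by (auto simp: kernel_class_def)
  have Vne: "V \<noteq> {}" using V(3)[OF kc[of 1 0]] by auto
  have Vm: "v \<in> borel_measurable borel" "\<bar>v t\<bar> \<le> \<kappa>" if "v \<in> V" for v t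
    using V(1) that K0 K\<kappa> by (auto simp: kernel_class_def)
  have covV: "\<exists>N. L1_cover V \<kappa> \<delta> N" if "0 < \<delta>" for \<delta> using cov[OF that] L1_cover_mono[OF _ V(1) order_refl] by blast
  obtain B where B: "\<And>x. x \<in> J \<Longrightarrow> \<bar>x\<bar> \<le> B" using compact_imp_bounded[OF J] by (auto simp: bounded_iff)
  \<comment> \<open>A symmetric interval around \<open>J\<close> with a margin of 1: it contains
    every window with \<open>h < 1\<close> around a point of \<open>I\<close>, so one range of cells
    serves all bandwidths.\<close>
  define lo where "lo = - \<bar>B\<bar> - 1" define hi where "hi = \<bar>B\<bar> + 1"
  have "AE \<omega> in M. eventually (\<lambda>n. \<forall>j\<in>cells (a n) lo hi. \<forall>m\<le>q. \<forall>v\<in>V.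
      ?dev \<omega> n j m v \<le> (1 / real (Suc r)) * real n * a n) sequentially" for r
    unfolding D_def
    by (rule cells_uniform_deviation[where \<kappa> = \<kappa> and \<tau> = \<tau> and C = C])
       (fact ind dist[unfolded D_def] f0 fm V(2) Vne Vm \<kappa> covV \<psi>m \<psi>B \<tau> C mass a rate Jb | simp add: lo_def hi_def)+
  \<comment> \<open>Countably many tolerances 1/(r+1) leave a single null set that serves all
    \<open>e\<close>.\<close>
  then have "AE \<omega> in M. \<forall>r. eventually (\<lambda>n. \<forall>j\<in>cells (a n) lo hi. \<forall>m\<le>q. \<forall>v\<in>V.
      ?dev \<omega> n j m v \<le> (1 / real (Suc r)) * real n * a n) sequentially"
    by (simp only: AE_all_countable) blast
  then show ?thesis
  proof eventually_elim
    case (elim \<omega>)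
    show ?case
    proof (intro allI impI)
      fix e :: real assume e: "0 < e"
      obtain r where r: "3 * 3 ^ q * (1 / real (Suc r)) \<le> e / 2"
      proof -
        obtain r where "3 * 3 ^ q / (e / 2) < real r" using reals_Archimedean2 by blast
        then have "3 * 3 ^ q < real (Suc r) * (e / 2)" using e by (simp add: pos_divide_less_eq distrib_right)
        then have "3 * 3 ^ q * (1 / real (Suc r)) \<le> e / 2" by (simp add: field_simps)
        then show ?thesis by (rule that)
      qed
      \<comment> \<open>One quarter of \<open>e\<close> goes to the variation of \<open>R\<close>
        over a window, another to the distance between the inner integral of \<open>\<psi> n\<close>
        and \<open>R\<close>.\<close>
      have "uniformly_continuous_on J R" using R J by (rule compact_uniformly_continuous)
      then obtain d where d: "0 < d" "\<And>x t. x \<in> J \<Longrightarrow> t \<in> J \<Longrightarrow> dist t x < d \<Longrightarrow> dist (R t) (R x) < e / 4"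
        using e unfolding uniformly_continuous_on_def by (metis divide_pos_pos zero_less_numeral)
      have evb: "eventually (\<lambda>n. b n < min 1 (min \<eta> d)) sequentially"
        using b by (rule order_tendstoD) (use \<eta> d in auto)
      have bias4: "eventually (\<lambda>n. AE t\<in>J in lborel. \<bar>(\<integral>y. \<psi> n y * f (t, y) \<partial>lborel) - R t\<bar> \<le> e / 4) sequentially"
        using e by (intro bias) auto
      show "eventually (\<lambda>n. \<forall>x\<in>I. \<forall>h\<in>{a n..b n}. \<forall>k\<le>q.
       ?err \<omega> n x h k \<le> e) sequentially"
        using elim[rule_format, of r] evb bias4 a(1) eventually_gt_at_top[of 0]
      proof eventually_elim
        case (elim n)
        show ?case
        proof (intro ballI allI impI)
          fix x h k assume x: "x \<in> I" and h: "h \<in> {a n..b n}" and k: "k \<le> q"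
          have h0: "0 < h" "a n \<le> h" using h elim(4) by auto
          have h1: "h < 1" "h < \<eta>" "h < d" using h elim(2) by auto
          have sub: "{x - h/2..x + h/2} \<subseteq> J"
          proof -
            have "{x - h/2..x + h/2} \<subseteq> {x - \<eta>..x + \<eta>}" using h1 h0 by auto
            then show ?thesis using \<eta>(2)[OF x] by blast
          qed
          have xB: "\<bar>x\<bar> \<le> \<bar>B\<bar>" using B[OF IJ[OF x]] by linarith
          have jj: "j \<in> cells (a n) lo hi" if "j \<in> cells (a n) (x - h/2) (x + h/2)" for j
          proof -
            have l: "lo / a n \<le> (x - h/2) / a n" "(x + h/2) / a n \<le> hi / a n"
              using xB h1 elim(4) by (auto simp: lo_def hi_def intro!: divide_right_mono)
            show ?thesis using floor_mono[OF l(1)] floor_mono[OF l(2)] that unfolding atLeastAtMost_iff by linarith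
          qed
          have dev: "\<bar>(\<Sum>i=1..n. K ((x - fst (Z i \<omega>)) / h) * (cell_weight J (a n) j m (fst (Z i \<omega>)) * \<psi> n (snd (Z i \<omega>))))
              - real n * (\<integral>z. K ((x - fst z) / h) * (cell_weight J (a n) j m (fst z) * \<psi> n (snd z)) \<partial>D)\<bar> \<le> (1 / real (Suc r)) * real n * a n"
            if j: "j \<in> cells (a n) (x - h/2) (x + h/2)" and m: "m \<le> k" for j m
          proof -
            obtain s where s: "\<And>i. s i \<in> V" "\<And>t. (\<lambda>i. s i t) \<longlonglongrightarrow> K ((x - t) / h)"
              using V(3)[OF kc[OF h0(1), of x]] by blast
            let ?w = "\<lambda>z. cell_weight J (a n) j m (fst z) * \<psi> n (snd z)"
            note [measurable] = measurable_fst_snd_borel cell_weight_measurable[OF Jb]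
            have w\<tau>: "\<bar>?w z\<bar> \<le> \<tau> n" for z
              using elim(4) \<psi>B by (rule cell_weight_mult_le)
            show ?thesis
            proof (rule deviation_pointwise_limit[where z = "\<lambda>i. Z i \<omega>" and w = ?w and u = "\<lambda>t. K ((x - t) / h)" and s = s
                  and \<tau> = "\<tau> n" and \<kappa> = \<kappa>, OF Dp sD])
              show "\<bar>(\<Sum>i = 1..n. s m' (fst (Z i \<omega>)) * ?w (Z i \<omega>)) - real n * (\<integral>z. s m' (fst z) * ?w z \<partial>D)\<bar>
                 \<le> 1 / real (Suc r) * real n * a n" for m'
                by (rule elim(1)[rule_format, OF jj[OF j] order_trans[OF m k] s(1)])
              show "?w \<in> borel_measurable borel" "(\<lambda>t. K ((x - t) / h)) \<in> borel_measurable borel" by measurable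
            qed (rule w\<tau> Vm(1)[OF s(1)] Vm(2)[OF s(1)] s(2))+
          qed
          have K\<kappa>': "\<bar>K u\<bar> \<le> \<kappa>" for u using K0 K\<kappa> by simp
          have 1: "\<bar>(\<Sum>i=1..n. ((fst (Z i \<omega>) - x) / h) ^ k * K ((x - fst (Z i \<omega>)) / h) * \<psi> n (snd (Z i \<omega>))) / (real n * h)
              - (\<integral>u. ((fst u - x) / h) ^ k * K ((x - fst u) / h) * \<psi> n (snd u) \<partial>D) / h\<bar> \<le> 3 * 3 ^ k * (1 / real (Suc r))"
            by (rule kernel_deviation_le[OF Dp sD Km K\<kappa>' Ks \<psi>m \<psi>B Jb sub elim(4) h0(2) elim(5) dev])
          let ?c = "\<lambda>t. ((t - x) / h) ^ k * K ((x - t) / h)"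
          have cB: "\<bar>?c t\<bar> \<le> \<kappa>" for t
          proof (cases "\<bar>(x - t) / h\<bar> \<le> 1/2")
            case True
            then have "\<bar>(t - x) / h\<bar> \<le> 1" using h0 by (simp add: abs_divide abs_minus_commute field_simps)
            then have "\<bar>((t - x) / h) ^ k\<bar> \<le> 1" by (rule abs_power_le_one)
            then have "\<bar>((t - x) / h) ^ k\<bar> * \<bar>K ((x - t) / h)\<bar> \<le> 1 * \<kappa>" using K\<kappa>' by (intro mult_mono) auto
            then show ?thesis by (simp add: abs_mult)
          next
            case False then show ?thesis using Ks \<kappa> by simp
          qed
          have cm: "?c \<in> borel_measurable borel" by measurable
          note bp = bounded_product_density_integral[OF f0 fm Dp[unfolded D_def] cm cB \<psi>m \<psi>B]
          have 2: "\<bar>(\<integral>t. ?c t * (\<integral>y. \<psi> n y * f (t, y) \<partial>lborel) \<partial>lborel) / h - R x * kernel_moment K k\<bar> \<le> e / 2"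
          proof (rule kernel_bias_le[OF Km K0 K\<kappa> Ks K1 h0(1) bp(2)])
            show "AE t in lborel. \<bar>t - x\<bar> \<le> h / 2 \<longrightarrow> \<bar>(\<integral>y. \<psi> n y * f (t, y) \<partial>lborel) - R x\<bar> \<le> e / 2"
              using elim(3)
            proof eventually_elim
              fix t assume t: "t \<in> J \<longrightarrow> \<bar>(\<integral>y. \<psi> n y * f (t, y) \<partial>lborel) - R t\<bar> \<le> e / 4"
              show "\<bar>t - x\<bar> \<le> h / 2 \<longrightarrow> \<bar>(\<integral>y. \<psi> n y * f (t, y) \<partial>lborel) - R x\<bar> \<le> e / 2"
              proof
                assume tx: "\<bar>t - x\<bar> \<le> h / 2"
                then have "t \<in> {x - h/2..x + h/2}" unfolding abs_le_iff atLeastAtMost_iff by linarith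
                then have tJ: "t \<in> J" using sub by blast
                have "dist (R t) (R x) < e / 4" using tx h1 h0 by (intro d(2) IJ x tJ) (simp add: dist_real_def)
                then have "\<bar>R t - R x\<bar> < e / 4" by (simp add: dist_real_def)
                then show "\<bar>(\<integral>y. \<psi> n y * f (t, y) \<partial>lborel) - R x\<bar> \<le> e / 2" using t tJ by linarith
              qed
            qed
          qed
          have 3: "3 * 3 ^ k * (1 / real (Suc r)) \<le> e / 2"
            using k by (intro order_trans[OF _ r] mult_right_mono mult_left_mono power_increasing) auto
          have tri: "\<bar>A - E\<bar> \<le> \<bar>A - B\<bar> + \<bar>B - E\<bar>" for A B E :: real by linarith
          have "?err \<omega> n x h k \<le> e / 2 + e / 2"
            by (rule order_trans[OF tri add_mono[OF order_trans[OF 1[unfolded D_def bp(1)] 3] 2]])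
          then show "?err \<omega> n x h k \<le> e" by (simp only: field_sum_of_halves)
        qed
      qed
    qed
  qed
qed

section \<open>Truncation of the response\<close>

definition trunc :: "real \<Rightarrow> real \<Rightarrow> real" where
  "trunc c y = (if \<bar>y\<bar> \<le> c then y else 0)"

abbreviation abs_moment :: "(real \<times> real \<Rightarrow> real) \<Rightarrow> real \<Rightarrow> ennreal" where
  "abs_moment f t \<equiv> \<integral>\<^sup>+y. ennreal (\<bar>y\<bar> * f (t, y)) \<partial>lborel"

abbreviation trunc_bias :: "(real \<times> real \<Rightarrow> real) \<Rightarrow> real \<Rightarrow> real \<Rightarrow> real" where
  "trunc_bias f c t \<equiv> \<bar>(\<integral>y. trunc c y * f (t, y) \<partial>lborel) - (\<integral>y. y * f (t, y) \<partial>lborel)\<bar>"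

text \<open>The interface between the two alternative moment conditions and the rest of the
  argument. Responses matter only where the design point lies in \<open>J\<close>, since the kernel
  sees no others. The density conditions are almost everywhere in \<open>t\<close> because an almost
  sure bound on the response restricts \<open>f\<close> only up to null sets.\<close>

definition truncation_sequence ::
  "'a measure \<Rightarrow> (nat \<Rightarrow> 'a \<Rightarrow> real \<times> real) \<Rightarrow> (real \<times> real \<Rightarrow> real) \<Rightarrow> real set \<Rightarrow> (nat \<Rightarrow> real) \<Rightarrow> (nat \<Rightarrow> real) \<Rightarrow> bool"
where
  "truncation_sequence M Z f J a \<tau> \<longleftrightarrow>
     (\<forall>n. 1 \<le> \<tau> n) \<and> filterlim (\<lambda>n. real n * a n / (\<tau> n * ln (real n))) at_top sequentially \<and>
     (AE \<omega> in M. eventually (\<lambda>n. \<forall>i\<in>{1..n}. fst (Z i \<omega>) \<in> J \<longrightarrow> \<bar>snd (Z i \<omega>)\<bar> \<le> \<tau> n) sequentially) \<and>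
     (\<exists>C>0. AE t\<in>J in lborel. abs_moment f t \<le> ennreal C) \<and>
     (\<forall>e>0. eventually (\<lambda>n. AE t\<in>J in lborel. trunc_bias f (\<tau> n) t \<le> e) sequentially)"

lemma section_measurable:
  fixes f :: "real \<times> real \<Rightarrow> real"
  assumes "f \<in> borel_measurable borel"
  shows "(\<lambda>y. f (t, y)) \<in> borel_measurable borel"
proof -
  have "f \<in> borel_measurable (lborel \<Otimes>\<^sub>M lborel)" using assms by (simp add: lborel_prod)
  from measurable_Pair2[OF this, of t] show ?thesis by simp
qed

text \<open>Positivity forces integrability, because a Bochner integral that does not exist has the
  value 0.\<close>

lemma marginal_density_nn_integral:
  assumes f0: "\<And>z. 0 \<le> f z" and pos: "0 < marginal_density f t"
  shows "(\<integral>\<^sup>+y. ennreal (f (t, y)) \<partial>lborel) = ennreal (marginal_density f t)"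
proof -
  have "integrable lborel (\<lambda>y. f (t, y))"
  proof (rule ccontr)
    assume "\<not> ?thesis" then have "marginal_density f t = 0"
      unfolding marginal_density_def by (rule not_integrable_integral_eq)
    with pos show False by simp
  qed
  then show ?thesis unfolding marginal_density_def using f0 by (intro nn_integral_eq_integral) auto
qed

text \<open>A constant level above the bound suffices, since truncation then changes nothing almost
  surely; \<open>max 1 B\<close> also meets the requirement that levels be at least 1.\<close>

lemma (in prob_space) bounded_truncation_sequence:
  fixes Z :: "nat \<Rightarrow> 'a \<Rightarrow> real \<times> real" and f :: "real \<times> real \<Rightarrow> real"
  defines "D \<equiv> law f"
  assumes Z[measurable]: "\<And>i. Z i \<in> borel_measurable M" and dist: "\<And>i. distr M borel (Z i) = D"
    and f0: "\<And>z. 0 \<le> f z" and fm: "f \<in> borel_measurable borel"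
    and J[measurable]: "J \<in> sets borel" and mp: "\<And>t. t \<in> J \<Longrightarrow> 0 < marginal_density f t" and mC: "\<And>t. t \<in> J \<Longrightarrow> marginal_density f t \<le> Cf"
    and B: "0 < B" "AE \<omega> in M. \<bar>snd (Z 0 \<omega>)\<bar> * indicator J (fst (Z 0 \<omega>)) \<le> B" and Cf: "0 < Cf"
    and rate: "filterlim (\<lambda>n. real n * a n / ln (real n)) at_top sequentially"
  shows "\<exists>\<tau>. truncation_sequence M Z f J a \<tau>"
proof (intro exI[of _ "\<lambda>_. max 1 B"], unfold truncation_sequence_def, intro conjI allI impI)
  note [measurable] = measurable_fst_snd_borel
  have P[measurable]: "{z::real\<times>real. \<bar>snd z\<bar> * indicator J (fst z) \<le> B} \<in> sets borel" by measurable
  have AED: "AE z in D. \<bar>snd z\<bar> * indicator J (fst z) \<le> B"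
    unfolding dist[of 0, symmetric] using B(2) by (subst AE_distr_iff) (auto intro: P)
  show "filterlim (\<lambda>n. real n * a n / (max 1 B * ln (real n))) at_top sequentially"
  proof -
    have "filterlim (\<lambda>n. (1 / max 1 B) * (real n * a n / ln (real n))) at_top sequentially"
      using B by (intro filterlim_tendsto_pos_mult_at_top[OF tendsto_const _ rate]) auto
    then show ?thesis by simp
  qed
  show "AE \<omega> in M. eventually (\<lambda>n. \<forall>i\<in>{1..n}. fst (Z i \<omega>) \<in> J \<longrightarrow> \<bar>snd (Z i \<omega>)\<bar> \<le> max 1 B) sequentially"
  proof -
    have "AE \<omega> in M. \<bar>snd (Z i \<omega>)\<bar> * indicator J (fst (Z i \<omega>)) \<le> B" for i
      using AED unfolding dist[of i, symmetric] by (subst (asm) AE_distr_iff) (auto intro: P)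
    then have "AE \<omega> in M. \<forall>i. \<bar>snd (Z i \<omega>)\<bar> * indicator J (fst (Z i \<omega>)) \<le> B" by (simp add: AE_all_countable)
    then show ?thesis
    proof eventually_elim
      case (elim \<omega>)
      have "fst (Z i \<omega>) \<in> J \<longrightarrow> \<bar>snd (Z i \<omega>)\<bar> \<le> max 1 B" for i using elim[rule_format, of i] by auto
      then show ?case by simp
    qed
  qed
  have "AE z in lborel. 0 < ennreal (f z) \<longrightarrow> \<bar>snd z\<bar> * indicator J (fst z) \<le> B"
    using AED fm unfolding D_def by (subst (asm) AE_density) auto
  \<comment> \<open>Fubini for null sets: the almost sure bound on the response becomes a statement
    about almost every section of the density.\<close>
  then have "AE t in lborel. AE y in lborel. 0 < ennreal (f (t, y)) \<longrightarrow> \<bar>snd (t, y)\<bar> * indicator J (fst (t, y)) \<le> B"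
    unfolding lborel_prod[symmetric] by (rule lborel_pair.AE_pair)
  then have sec: "AE t in lborel. AE y in lborel. t \<in> J \<longrightarrow> 0 < f (t, y) \<longrightarrow> \<bar>y\<bar> \<le> B"
    by eventually_elim (auto elim!: eventually_mono)
  show "\<exists>C>0. AE t\<in>J in lborel. abs_moment f t \<le> ennreal C"
  proof (intro exI[of _ "B * Cf"] conjI)
    show "AE t\<in>J in lborel. abs_moment f t \<le> ennreal (B * Cf)"
      using sec
    proof eventually_elim
      case (elim t)
      show ?case
      proof
        assume t: "t \<in> J"
        have "abs_moment f t \<le> (\<integral>\<^sup>+y. ennreal B * ennreal (f (t, y)) \<partial>lborel)"
        proof (rule nn_integral_mono_AE, use elim in eventually_elim)
          fix y assume y: "t \<in> J \<longrightarrow> 0 < f (t, y) \<longrightarrow> \<bar>y\<bar> \<le> B"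
          have "\<bar>y\<bar> * f (t, y) \<le> B * f (t, y)"
          proof (cases "f (t, y) = 0")
            case False then show ?thesis using y t f0[of "(t, y)"] by (intro mult_right_mono) auto
          qed simp
          then show "ennreal (\<bar>y\<bar> * f (t, y)) \<le> ennreal B * ennreal (f (t, y))"
            using B(1) f0 by (simp add: ennreal_mult[symmetric] ennreal_leI)
        qed
        also have "\<dots> = ennreal B * ennreal (marginal_density f t)"
          using section_measurable[OF fm, of t] by (subst nn_integral_cmult) (auto simp: marginal_density_nn_integral[OF f0 mp[OF t]])
        also have "\<dots> = ennreal (B * marginal_density f t)"
          using B(1) mp[OF t] by (intro ennreal_mult[symmetric]) auto
        also have "\<dots> \<le> ennreal (B * Cf)" using mC[OF t] B(1) by (intro ennreal_leI mult_left_mono) auto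
        finally show "abs_moment f t \<le> ennreal (B * Cf)" .
      qed
    qed
  qed (use B Cf in simp)
  fix e :: real assume e: "0 < e"
  have tm: "trunc c \<in> borel_measurable borel" for c unfolding trunc_def[abs_def] by measurable
  have "AE t\<in>J in lborel. (\<integral>y. trunc (max 1 B) y * f (t, y) \<partial>lborel) = (\<integral>y. y * f (t, y) \<partial>lborel)"
    using sec
  proof eventually_elim
    case (elim t)
    show ?case
    proof (intro impI integral_cong_AE)
      assume t: "t \<in> J"
      show "AE y in lborel. trunc (max 1 B) y * f (t, y) = y * f (t, y)"
        using elim
      proof eventually_elim
        fix y assume y: "t \<in> J \<longrightarrow> 0 < f (t, y) \<longrightarrow> \<bar>y\<bar> \<le> B"
        show "trunc (max 1 B) y * f (t, y) = y * f (t, y)"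
          using y t f0[of "(t, y)"] by (cases "f (t, y) = 0") (auto simp: trunc_def)
      qed
    qed (use tm section_measurable[OF fm, of t] in auto)
  qed
  then have "AE t\<in>J in lborel. trunc_bias f (max 1 B) t \<le> e"
    by eventually_elim (use e in simp)
  then show "eventually (\<lambda>n. AE t\<in>J in lborel. trunc_bias f (max 1 B) t \<le> e) sequentially"
    by (rule always_eventually[OF allI])
qed simp

text \<open>With e = 2/q, n a_n is c n^e (ln n)^(1-e) and the level is n^(3e/4), so the quotient
  equals c (n^(1/4) / ln n)^e.\<close>

lemma moment_rate_at_top:
  fixes q c :: real and a :: "nat \<Rightarrow> real"
  assumes q: "2 < q" and c: "0 < c" and a: "\<And>n. 2 \<le> n \<Longrightarrow> a n = c * (ln (real n) / real n) powr (1 - 2 / q)"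
  shows "filterlim (\<lambda>n. real n * a n / (max 1 (real n powr (3 / (2 * q))) * ln (real n))) at_top sequentially"
proof -
  define e where "e = 2 / q"
  have e: "0 < e" using q by (simp add: e_def)
  have "(\<lambda>n. (ln (real n) / real n powr (1/4)) powr e) \<longlonglongrightarrow> 0"
  proof (rule tendsto_zero_powrI[OF lim_ln_over_power tendsto_const _ e])
    show "eventually (\<lambda>n. 0 \<le> ln (real n) / real n powr (1/4)) sequentially"
      using eventually_ge_at_top[of 1] by eventually_elim auto
  qed simp
  then have "filterlim (\<lambda>n. inverse ((ln (real n) / real n powr (1/4)) powr e)) at_top sequentially"
  proof (rule filterlim_inverse_at_top)
    show "eventually (\<lambda>n. 0 < (ln (real n) / real n powr (1/4)) powr e) sequentially"
      using eventually_ge_at_top[of 2] by eventually_elim auto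
  qed
  then have lim: "filterlim (\<lambda>n. c * inverse ((ln (real n) / real n powr (1/4)) powr e)) at_top sequentially"
    by (rule filterlim_tendsto_pos_mult_at_top[OF tendsto_const c])
  have eq: "eventually (\<lambda>n. c * inverse ((ln (real n) / real n powr (1/4)) powr e)
      = real n * a n / (max 1 (real n powr (3 / (2 * q))) * ln (real n))) sequentially"
    using eventually_ge_at_top[of 2]
  proof eventually_elim
    case (elim n)
    define N where "N = real n"
    define L where "L = ln N"
    have L: "0 < L" and N: "1 < N" using elim by (auto simp: L_def N_def)
    have N34: "3 / (2 * q) = (3/4) * e" by (simp add: e_def)
    have mx: "max 1 (N powr ((3/4) * e)) = N powr ((3/4) * e)"
      using N e by (simp add: max_def ge_one_powr_ge_zero)
    have "N * (c * (L / N) powr (1 - e)) / (N powr ((3/4) * e) * L) = c * inverse ((L / N) powr e * N powr ((3/4) * e))"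
      using L N by (simp add: powr_diff field_simps)
    also have "(L / N) powr e * N powr ((3/4) * e) = (L / N powr (1/4)) powr e"
    proof -
      have "N powr e = N powr ((3/4) * e) * N powr ((1/4) * e)" by (simp add: powr_add[symmetric] algebra_simps)
      then show ?thesis using L N by (simp add: powr_divide powr_powr field_simps)
    qed
    finally show ?case unfolding a[OF elim] N34 N_def[symmetric] L_def[symmetric] mx e_def[symmetric] by simp
  qed
  show ?thesis by (rule filterlim_cong[OF refl refl eq, THEN iffD1, OF lim])
qed

text \<open>Markov's inequality of order \<open>q\<close> bounds the probability that an observation
  exceeds the level of its own index \<open>i\<close> by a multiple of i^(-3/2), which is summable.
  Beyond the level, |y| is at most |y|^q / \<tau> n, so the truncation bias is of order 1 / \<tau>
  n.\<close>

lemma (in prob_space) moment_truncation_sequence: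
  fixes Z :: "nat \<Rightarrow> 'a \<Rightarrow> real \<times> real" and f :: "real \<times> real \<Rightarrow> real" and q c :: real
  defines "D \<equiv> law f"
  assumes Z[measurable]: "\<And>i. Z i \<in> borel_measurable M" and dist: "\<And>i. distr M borel (Z i) = D"
    and f0: "\<And>z. 0 \<le> f z" and fm: "f \<in> borel_measurable borel"
    and Jc: "compact J" and mp: "\<And>t. t \<in> J \<Longrightarrow> 0 < marginal_density f t" and mC: "\<And>t. t \<in> J \<Longrightarrow> marginal_density f t \<le> Cf"
    and Cf: "0 < Cf" and q: "2 < q" and fin: "(SUP z\<in>J. cond_nn_expectation f (\<lambda>y. \<bar>y\<bar> powr q) z) < \<infinity>"
    and c: "0 < c" and a: "\<And>n. 2 \<le> n \<Longrightarrow> a n = c * (ln (real n) / real n) powr (1 - 2 / q)"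
  shows "\<exists>\<tau>. truncation_sequence M Z f J a \<tau>"
proof -
  \<comment> \<open>Any exponent strictly between \<open>1/q\<close> (for Borel-Cantelli) and \<open>2/q\<close> (for the rate) would do.\<close>
  define \<tau> where "\<tau> n = max 1 (real n powr (3 / (2 * q)))" for n
  note [measurable] = measurable_fst_snd_borel
  have J[measurable]: "J \<in> sets borel" using Jc by (rule borel_compact)
  have \<tau>1: "1 \<le> \<tau> n" for n by (simp add: \<tau>_def)
  \<comment> \<open>Borel-Cantelli compares observation \<open>i\<close> with the level of index
    \<open>i\<close>; monotonicity transfers this to all later levels.\<close>
  have \<tau>mono: "\<tau> m \<le> \<tau> n" if "m \<le> n" for m n
    unfolding \<tau>_def using that q by (intro max.mono powr_mono2) auto
  have \<tau>inf: "filterlim \<tau> at_top sequentially"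
  proof (rule filterlim_at_top_mono)
    show "filterlim (\<lambda>n. real n powr (3 / (2 * q))) at_top sequentially"
    proof -
      have "(\<lambda>n. real n powr (- (3 / (2 * q)))) \<longlonglongrightarrow> 0"
        using q by (intro tendsto_neg_powr filterlim_real_sequentially) auto
      then have "filterlim (\<lambda>n. inverse (real n powr (- (3 / (2 * q))))) at_top sequentially"
        by (rule filterlim_inverse_at_top) (use eventually_gt_at_top[of 0] in \<open>eventually_elim, simp\<close>)
      then show ?thesis by (simp add: powr_minus)
    qed
  qed (simp add: \<tau>_def)
  obtain S where S: "0 \<le> S" "(SUP z\<in>J. cond_nn_expectation f (\<lambda>y. \<bar>y\<bar> powr q) z) = ennreal S"
    using fin by (cases "SUP z\<in>J. cond_nn_expectation f (\<lambda>y. \<bar>y\<bar> powr q) z") auto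
  define E where "E = S * Cf"
  have E0: "0 \<le> E" using S Cf by (simp add: E_def)
  have mom: "(\<integral>\<^sup>+y. ennreal (\<bar>y\<bar> powr q * f (t, y)) \<partial>lborel) \<le> ennreal E" if t: "t \<in> J" for t
  proof -
    let ?m = "ennreal (marginal_density f t)"
    have m: "?m \<noteq> 0" "?m \<noteq> top" using mp[OF t] by auto
    have "(\<integral>\<^sup>+y. ennreal (\<bar>y\<bar> powr q * f (t, y)) \<partial>lborel) = cond_nn_expectation f (\<lambda>y. \<bar>y\<bar> powr q) t * ?m"
      unfolding cond_nn_expectation_def using m by (simp add: ennreal_divide_times top.not_eq_extremum)
    also have "\<dots> \<le> ennreal S * ?m"
      unfolding S(2)[symmetric] using t by (intro mult_right_mono SUP_upper) auto
    also have "\<dots> \<le> ennreal S * ennreal Cf" using mC[OF t] by (intro mult_left_mono ennreal_leI) auto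
    also have "\<dots> = ennreal E" using S Cf by (simp add: E_def ennreal_mult)
    finally show ?thesis .
  qed
  have abs1: "abs_moment f t \<le> ennreal (Cf + E)" if t: "t \<in> J" for t
  proof -
    note [measurable] = section_measurable[OF fm, of t]
    have "abs_moment f t \<le> (\<integral>\<^sup>+y. ennreal (f (t, y)) + ennreal (\<bar>y\<bar> powr q * f (t, y)) \<partial>lborel)"
    proof (intro nn_integral_mono)
      fix y :: real
      have "\<bar>y\<bar> \<le> 1 + \<bar>y\<bar> powr q"
      proof (cases "\<bar>y\<bar> \<le> 1")
        case False
        then have "\<bar>y\<bar> powr 1 \<le> \<bar>y\<bar> powr q" using q by (intro powr_mono) auto
        then show ?thesis using False by simp
      qed (use powr_ge_zero[of "\<bar>y\<bar>" q] in linarith)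
      then have "\<bar>y\<bar> * f (t, y) \<le> (1 + \<bar>y\<bar> powr q) * f (t, y)" using f0 by (intro mult_right_mono)
      then show "ennreal (\<bar>y\<bar> * f (t, y)) \<le> ennreal (f (t, y)) + ennreal (\<bar>y\<bar> powr q * f (t, y))"
        using f0 by (simp add: ennreal_plus[symmetric] distrib_right ennreal_leI del: ennreal_plus)
    qed
    also have "\<dots> = ennreal (marginal_density f t) + (\<integral>\<^sup>+y. ennreal (\<bar>y\<bar> powr q * f (t, y)) \<partial>lborel)"
      by (subst nn_integral_add) (auto simp: marginal_density_nn_integral[OF f0 mp[OF t]])
    also have "\<dots> \<le> ennreal Cf + ennreal E" using mom[OF t] mC[OF t] by (intro add_mono ennreal_leI)
    also have "\<dots> = ennreal (Cf + E)" using E0 Cf by simp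
    finally show ?thesis .
  qed
  have bias: "trunc_bias f (\<tau> n) t \<le> E / \<tau> n" if t: "t \<in> J" for t n
  proof -
    note [measurable] = section_measurable[OF fm, of t]
    have [measurable]: "trunc c \<in> borel_measurable borel" for c unfolding trunc_def[abs_def] by measurable
    have \<tau>0: "0 < \<tau> n" using \<tau>1[of n] by linarith
    have i1: "integrable lborel (\<lambda>y. y * f (t, y))"
    proof (rule integrableI_bounded)
      have "(\<integral>\<^sup>+y. ennreal (norm (y * f (t, y))) \<partial>lborel) = abs_moment f t"
        using f0 by (simp add: abs_mult)
      also have "\<dots> < \<infinity>" using abs1[OF t] by (rule order.strict_trans1) simp
      finally show "(\<integral>\<^sup>+y. ennreal (norm (y * f (t, y))) \<partial>lborel) < \<infinity>" .
    qed measurable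
    have i2: "integrable lborel (\<lambda>y. trunc (\<tau> n) y * f (t, y))"
      by (rule Bochner_Integration.integrable_bound[OF i1]) (auto simp: trunc_def abs_mult)
    have iq: "integrable lborel (\<lambda>y. \<bar>y\<bar> powr q * f (t, y))"
    proof (rule integrableI_bounded)
      have "(\<integral>\<^sup>+y. ennreal (norm (\<bar>y\<bar> powr q * f (t, y))) \<partial>lborel) = (\<integral>\<^sup>+y. ennreal (\<bar>y\<bar> powr q * f (t, y)) \<partial>lborel)"
        using f0 by (simp add: abs_mult)
      also have "\<dots> < \<infinity>" using mom[OF t] by (rule order.strict_trans1) simp
      finally show "(\<integral>\<^sup>+y. ennreal (norm (\<bar>y\<bar> powr q * f (t, y))) \<partial>lborel) < \<infinity>" .
    qed measurable
    have iqE: "(\<integral>y. \<bar>y\<bar> powr q * f (t, y) \<partial>lborel) \<le> E"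
      using mom[OF t] f0 E0 by (subst (asm) nn_integral_eq_integral[OF iq]) (auto simp: ennreal_le_iff)
    have "(\<integral>y. trunc (\<tau> n) y * f (t, y) \<partial>lborel) - (\<integral>y. y * f (t, y) \<partial>lborel) = (\<integral>y. trunc (\<tau> n) y * f (t, y) - y * f (t, y) \<partial>lborel)"
      using i1 i2 by simp
    then have "trunc_bias f (\<tau> n) t \<le> (\<integral>y. \<bar>trunc (\<tau> n) y * f (t, y) - y * f (t, y)\<bar> \<partial>lborel)"
      by (simp only: integral_abs_bound)
    also have "\<dots> \<le> (\<integral>y. (1 / \<tau> n) * (\<bar>y\<bar> powr q * f (t, y)) \<partial>lborel)"
    proof (rule integral_mono)
      fix y :: real
      show "\<bar>trunc (\<tau> n) y * f (t, y) - y * f (t, y)\<bar> \<le> (1 / \<tau> n) * (\<bar>y\<bar> powr q * f (t, y))"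
      proof (cases "\<bar>y\<bar> \<le> \<tau> n")
        case True then show ?thesis using f0 \<tau>0 by (simp add: trunc_def)
      next
        case False
        then have y: "1 \<le> \<bar>y\<bar>" "\<tau> n \<le> \<bar>y\<bar>" using \<tau>1[of n] by auto
        have "\<tau> n * \<bar>y\<bar> \<le> \<bar>y\<bar> * \<bar>y\<bar>" using y by (intro mult_right_mono) auto
        also have "\<dots> = \<bar>y\<bar> powr 2" using y by (simp add: powr_numeral power2_eq_square)
        also have "\<dots> \<le> \<bar>y\<bar> powr q" using y q by (intro powr_mono) auto
        finally have "\<bar>y\<bar> \<le> (1 / \<tau> n) * \<bar>y\<bar> powr q" using \<tau>0 by (simp add: field_simps)
        then have "\<bar>y\<bar> * f (t, y) \<le> ((1 / \<tau> n) * \<bar>y\<bar> powr q) * f (t, y)" using f0 by (intro mult_right_mono)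
        then show ?thesis using False f0 by (simp add: trunc_def abs_mult)
      qed
    qed (use i1 i2 iq in auto)
    also have "\<dots> = (1 / \<tau> n) * (\<integral>y. \<bar>y\<bar> powr q * f (t, y) \<partial>lborel)" by simp
    also have "\<dots> \<le> (1 / \<tau> n) * E" using iqE \<tau>0 by (intro mult_left_mono) auto
    finally show ?thesis by simp
  qed
  let ?m = "\<lambda>z. ennreal (\<bar>snd z\<bar> powr q) * indicator J (fst z)"
  define W where "W = E * measure lborel J"
  have W: "(\<integral>\<^sup>+z. ?m z \<partial>D) \<le> ennreal W"
  proof -
    have fm2[measurable]: "f \<in> borel_measurable (lborel \<Otimes>\<^sub>M lborel)" using fm by (simp add: lborel_prod)
    have "(\<integral>\<^sup>+z. ?m z \<partial>D)
       = (\<integral>\<^sup>+z. ennreal (f z) * ?m z \<partial>(lborel \<Otimes>\<^sub>M lborel))"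
      unfolding D_def lborel_prod using fm by (subst nn_integral_density) auto
    also have "\<dots> = (\<integral>\<^sup>+t. \<integral>\<^sup>+y. ennreal (f (t, y)) * ?m (t, y) \<partial>lborel \<partial>lborel)"
      by (rule lborel.nn_integral_fst[symmetric]) measurable
    also have "\<dots> \<le> (\<integral>\<^sup>+t. ennreal E * indicator J t \<partial>lborel)"
    proof (intro nn_integral_mono)
      fix t :: real
      show "(\<integral>\<^sup>+y. ennreal (f (t, y)) * ?m (t, y) \<partial>lborel) \<le> ennreal E * indicator J t"
      proof (cases "t \<in> J")
        case True
        then have "(\<integral>\<^sup>+y. ennreal (f (t, y)) * ?m (t, y) \<partial>lborel)
           = (\<integral>\<^sup>+y. ennreal (\<bar>y\<bar> powr q * f (t, y)) \<partial>lborel)"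
          using f0 by (intro nn_integral_cong) (simp add: ennreal_mult mult.commute)
        then show ?thesis using mom[OF True] True by simp
      qed simp
    qed
    also have "\<dots> = ennreal E * emeasure lborel J" by (simp add: nn_integral_cmult_indicator)
    also have "\<dots> = ennreal W"
      using E0 emeasure_compact_finite[OF Jc] by (simp add: W_def ennreal_mult emeasure_eq_ennreal_measure)
    finally show ?thesis .
  qed
  define A where "A i = {\<omega>\<in>space M. fst (Z i \<omega>) \<in> J \<and> \<tau> i < \<bar>snd (Z i \<omega>)\<bar>}" for i
  have Am: "A i \<in> events" for i unfolding A_def by measurable
  have W0: "0 \<le> W" using E0 by (simp add: W_def)
  have AP: "prob (A i) \<le> W * real i powr (-3/2)" if "1 \<le> i" for i
  proof -
    have i: "0 < real i" using that by simp
    have "emeasure M (A i) = (\<integral>\<^sup>+\<omega>. indicator (A i) \<omega> \<partial>M)" using Am by simp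
    also have "\<dots> \<le> (\<integral>\<^sup>+\<omega>. ennreal (real i powr (-3/2)) * ?m (Z i \<omega>) \<partial>M)"
    proof (intro nn_integral_mono)
      fix \<omega>
      show "indicator (A i) \<omega> \<le> ennreal (real i powr (-3/2)) * ?m (Z i \<omega>)"
      proof (cases "\<omega> \<in> A i")
        case True
        then have y: "fst (Z i \<omega>) \<in> J" "\<tau> i < \<bar>snd (Z i \<omega>)\<bar>" by (auto simp: A_def)
        \<comment> \<open>Raising the level to the power \<open>q\<close> turns the exponent
          \<open>3 / (2 * q)\<close> into 3/2, which lies above the summability threshold 1.\<close>
        have "real i powr (3/2) = (real i powr (3 / (2 * q))) powr q" using q by (simp add: powr_powr)
        also have "\<dots> \<le> \<bar>snd (Z i \<omega>)\<bar> powr q" using y(2) q by (intro powr_mono2) (auto simp: \<tau>_def)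
        finally have "real i powr (-3/2) * real i powr (3/2) \<le> real i powr (-3/2) * \<bar>snd (Z i \<omega>)\<bar> powr q"
          by (intro mult_left_mono) auto
        then have "1 \<le> real i powr (-3/2) * \<bar>snd (Z i \<omega>)\<bar> powr q" using i by (simp add: powr_add[symmetric])
        then have "ennreal 1 \<le> ennreal (real i powr (-3/2) * \<bar>snd (Z i \<omega>)\<bar> powr q)" by (rule ennreal_leI)
        then show ?thesis using True y by (simp add: ennreal_mult)
      qed simp
    qed
    also have "\<dots> = ennreal (real i powr (-3/2)) * (\<integral>\<^sup>+\<omega>. ?m (Z i \<omega>) \<partial>M)"
      by (rule nn_integral_cmult) measurable
    also have "(\<integral>\<^sup>+\<omega>. ?m (Z i \<omega>) \<partial>M)
        = (\<integral>\<^sup>+z. ?m z \<partial>D)"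
      unfolding dist[of i, symmetric] by (subst nn_integral_distr) auto
    also have "ennreal (real i powr (-3/2)) * \<dots> \<le> ennreal (real i powr (-3/2)) * ennreal W"
      by (intro mult_left_mono W) auto
    also have "\<dots> = ennreal (W * real i powr (-3/2))" using W0 by (simp add: ennreal_mult mult.commute)
    finally show ?thesis using W0 by (simp add: emeasure_eq_measure)
  qed
  have "summable (\<lambda>i. W * real i powr (-3/2))" by (intro summable_mult) (simp add: summable_real_powr_iff)
  then have "summable (\<lambda>i. prob (A i))"
    by (rule summable_comparison_test'[where N = 1]) (use AP in simp)
  then have bc: "AE \<omega> in M. eventually (\<lambda>i. \<omega> \<in> space M - A i) sequentially"
    using Am by (intro borel_cantelli_AE1) (auto simp: emeasure_eq_measure)
  have "truncation_sequence M Z f J a \<tau>"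
    unfolding truncation_sequence_def
  proof (intro conjI allI impI)
    show "filterlim (\<lambda>n. real n * a n / (\<tau> n * ln (real n))) at_top sequentially"
      unfolding \<tau>_def by (rule moment_rate_at_top[OF q c a])
    show "\<exists>C>0. AE t\<in>J in lborel. abs_moment f t \<le> ennreal C"
      using abs1 Cf E0 by (intro exI[of _ "Cf + E"]) auto
    show "AE \<omega> in M. eventually (\<lambda>n. \<forall>i\<in>{1..n}. fst (Z i \<omega>) \<in> J \<longrightarrow> \<bar>snd (Z i \<omega>)\<bar> \<le> \<tau> n) sequentially"
      using bc
    proof eventually_elim
      case (elim \<omega>)
      then obtain N0 where N0: "\<And>i. N0 \<le> i \<Longrightarrow> \<omega> \<in> space M - A i" unfolding eventually_sequentially by blast
      \<comment> \<open>The finitely many observations before \<open>N0\<close> may violate the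
        levels of their own indices, but together they are bounded by a fixed number that
        \<open>\<tau> n\<close> eventually passes.\<close>
      define m0 where "m0 = (\<Sum>i<N0. \<bar>snd (Z i \<omega>)\<bar>)"
      have "eventually (\<lambda>n. m0 \<le> \<tau> n) sequentially" using \<tau>inf unfolding filterlim_at_top by blast
      then show ?case
      proof eventually_elim
        case (elim n)
        show ?case
        proof (intro ballI impI)
          fix i assume i: "i \<in> {1..n}" and ZJ: "fst (Z i \<omega>) \<in> J"
          show "\<bar>snd (Z i \<omega>)\<bar> \<le> \<tau> n"
          proof (cases "N0 \<le> i")
            case True
            then have "\<bar>snd (Z i \<omega>)\<bar> \<le> \<tau> i" using N0[OF True] ZJ by (auto simp: A_def)
            also have "\<dots> \<le> \<tau> n" using i by (intro \<tau>mono) auto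
            finally show ?thesis .
          next
            case False
            then have "\<bar>snd (Z i \<omega>)\<bar> \<le> m0" unfolding m0_def by (intro member_le_sum) auto
            then show ?thesis using elim by linarith
          qed
        qed
      qed
    qed
    fix e :: real assume e: "0 < e"
    have "eventually (\<lambda>n. E / e \<le> \<tau> n) sequentially" using \<tau>inf unfolding filterlim_at_top by blast
    then show "eventually (\<lambda>n. AE t\<in>J in lborel. trunc_bias f (\<tau> n) t \<le> e) sequentially"
    proof eventually_elim
      case (elim n)
      have \<tau>0: "0 < \<tau> n" using \<tau>1[of n] by linarith
      have "E / \<tau> n \<le> e" using elim e \<tau>0 by (simp add: field_simps)
      then show ?case using bias order_trans by (intro AE_I2) blast
    qed
  qed (rule \<tau>1)
  then show ?thesis by blast
qed

section \<open>Uniform consistency\<close>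

theorem mainTheorem2:
  fixes M :: "'a measure"
    and X Y :: "nat \<Rightarrow> 'a \<Rightarrow> real"  (* index 0: the generic pair (X, Y); indices 1, 2, ...: the sample *)
    and f :: "real \<times> real \<Rightarrow> real"
    and I J :: "real set" and \<eta> :: real
    and p :: nat
    and K :: "real \<Rightarrow> real"
    and a b :: "nat \<Rightarrow> real"
  assumes "prob_space M"
    and "prob_space.indep_vars M (\<lambda>_. borel) (\<lambda>i \<omega>. (X i \<omega>, Y i \<omega>)) UNIV"
    and "\<And>z. 0 \<le> f z"
    and "\<And>i. distributed M lborel (\<lambda>\<omega>. (X i \<omega>, Y i \<omega>)) (\<lambda>z. ennreal (f z))"
    and "is_interval I" and "compact I" and "I \<noteq> {}"
    and "0 < \<eta>" and "\<eta> < 1" and "J = closed_nbhd I \<eta>"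
    and "continuous_on J (marginal_density f)"
    and "\<And>x. x \<in> J \<Longrightarrow> 0 < marginal_density f x"
    and "\<And>x. x \<in> J \<Longrightarrow> AE y in lborel. ((\<lambda>x'. f (x', y)) \<longlongrightarrow> f (x, y)) (at x)"
    and "p \<in> {0, 1, 2}"
    and "times_differentiable_on (p + 1) (regression_fun f) J"
    and "\<And>u. 0 \<le> K u" and "bounded (range K)" and "K \<in> borel_measurable borel"
    and "closure {u. K u \<noteq> 0} \<subseteq> {-1/2..1/2}"
    and "(\<integral>u. K u \<partial>lborel) = 1"
    and "pointwise_measurable_class borel (kernel_class K)"
    and "\<exists>C>0. \<exists>\<nu>>0. \<forall>\<epsilon>. 0 < \<epsilon> \<and> \<epsilon> < 1 \<longrightarrow>
           ereal_of_enat (uniform_covering_number borel (\<lambda>_. sup_norm K) \<epsilon> (kernel_class K))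
             \<le> ereal (C * \<epsilon> powr (- \<nu>))"
    and "\<And>n. 2 \<le> n \<Longrightarrow> 0 < a n"
    and "((\<exists>B>0. AE \<omega> in M. \<bar>Y 0 \<omega>\<bar> * indicator J (X 0 \<omega>) \<le> B) \<and>
            antimono_on {1..} a \<and> a \<longlonglongrightarrow> 0 \<and>
            filterlim (\<lambda>n. real n * a n / ln (real n)) at_top sequentially)
         \<or> (\<exists>q>2. (SUP z\<in>J. cond_nn_expectation f (\<lambda>y. \<bar>y\<bar> powr q) z) < \<infinity> \<and>
            (\<exists>c>0. \<forall>n\<ge>2. a n = c * (ln (real n) / real n) powr (1 - 2 / q)))"
    and "\<And>n. 1 \<le> n \<Longrightarrow> a n < b n"
    and "antimono_on {1..} b" and "b \<longlonglongrightarrow> 0"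
  shows "AE \<omega> in M.
           (\<forall>\<^sub>F n in sequentially. \<forall>x\<^sub>0\<in>I. \<forall>h\<in>{a n..b n}.
              lp_well_defined K p (\<lambda>i. X i \<omega>) (\<lambda>i. Y i \<omega>) n h x\<^sub>0) \<and>
           (\<lambda>n. SUP h\<in>{a n..b n}. SUP x\<^sub>0\<in>I.
              ennreal \<bar>lp_estimator K p (\<lambda>i. X i \<omega>) (\<lambda>i. Y i \<omega>) n h x\<^sub>0 - regression_fun f x\<^sub>0\<bar>)
             \<longlonglongrightarrow> 0"
proof -
  let ?w = "\<lambda>\<omega> x h k i. ((X i \<omega> - x) / h) ^ k * K ((x - X i \<omega>) / h)"
  let ?fX = "marginal_density f" and ?g = "regression_fun f"
  let ?R1 = "\<lambda>t. \<integral>y. y * f (t, y) \<partial>lborel"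
  note M = assms(1) and ind = assms(2) and f0 = assms(3) and distrib = assms(4)
  note I = assms(6,7) and \<eta> = assms(8) and J_def = assms(10) and fXc = assms(11) and fXp = assms(12) and gd = assms(15)
  note K0 = assms(16) and Kb = assms(17) and Km = assms(18) and Ksupp = assms(19) and K1 = assms(20) and pm = assms(21)
  note ucn = assms(22) and apos = assms(23) and cases = assms(24) and ab = assms(25) and blim = assms(27)
  interpret prob_space M by (rule M)
  define Z where "Z i \<omega> = (X i \<omega>, Y i \<omega>)" for i \<omega>
  define D where "D = law f"
  have indZ: "indep_vars (\<lambda>_. borel) Z UNIV" using ind unfolding Z_def[abs_def] .
  have Zm: "Z i \<in> borel_measurable M" for i using indZ by (auto simp: indep_vars_def)
  \<comment> \<open>By nonnegativity, \<open>f\<close> is recovered from its extended-valued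
    version, whose measurability is part of being a density.\<close>
  have fm: "f \<in> borel_measurable borel"
  proof -
    have "(\<lambda>z. ennreal (f z)) \<in> borel_measurable borel" using distributed_borel_measurable[OF distrib[of 0]] by simp
    then have "(\<lambda>z. enn2real (ennreal (f z))) \<in> borel_measurable borel" by measurable
    then show ?thesis using f0 by simp
  qed
  have distZ: "distr M borel (Z i) = D" for i
  proof -
    have "distr M borel (Z i) = distr M lborel (Z i)" by (rule distr_cong) auto
    also have "\<dots> = D" using distributed_distr_eq_density[OF distrib[of i]] by (simp add: D_def Z_def[abs_def])
    finally show ?thesis .
  qed
  define \<kappa> where "\<kappa> = sup_norm K"
  have K\<kappa>: "\<bar>K u\<bar> \<le> \<kappa>" for u
  proof -
    obtain B where "\<And>u. \<bar>K u\<bar> \<le> B" using Kb by (auto simp: bounded_iff)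
    then have "bdd_above (range (\<lambda>u. \<bar>K u\<bar>))" by (intro bdd_aboveI2)
    then show ?thesis unfolding \<kappa>_def sup_norm_def by (rule cSUP_upper[OF UNIV_I])
  qed
  have \<kappa>: "0 < \<kappa>"
  proof (rule ccontr)
    assume "\<not> 0 < \<kappa>"
    then have "K u = 0" for u using K\<kappa>[of u] by linarith
    with K1 show False by simp
  qed
  have K\<kappa>': "K u \<le> \<kappa>" for u using K\<kappa>[of u] by linarith
  have Ks: "K u = 0" if "1/2 < \<bar>u\<bar>" for u
  proof (rule ccontr)
    assume "K u \<noteq> 0"
    then have "u \<in> closure {u. K u \<noteq> 0}" by (intro subsetD[OF closure_subset]) simp
    then have "u \<in> {-1/2..1/2}" using Ksupp by (rule subsetD[rotated])
    with that show False by auto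
  qed
  have cov: "\<exists>N. L1_cover (kernel_class K) \<kappa> \<delta> N" if "0 < \<delta>" for \<delta>
  proof -
    obtain C \<nu> where u: "\<And>\<epsilon>. 0 < \<epsilon> \<Longrightarrow> \<epsilon> < 1 \<Longrightarrow>
       ereal_of_enat (uniform_covering_number borel (\<lambda>_. \<kappa>) \<epsilon> (kernel_class K)) \<le> ereal (C * \<epsilon> powr (- \<nu>))"
      using ucn unfolding \<kappa>_def by blast
    \<comment> \<open>The cap at 1/2 keeps \<epsilon> in the range below 1 for which the covering
      bound is assumed.\<close>
    define \<epsilon> where "\<epsilon> = min (1/2) (\<delta> / \<kappa>)"
    have \<epsilon>: "0 < \<epsilon>" "\<epsilon> < 1" "\<epsilon> * \<kappa> \<le> \<delta>"
      using that \<kappa> by (auto simp: \<epsilon>_def min_def field_simps)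
    have "\<exists>N. L1_cover (kernel_class K) \<kappa> (\<epsilon> * \<kappa>) N"
    proof (rule uniform_covering_number_L1_cover[OF \<kappa> _ _ u[OF \<epsilon>(1,2)]])
      show "v \<in> borel_measurable borel" if "v \<in> kernel_class K" for v
        using that Km by (auto simp: kernel_class_def)
      show "\<bar>v t\<bar> \<le> \<kappa>" if "v \<in> kernel_class K" for v t using that K\<kappa> by (auto simp: kernel_class_def)
    qed
    then show ?thesis using L1_cover_mono[OF _ order_refl \<epsilon>(3)] by blast
  qed
  have Jc: "compact J"
  proof -
    \<comment> \<open>\<open>J\<close> is the Minkowski sum of two compact sets.\<close>
    have "J = (\<Union>x\<in>I. \<Union>y\<in>{-\<eta>..\<eta>}. {x + y})"
    proof (intro set_eqI iffI)
      fix t assume "t \<in> J"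
      then obtain x where "x \<in> I" "\<bar>t - x\<bar> \<le> \<eta>" unfolding J_def closed_nbhd_def by blast
      then show "t \<in> (\<Union>x\<in>I. \<Union>y\<in>{-\<eta>..\<eta>}. {x + y})" by (intro UN_I[of x] UN_I[of "t - x"]) (auto simp: abs_le_iff)
    next
      fix t assume "t \<in> (\<Union>x\<in>I. \<Union>y\<in>{-\<eta>..\<eta>}. {x + y})"
      then obtain x y where "x \<in> I" "y \<in> {-\<eta>..\<eta>}" "t = x + y" by blast
      then show "t \<in> J" unfolding J_def closed_nbhd_def by (auto intro!: bexI[of _ x] simp: abs_le_iff)
    qed
    then show ?thesis using compact_sums'[OF I(1) compact_Icc] by simp
  qed
  have nb: "{x - \<eta>..x + \<eta>} \<subseteq> J" if "x \<in> I" for x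
    unfolding J_def closed_nbhd_def using that by (auto intro!: bexI[of _ x] simp: abs_le_iff)
  have IJ: "x \<in> J" if "x \<in> I" for x using nb[OF that] \<eta> by (auto simp: subset_iff)
  have Jne: "J \<noteq> {}" using IJ I(2) by blast
  \<comment> \<open>The minimum of the design density keeps the limiting quadratic form away from 0,
    and its maximum bounds the mass of the cells.\<close>
  obtain t0 where t0: "t0 \<in> J" "\<And>t. t \<in> J \<Longrightarrow> ?fX t0 \<le> ?fX t"
    using continuous_attains_inf[OF Jc Jne fXc] by blast
  obtain t1 where t1: "t1 \<in> J" "\<And>t. t \<in> J \<Longrightarrow> ?fX t \<le> ?fX t1"
    using continuous_attains_sup[OF Jc Jne fXc] by blast
  define Cf where "Cf = ?fX t1"
  have Cf: "0 < Cf" using fXp[OF t1(1)] by (simp add: Cf_def)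
  \<comment> \<open>Differentiability relative to \<open>J\<close> gives continuity up to the end
    points, and with it continuity of the limit \<open>?R1\<close> of the response moments.\<close>
  have gc: "continuous_on J ?g"
  proof -
    obtain Df where Df: "\<And>x. x \<in> J \<Longrightarrow> Df 0 x = ?g x" "\<And>k x. k < p + 1 \<Longrightarrow> x \<in> J \<Longrightarrow> (Df k has_real_derivative Df (Suc k) x) (at x within J)"
      using gd unfolding times_differentiable_on_def by blast
    have "continuous_on J (Df 0)"
      unfolding continuous_on_eq_continuous_within by (intro ballI DERIV_continuous[OF Df(2)[of 0]]) auto
    then show ?thesis using Df(1) by (simp cong: continuous_on_cong)
  qed
  have R1: "?R1 t = ?g t * ?fX t" if "t \<in> J" for t
    using fXp[OF that] by (simp add: regression_fun_def)
  have R1c: "continuous_on J ?R1"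
  proof -
    have "continuous_on J (\<lambda>t. ?g t * ?fX t)" by (intro continuous_intros gc fXc)
    then show ?thesis using R1 by (simp cong: continuous_on_cong)
  qed
  obtain G where G: "\<And>x. x \<in> J \<Longrightarrow> \<bar>?g x\<bar> \<le> G"
    using compact_imp_bounded[OF compact_continuous_image[OF gc Jc]] by (auto simp: bounded_iff)
  have apos': "eventually (\<lambda>n. 0 < a n) sequentially"
    using eventually_ge_at_top[of 2] by eventually_elim (rule apos)
  \<comment> \<open>Squeezing between 0 and \<open>b\<close> treats both alternatives for
    \<open>a\<close> alike.\<close>
  have alim: "a \<longlonglongrightarrow> 0"
  proof (rule tendsto_sandwich[OF _ _ tendsto_const blim])
    show "eventually (\<lambda>n. 0 \<le> a n) sequentially" using apos' by eventually_elim simp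
    show "eventually (\<lambda>n. a n \<le> b n) sequentially"
      using eventually_ge_at_top[of 1] by eventually_elim (rule less_imp_le[OF ab])
  qed
  have "\<exists>\<tau>. truncation_sequence M Z f J a \<tau>"
    using cases
  proof (elim disjE conjE exE)
    fix B assume B: "0 < B" "AE \<omega> in M. \<bar>Y 0 \<omega>\<bar> * indicator J (X 0 \<omega>) \<le> B"
      and rate: "filterlim (\<lambda>n. real n * a n / ln (real n)) at_top sequentially"
    show ?thesis
      by (rule bounded_truncation_sequence[OF Zm distZ[unfolded D_def] f0 fm borel_compact[OF Jc] fXp _ B(1) _ Cf rate])
         (use B(2) t1(2) in \<open>auto simp: Z_def Cf_def\<close>)
  next
    fix q c assume q: "2 < q" and fin: "(SUP z\<in>J. cond_nn_expectation f (\<lambda>y. \<bar>y\<bar> powr q) z) < \<infinity>"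
      and c: "0 < c" and a: "\<forall>n\<ge>2. a n = c * (ln (real n) / real n) powr (1 - 2 / q)"
    show ?thesis
      by (rule moment_truncation_sequence[OF Zm distZ[unfolded D_def] f0 fm Jc fXp _ Cf q fin c])
         (use a t1(2) in \<open>auto simp: Cf_def\<close>)
  qed
  then obtain \<tau> C1 where \<tau>1: "\<And>n. 1 \<le> \<tau> n"
    and rate: "filterlim (\<lambda>n. real n * a n / (\<tau> n * ln (real n))) at_top sequentially"
    and ytrunc: "AE \<omega> in M. eventually (\<lambda>n. \<forall>i\<in>{1..n}. fst (Z i \<omega>) \<in> J \<longrightarrow> \<bar>snd (Z i \<omega>)\<bar> \<le> \<tau> n) sequentially"
    and C1: "0 < C1" "AE t\<in>J in lborel. abs_moment f t \<le> ennreal C1"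
    and tbias: "\<And>e. 0 < e \<Longrightarrow> eventually (\<lambda>n. AE t\<in>J in lborel. \<bar>(\<integral>y. trunc (\<tau> n) y * f (t, y) \<partial>lborel) - ?R1 t\<bar> \<le> e) sequentially"
    unfolding truncation_sequence_def by blast
  have tm: "trunc c \<in> borel_measurable borel" for c unfolding trunc_def[abs_def] by measurable
  have tB: "\<bar>trunc (\<tau> n) y\<bar> \<le> \<tau> n" for n y using \<tau>1[of n] by (auto simp: trunc_def)
  \<comment> \<open>The moments of the design are the case of a constant 1. It lies below every
    level \<open>\<tau> n\<close>, so the same rate condition serves here.\<close>
  have S: "AE \<omega> in M. \<forall>e>0. eventually (\<lambda>n. \<forall>x\<in>I. \<forall>h\<in>{a n..b n}. \<forall>k\<le>2*p.
     \<bar>(\<Sum>i=1..n. ((fst (Z i \<omega>) - x) / h) ^ k * K ((x - fst (Z i \<omega>)) / h) * 1) / (real n * h)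
        - ?fX x * kernel_moment K k\<bar> \<le> e) sequentially"
  proof (rule local_moment_convergence[where \<psi> = "\<lambda>_ _. 1" and R = ?fX, OF indZ distZ[unfolded D_def] f0 fm Km K0 K\<kappa>' \<kappa> Ks K1 pm cov _ _ \<tau>1 Cf _ apos' alim blim rate Jc \<eta> nb fXc])
    show "AE t\<in>J in lborel. (\<integral>\<^sup>+y. ennreal (\<bar>1\<bar> * f (t, y)) \<partial>lborel) \<le> ennreal Cf" for n :: nat
    proof (intro AE_I2 impI)
      fix t assume t: "t \<in> J"
      show "(\<integral>\<^sup>+y. ennreal (\<bar>1\<bar> * f (t, y)) \<partial>lborel) \<le> ennreal Cf"
        using marginal_density_nn_integral[OF f0 fXp[OF t]] t1(2)[OF t] by (simp add: Cf_def ennreal_leI)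
    qed
  qed (use \<tau>1 in \<open>auto simp: marginal_density_def\<close>)
  have T: "AE \<omega> in M. \<forall>e>0. eventually (\<lambda>n. \<forall>x\<in>I. \<forall>h\<in>{a n..b n}. \<forall>k\<le>2*p.
     \<bar>(\<Sum>i=1..n. ((fst (Z i \<omega>) - x) / h) ^ k * K ((x - fst (Z i \<omega>)) / h) * trunc (\<tau> n) (snd (Z i \<omega>))) / (real n * h)
        - ?R1 x * kernel_moment K k\<bar> \<le> e) sequentially"
  proof (rule local_moment_convergence[where \<psi> = "\<lambda>n. trunc (\<tau> n)" and R = ?R1, OF indZ distZ[unfolded D_def] f0 fm Km K0 K\<kappa>' \<kappa> Ks K1 pm cov tm tB \<tau>1 C1(1) _ apos' alim blim rate Jc \<eta> nb R1c tbias])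
    show "AE t\<in>J in lborel. (\<integral>\<^sup>+y. ennreal (\<bar>trunc (\<tau> n) y\<bar> * f (t, y)) \<partial>lborel) \<le> ennreal C1" for n
      using C1(2)
    proof eventually_elim
      case (elim t)
      have "(\<integral>\<^sup>+y. ennreal (\<bar>trunc (\<tau> n) y\<bar> * f (t, y)) \<partial>lborel) \<le> abs_moment f t"
        using f0 by (intro nn_integral_mono ennreal_leI mult_right_mono) (auto simp: trunc_def)
      then show ?case using elim by (auto intro: order_trans)
    qed
  qed
  show ?thesis
    using S T ytrunc
  proof eventually_elim
    case (elim \<omega>)
    have evb: "eventually (\<lambda>n. b n < \<eta>) sequentially" using blim \<eta> by (rule order_tendstoD)
    have conv: "eventually (\<lambda>n. \<forall>x\<in>I. \<forall>h\<in>{a n..b n}. \<forall>k\<le>2*p.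
       \<bar>(\<Sum>i=1..n. ?w \<omega> x h k i) / (real n * h) - ?fX x * kernel_moment K k\<bar> \<le> e \<and>
       \<bar>(\<Sum>i=1..n. ?w \<omega> x h k i * Y i \<omega>) / (real n * h) - ?g x * ?fX x * kernel_moment K k\<bar> \<le> e)
       sequentially" if e: "0 < e" for e
      using elim(1)[rule_format, OF e] elim(2)[rule_format, OF e] elim(3) evb apos'
    proof eventually_elim
      case (elim n)
      show ?case
      proof (intro ballI allI impI conjI)
        fix x h k assume x: "x \<in> I" and h: "h \<in> {a n..b n}" and k: "k \<le> 2 * p"
        show "\<bar>(\<Sum>i=1..n. ?w \<omega> x h k i) / (real n * h) - ?fX x * kernel_moment K k\<bar> \<le> e"
          using elim(1)[rule_format, OF x h k] by (simp add: Z_def)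
        have h0: "0 < h" "h < \<eta>" using h elim(4,5) by auto
        \<comment> \<open>Where the kernel is nonzero the design point lies in \<open>J\<close>, and
          there no response exceeds the level for this \<open>n\<close>; elsewhere both summands
          vanish. Truncation therefore leaves the empirical moments exactly unchanged.\<close>
        have "(\<Sum>i=1..n. ?w \<omega> x h k i * trunc (\<tau> n) (Y i \<omega>))
            = (\<Sum>i=1..n. ?w \<omega> x h k i * Y i \<omega>)"
        proof (intro sum.cong refl)
          fix i assume i: "i \<in> {1..n}"
          show "?w \<omega> x h k i * trunc (\<tau> n) (Y i \<omega>) = ?w \<omega> x h k i * Y i \<omega>"
          proof (cases "\<bar>(x - X i \<omega>) / h\<bar> \<le> 1/2")
            case True
            then have "\<bar>x - X i \<omega>\<bar> \<le> h / 2" using h0 by (simp add: abs_divide field_simps)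
            then have "X i \<omega> \<in> {x - \<eta>..x + \<eta>}" using h0 unfolding abs_le_iff atLeastAtMost_iff by linarith
            then have "X i \<omega> \<in> J" using nb[OF x] by blast
            then have "\<bar>Y i \<omega>\<bar> \<le> \<tau> n" using elim(3) i by (auto simp: Z_def)
            then show ?thesis by (simp add: trunc_def)
          next
            case False then show ?thesis using Ks by simp
          qed
        qed
        then show "\<bar>(\<Sum>i=1..n. ?w \<omega> x h k i * Y i \<omega>) / (real n * h) - ?g x * ?fX x * kernel_moment K k\<bar> \<le> e"
          using elim(2)[rule_format, OF x h k] R1[OF IJ[OF x]] by (simp add: Z_def)
      qed
    qed
    have fmin: "0 < ?fX t0" "\<And>x. x \<in> I \<Longrightarrow> ?fX t0 \<le> ?fX x" using t0 fXp IJ by auto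
    have Gb: "\<And>x. x \<in> I \<Longrightarrow> \<bar>?g x\<bar> \<le> G" using G IJ by auto
    show ?case
      using lp_uniform_conclusion[where \<phi> = ?fX and g = ?g and xs = "\<lambda>i. X i \<omega>" and ys = "\<lambda>i. Y i \<omega>", OF Km K0 K\<kappa>' Ks K1 fmin Gb apos' conv]
      by simp
  qed
qed

end
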